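(* Let $H$ be the generic Hecke algebra over $\mathbf Z[q_*]$ of the Weyl group $W=W_oe^X$ of a reduced based root datum and let $A\subset H[q_*^{-1/2}]$ be the commutative subalgebra spanned over $\mathbf Z[q_*^{\pm 1/2}]$ by the $\tilde\theta_x$, $x\in X$. Then: (1) $H\cap A$ is a free $\mathbf Z[q_*]$-module with basis $(E_x)_{x\in X}$, where $E_x=q_x^{1/2}\tilde\theta_x$; (2) $H$ is a finitely generated right $H\cap A$-module.
   Context: Root datum. $(X,X^\vee,R,R^\vee,B)$ is a reduced based root datum: $X,X^\vee$ are free abelian groups of finite rank $\ge 1$ in perfect duality $(\ ,\ ):X\times X^\vee\to\mathbf Z$; $R\subset X$, $R^\vee\subset X^\vee$ are finite nonempty sets of roots and coroots in bijection $\alpha\leftrightarrow\alpha^\vee$ with $(\alpha,\alpha^\vee)=2$; the reflections $s_\alpha(x)=x-(x,\alpha^\vee)\alpha$ preserve $R$ and the dual reflections preserve $R^\vee$; $R$ is reduced; $B$ is a basis of $R$, defining positive roots $R^+$ and negative roots $R^-$. $x\in X$ is dominant if $(x,\beta^\vee)\ge 0$ for all $\beta\in B$. Weyl groups. $W_o\subset GL(X)$ is the finite group generated by the $s_\alpha$, $\alpha\in R$. $W=W_o\ltimes X$; $x\in X$ is written $e^x$ in $W$, so $w_oe^xw_o^{-1}=e^{w_o(x)}$. $W_{aff}=W_o\ltimes Q(R)$, with $Q(R)\subset X$ the subgroup generated by $R$. $R_m$ is the set of roots $\alpha$ whose coroot $\alpha^\vee$ is minimal in $R^\vee$ for the order: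 $\alpha_1^\vee\preceq\alpha_2^\vee$ iff $\alpha_2^\vee-\alpha_1^\vee\in\sum_{\beta\in B}\mathbf N\beta^\vee$. With $S=\{s_\beta:\beta\in B\}\cup\{s_\alpha e^{\alpha}:\alpha\in R_m\}$, $(W_{aff},S)$ is a Coxeter system. The length on $W$, extending that of $(W_{aff},S)$, is $\ell(w_oe^x)=\sum_{\alpha\in R^+,w_o(\alpha)\in R^+}|(x,\alpha^\vee)|+\sum_{\alpha\in R^+,w_o(\alpha)\in R^-}|1+(x,\alpha^\vee)|$. $\Omega$ is the subgroup of elements of length $0$; it normalizes $S$ and $W=\Omega W_{aff}$ (semi-direct product). Generic weights. $(q_s)_{s\in S}$ are indeterminates with $q_s=q_{s'}$ iff $s,s'$ are conjugate in $W$ (independent otherwise); $\mathbf Z[q_*]$ is the polynomial ring they generate. For $w=us_1\cdots s_n$ with $u\in\Omega$ and $s_1\cdots s_n$ a reduced expression in $W_{aff}$, $q_w=q_{s_1}\cdots q_{s_n}$; $q_x:=q_{e^x}$. One also adjoins indeterminates $q_s^{1/2}$ with squares $q_s$ (equal for conjugate $s$), and $q_w^{1/2}$ is the corresponding monomial. Hecke algebra. $H$ is the $\mathbf Z[q_*]$-algebra, free as a module with basis $(T_w)_{w\in W}$, with $(T_s+1)(T_s-q_s)=0$ for $s\in S$ and $T_{ww'}=T_wT_{w'}$ if $\ell(ww')=\ell(w)+\ell(w')$. $H[q_*^{-1/2}]=H\otimes_{\mathbf Z[q_*]}\mathbf Z[q_*^{\pm1/2}]$; in it the $T_w$ are invertible,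 and $\tilde T_w:=q_w^{-1/2}T_w$. For $x\in X$, $\tilde\theta_x:=\tilde T_{e^y}\tilde T_{e^z}^{-1}$, where $x=y-z$ with $y,z$ dominant (independent of the choice). By Bernstein–Lusztig, $x\mapsto\tilde\theta_x$ induces an isomorphism of algebras $\mathbf Z[q_*^{\pm1/2}][X]\simeq A$. *)

theory Defs
  imports
    Complex_Main
    "HOL-Algebra.Generated_Groups"
    "HOL-Library.Poly_Mapping"
begin

section \<open>Modules\<close>

text \<open>The module structure over the integers carried by every abelian group.\<close>

definition zscale :: "int \<Rightarrow> 'a::ab_group_add \<Rightarrow> 'a" where
  "zscale n x = (if 0 \<le> n then (((+) x) ^^ nat n) 0 else - ((((+) x) ^^ nat (- n)) 0))"

lemma zscale_of_nat_add: "(((+) (x::'a::ab_group_add)) ^^ (m + n)) 0 = (((+) x) ^^ m) 0 + (((+) x) ^^ n) 0"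
  by (induction m) (auto simp: add.assoc)

lemma zscale_diff: "zscale (int m - int n) x = (((+) x) ^^ m) 0 - (((+) x) ^^ n) 0"
proof (cases "n \<le> m")
  case True
  then obtain k where "m = n + k" by (rule less_eqE)
  then show ?thesis by (simp add: zscale_def zscale_of_nat_add)
next
  case False
  then obtain k where k: "n = m + Suc k"
    using less_imp_Suc_add[of m n] by auto
  then have "int m - int n < 0" "nat (- (int m - int n)) = Suc k"
    by simp_all
  then have "zscale (int m - int n) x = - ((((+) x) ^^ Suc k) 0)"
    by (simp only: zscale_def not_le[symmetric] if_False)
  then show ?thesis
    by (simp only: k zscale_of_nat_add) simp
qed

lemma zscale_add_left: "zscale (a + b) x = zscale a x + zscale b x"
proof -
  obtain m n where a: "a = int m - int n" by (rule int_diff_cases)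
  obtain m' n' where b: "b = int m' - int n'" by (rule int_diff_cases)
  have "a + b = int (m + m') - int (n + n')" using a b by simp
  then have "zscale (a + b) x = (((+) x) ^^ (m+m')) 0 - (((+) x) ^^ (n+n')) 0"
    by (simp only: zscale_diff)
  then show ?thesis by (simp add: a b zscale_diff zscale_of_nat_add)
qed

lemma zscale_1: "zscale 1 x = x" by (simp add: zscale_def)
lemma zscale_0: "zscale 0 x = 0" by (simp add: zscale_def)
lemma zscale_diff_left: "zscale (a - b) x = zscale a x - zscale b x"
  using zscale_add_left[of "a - b" b x] by simp

lemma zscale_add_right: "zscale a (x + y) = zscale a x + zscale a y"
  by (induction a rule: int_induct[where k = 0])
     (simp_all add: zscale_0 zscale_1 zscale_add_left zscale_diff_left)

lemma zscale_zscale: "zscale a (zscale b x) = zscale (a * b) x"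
  by (induction a rule: int_induct[where k = 0])
     (simp_all add: zscale_0 zscale_1 zscale_add_left zscale_diff_left distrib_right left_diff_distrib)

lemma module_zscale: "module zscale"
  by unfold_locales (auto simp: zscale_1 zscale_add_left zscale_add_right zscale_zscale)

text \<open>The family \<open>(b i)\<close>, \<open>i \<in> I\<close>, is a basis of the submodule \<open>M\<close>.\<close>

definition is_basis ::
    "('r::comm_ring_1 \<Rightarrow> 'm::ab_group_add \<Rightarrow> 'm) \<Rightarrow> 'm set \<Rightarrow> 'i set \<Rightarrow> ('i \<Rightarrow> 'm) \<Rightarrow> bool" where
  "is_basis scale M I b \<longleftrightarrow>
     inj_on b I \<and> \<not> module.dependent scale (b ` I) \<and> module.span scale (b ` I) = M"

definition free_of_finite_positive_rank :: "'a::ab_group_add itself \<Rightarrow> bool" where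
  "free_of_finite_positive_rank _ \<longleftrightarrow>
     (\<exists>b :: 'a set. finite b \<and> b \<noteq> {} \<and> is_basis zscale UNIV b id)"

definition is_subring :: "'a::ring_1 set \<Rightarrow> bool" where
  "is_subring A \<longleftrightarrow> 1 \<in> A \<and> (\<forall>x\<in>A. \<forall>y\<in>A. x - y \<in> A \<and> x * y \<in> A)"

text \<open>\<open>M\<close> is a finitely generated right module over the subring \<open>A\<close>, for the multiplication of
  the ambient ring.\<close>

definition fg_right_module :: "'a::ring_1 set \<Rightarrow> 'a set \<Rightarrow> bool" where
  "fg_right_module M A \<longleftrightarrow>
     is_subring A \<and> 0 \<in> M \<and> (\<forall>x\<in>M. \<forall>y\<in>M. x - y \<in> M) \<and> (\<forall>x\<in>M. \<forall>a\<in>A. x * a \<in> M) \<and>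
     (\<exists>F. finite F \<and> F \<subseteq> M \<and> (\<forall>x\<in>M. \<exists>a. (\<forall>f\<in>F. a f \<in> A) \<and> x = (\<Sum>f\<in>F. f * a f)))"

definition ring_inverse :: "'a::ring_1 \<Rightarrow> 'a" where
  "ring_inverse a = (THE b. a * b = 1 \<and> b * a = 1)"

locale algebra_over = module scale
  for scale :: "'r::comm_ring_1 \<Rightarrow> 'a::ring_1 \<Rightarrow> 'a" +
  assumes scale_mult_left: "scale r (a * b) = scale r a * b"
    and scale_mult_right: "scale r (a * b) = a * scale r b"


section \<open>Reduced based root data\<close>

record ('x, 'y) root_datum =
  pairing :: "'x \<Rightarrow> 'y \<Rightarrow> int"
  roots :: "'x set"
  coroots :: "'y set"
  coroot :: "'x \<Rightarrow> 'y"
  simple_roots :: "'x set"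

definition reflection :: "('x::ab_group_add, 'y) root_datum \<Rightarrow> 'x \<Rightarrow> 'x \<Rightarrow> 'x" where
  "reflection D \<alpha> x = x - zscale (pairing D x (coroot D \<alpha>)) \<alpha>"

definition coreflection :: "('x, 'y::ab_group_add) root_datum \<Rightarrow> 'x \<Rightarrow> 'y \<Rightarrow> 'y" where
  "coreflection D \<alpha> y = y - zscale (pairing D \<alpha> y) (coroot D \<alpha>)"

definition nat_span :: "'a::ab_group_add set \<Rightarrow> 'a set" where
  "nat_span b = {(\<Sum>v\<in>b. zscale (int (n v)) v) | n. True}"

definition pos_roots :: "('x::ab_group_add, 'y) root_datum \<Rightarrow> 'x set" where
  "pos_roots D = roots D \<inter> nat_span (simple_roots D)"

definition neg_roots :: "('x::ab_group_add, 'y) root_datum \<Rightarrow> 'x set" where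
  "neg_roots D = roots D \<inter> uminus ` nat_span (simple_roots D)"

definition perfect_pairing :: "('x::ab_group_add \<Rightarrow> 'y::ab_group_add \<Rightarrow> int) \<Rightarrow> bool" where
  "perfect_pairing p \<longleftrightarrow>
     (\<forall>y. additive (\<lambda>x. p x y)) \<and> (\<forall>x. additive (p x)) \<and>
     (\<forall>f. additive f \<longrightarrow> (\<exists>!y. f = (\<lambda>x. p x y))) \<and>
     (\<forall>g. additive g \<longrightarrow> (\<exists>!x. g = p x))"

locale reduced_based_root_datum =
  fixes D :: "('x::ab_group_add, 'y::ab_group_add) root_datum"
  assumes free_X: "free_of_finite_positive_rank TYPE('x)"
    and free_Y: "free_of_finite_positive_rank TYPE('y)"
    and perfect: "perfect_pairing (pairing D)"
    and finite_roots: "finite (roots D)"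
    and roots_nonempty: "roots D \<noteq> {}"
    and coroot_bij: "bij_betw (coroot D) (roots D) (coroots D)"
    and pairing_coroot: "\<alpha> \<in> roots D \<Longrightarrow> pairing D \<alpha> (coroot D \<alpha>) = 2"
    and reflection_roots: "\<alpha> \<in> roots D \<Longrightarrow> reflection D \<alpha> ` roots D = roots D"
    and coreflection_coroots: "\<alpha> \<in> roots D \<Longrightarrow> coreflection D \<alpha> ` coroots D = coroots D"
    and reduced: "\<lbrakk>\<alpha> \<in> roots D; \<beta> \<in> roots D; m \<noteq> 0; zscale m \<beta> = zscale n \<alpha>\<rbrakk>
                    \<Longrightarrow> \<beta> = \<alpha> \<or> \<beta> = - \<alpha>"
    and simple_subset: "simple_roots D \<subseteq> roots D"
    and simple_independent: "\<not> module.dependent zscale (simple_roots D)"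
    and pos_or_neg: "roots D = pos_roots D \<union> neg_roots D"

definition dominant :: "('x, 'y) root_datum \<Rightarrow> 'x \<Rightarrow> bool" where
  "dominant D x \<longleftrightarrow> (\<forall>\<beta>\<in>simple_roots D. 0 \<le> pairing D x (coroot D \<beta>))"


section \<open>Weyl groups\<close>

definition GL :: "('x::ab_group_add \<Rightarrow> 'x) monoid" where
  "GL = \<lparr>carrier = {f. bij f \<and> additive f}, monoid.mult = (\<circ>), one = id\<rparr>"

definition finite_weyl :: "('x::ab_group_add, 'y) root_datum \<Rightarrow> ('x \<Rightarrow> 'x) set" where
  "finite_weyl D = generate GL (reflection D ` roots D)"

text \<open>The pair \<open>(v, x)\<close> stands for the element \<open>v e\<^sup>x\<close> of the semidirect product; thus
  \<open>(v e\<^sup>x) (v' e\<^sup>x\<^sup>') = v v' e\<^sup>z\<close> with \<open>z = v'\<^sup>-\<^sup>1(x) + x'\<close>.\<close>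

type_synonym 'x weyl = "('x \<Rightarrow> 'x) \<times> 'x"

definition weyl_group :: "('x::ab_group_add, 'y) root_datum \<Rightarrow> 'x weyl monoid" where
  "weyl_group D =
     \<lparr>carrier = finite_weyl D \<times> UNIV,
      monoid.mult = (\<lambda>(v, x) (v', x'). (v \<circ> v', inv_into UNIV v' x + x')),
      one = (id, 0)\<rparr>"

definition transl :: "'x \<Rightarrow> 'x weyl" where
  "transl x = (id, x)"

definition coroot_le :: "('x, 'y::ab_group_add) root_datum \<Rightarrow> 'y \<Rightarrow> 'y \<Rightarrow> bool" where
  "coroot_le D a b \<longleftrightarrow> b - a \<in> nat_span (coroot D ` simple_roots D)"

definition min_coroot_roots :: "('x, 'y::ab_group_add) root_datum \<Rightarrow> 'x set" where
  "min_coroot_roots D =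
     {\<alpha> \<in> roots D. \<forall>b\<in>coroots D. coroot_le D b (coroot D \<alpha>) \<longrightarrow> b = coroot D \<alpha>}"

definition simple_reflections :: "('x::ab_group_add, 'y::ab_group_add) root_datum \<Rightarrow> 'x weyl set" where
  "simple_reflections D =
     {(reflection D \<beta>, 0) | \<beta>. \<beta> \<in> simple_roots D} \<union>
     {(reflection D \<alpha>, \<alpha>) | \<alpha>. \<alpha> \<in> min_coroot_roots D}"

fun len :: "('x::ab_group_add, 'y) root_datum \<Rightarrow> 'x weyl \<Rightarrow> nat" where
  "len D (v, x) =
     (\<Sum>\<alpha>\<in>{\<alpha> \<in> pos_roots D. v \<alpha> \<in> pos_roots D}. nat \<bar>pairing D x (coroot D \<alpha>)\<bar>) +
     (\<Sum>\<alpha>\<in>{\<alpha> \<in> pos_roots D. v \<alpha> \<in> neg_roots D}. nat \<bar>1 + pairing D x (coroot D \<alpha>)\<bar>)"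

definition Omega :: "('x::ab_group_add, 'y) root_datum \<Rightarrow> 'x weyl set" where
  "Omega D = {u \<in> carrier (weyl_group D). len D u = 0}"

definition conjugate :: "('g, 'b) monoid_scheme \<Rightarrow> 'g \<Rightarrow> 'g \<Rightarrow> bool" where
  "conjugate G s t \<longleftrightarrow> (\<exists>g\<in>carrier G. t = g \<otimes>\<^bsub>G\<^esub> s \<otimes>\<^bsub>G\<^esub> inv\<^bsub>G\<^esub> g)"

definition list_prod :: "('g, 'b) monoid_scheme \<Rightarrow> 'g list \<Rightarrow> 'g" where
  "list_prod G ss = foldr (\<lambda>s t. s \<otimes>\<^bsub>G\<^esub> t) ss \<one>\<^bsub>G\<^esub>"

text \<open>Reduced expression with respect to a generating set \<open>S\<close> (in the sense of Coxeter systems).\<close>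

definition reduced_word :: "('g, 'b) monoid_scheme \<Rightarrow> 'g set \<Rightarrow> 'g list \<Rightarrow> bool" where
  "reduced_word G S ss \<longleftrightarrow>
     set ss \<subseteq> S \<and>
     (\<forall>ts. set ts \<subseteq> S \<and> list_prod G ts = list_prod G ss \<longrightarrow> length ss \<le> length ts)"


section \<open>Generic weights\<close>

text \<open>\<open>'c\<close> is a set of labels for the indeterminates. With \<open>v\<^sub>c = q\<^sub>c\<^sup>1\<^sup>/\<^sup>2\<close>, the first ring below is the
  polynomial ring over the integers in the \<open>q\<^sub>c\<close>, the second one the ring of Laurent polynomials
  in the \<open>v\<^sub>c\<close>: exponents in the first ring count \<open>q\<^sub>c\<close>, exponents in the second ring count \<open>v\<^sub>c\<close>.\<close>

type_synonym 'c qpoly = "('c \<Rightarrow>\<^sub>0 nat) \<Rightarrow>\<^sub>0 int"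
type_synonym 'c vlaurent = "('c \<Rightarrow>\<^sub>0 int) \<Rightarrow>\<^sub>0 int"

definition int_exponent :: "('c \<Rightarrow>\<^sub>0 nat) \<Rightarrow> ('c \<Rightarrow>\<^sub>0 int)" where
  "int_exponent m = Poly_Mapping.map int m"

text \<open>The inclusion of the first ring in the second, \<open>q\<^sub>c \<mapsto> v\<^sub>c\<^sup>2\<close>.\<close>

definition qpoly_incl :: "'c qpoly \<Rightarrow> 'c vlaurent" where
  "qpoly_incl p =
     (\<Sum>m\<in>Poly_Mapping.keys p.
        Poly_Mapping.single (int_exponent m + int_exponent m) (Poly_Mapping.lookup p m))"

lemma int_exponent_add: "int_exponent (m + n) = int_exponent m + int_exponent n"
  by (rule poly_mapping_eqI) (simp add: int_exponent_def Poly_Mapping.map.rep_eq lookup_add when_def)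

lemma qpoly_incl_superset:
  assumes "finite F" "Poly_Mapping.keys p \<subseteq> F"
  shows "qpoly_incl p = (\<Sum>m\<in>F. Poly_Mapping.single (int_exponent m + int_exponent m) (Poly_Mapping.lookup p m))"
  unfolding qpoly_incl_def
  by (rule sum.mono_neutral_left[OF assms]) (simp add: in_keys_iff)

lemma qpoly_incl_add: "qpoly_incl (p + q) = qpoly_incl p + qpoly_incl q"
proof -
  let ?F = "Poly_Mapping.keys p \<union> Poly_Mapping.keys q"
  have "Poly_Mapping.keys (p + q) \<subseteq> ?F" by (rule Poly_Mapping.keys_add)
  then show ?thesis
    by (simp add: qpoly_incl_superset[of ?F] lookup_add single_add sum.distrib)
qed

lemma qpoly_incl_single: "qpoly_incl (Poly_Mapping.single m a) = Poly_Mapping.single (int_exponent m + int_exponent m) a"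
  by (simp add: qpoly_incl_superset[of "{m}"])

lemma qpoly_incl_0: "qpoly_incl 0 = 0" by (simp add: qpoly_incl_def)

lemma qpoly_incl_sum: "qpoly_incl (sum f F) = (\<Sum>i\<in>F. qpoly_incl (f i))"
  by (induction F rule: infinite_finite_induct) (auto simp: qpoly_incl_add qpoly_incl_0)

lemma poly_mapping_decomp: "(p::'a \<Rightarrow>\<^sub>0 'b::comm_monoid_add) = (\<Sum>m\<in>Poly_Mapping.keys p. Poly_Mapping.single m (Poly_Mapping.lookup p m))"
  by (rule poly_mapping_eqI) (simp add: lookup_sum lookup_single when_def in_keys_iff)

lemma qpoly_incl_mult: "qpoly_incl (p * q) = qpoly_incl p * qpoly_incl q"
proof -
  have "qpoly_incl (p * q) = qpoly_incl ((\<Sum>m\<in>Poly_Mapping.keys p. Poly_Mapping.single m (Poly_Mapping.lookup p m)) * (\<Sum>m\<in>Poly_Mapping.keys q. Poly_Mapping.single m (Poly_Mapping.lookup q m)))"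
    using poly_mapping_decomp[of p] poly_mapping_decomp[of q] by simp
  also have "\<dots> = qpoly_incl p * qpoly_incl q"
    unfolding sum_product qpoly_incl_sum mult_single qpoly_incl_single int_exponent_add
    by (simp add: qpoly_incl_def sum_product mult_single algebra_simps)
  finally show ?thesis .
qed

lemma qpoly_incl_1: "qpoly_incl 1 = 1"
proof -
  have "int_exponent 0 = (0 :: 'a \<Rightarrow>\<^sub>0 int)"
    using int_exponent_add[of 0 "0 :: 'a \<Rightarrow>\<^sub>0 nat"] by simp
  then show ?thesis
    using qpoly_incl_single[of "0 :: 'a \<Rightarrow>\<^sub>0 nat" 1] by simp
qed

text \<open>The label of \<open>s \<in> S\<close> stands for its conjugacy class in \<open>W\<close>; every label occurs, so that
  \<open>'c qpoly\<close> is the polynomial ring generated by the \<open>q\<^sub>s\<close>.\<close>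

locale generic_weights = reduced_based_root_datum D
  for D :: "('x::ab_group_add, 'y::ab_group_add) root_datum" +
  fixes lab :: "'x weyl \<Rightarrow> 'c"
  assumes lab_eq_iff: "\<lbrakk>s \<in> simple_reflections D; t \<in> simple_reflections D\<rbrakk>
                         \<Longrightarrow> lab s = lab t \<longleftrightarrow> conjugate (weyl_group D) s t"
    and lab_surj: "lab ` simple_reflections D = UNIV"

text \<open>The exponent vector of the monomial \<open>q\<^sub>w\<close>.\<close>

definition weight_exponent ::
    "('x::ab_group_add, 'y::ab_group_add) root_datum \<Rightarrow> ('x weyl \<Rightarrow> 'c) \<Rightarrow> 'x weyl \<Rightarrow> ('c \<Rightarrow>\<^sub>0 nat)" where
  "weight_exponent D lab w =
     (THE m. \<exists>u ss. u \<in> Omega D \<and>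
        reduced_word (weyl_group D) (simple_reflections D) ss \<and>
        w = u \<otimes>\<^bsub>weyl_group D\<^esub> list_prod (weyl_group D) ss \<and>
        m = (\<Sum>s\<leftarrow>ss. Poly_Mapping.single (lab s) 1))"

definition q_gen :: "('x weyl \<Rightarrow> 'c) \<Rightarrow> 'x weyl \<Rightarrow> 'c qpoly" where
  "q_gen lab s = Poly_Mapping.single (Poly_Mapping.single (lab s) 1) 1"

definition q_sqrt ::
    "('x::ab_group_add, 'y::ab_group_add) root_datum \<Rightarrow> ('x weyl \<Rightarrow> 'c) \<Rightarrow> 'x weyl \<Rightarrow> 'c vlaurent" where
  "q_sqrt D lab w = Poly_Mapping.single (int_exponent (weight_exponent D lab w)) 1"

definition q_inv_sqrt ::
    "('x::ab_group_add, 'y::ab_group_add) root_datum \<Rightarrow> ('x weyl \<Rightarrow> 'c) \<Rightarrow> 'x weyl \<Rightarrow> 'c vlaurent" where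
  "q_inv_sqrt D lab w = Poly_Mapping.single (- int_exponent (weight_exponent D lab w)) 1"


section \<open>The generic Hecke algebra\<close>

locale generic_hecke_algebra = generic_weights D lab + H: algebra_over scaleH
  for D :: "('x::ab_group_add, 'y::ab_group_add) root_datum"
    and lab :: "'x weyl \<Rightarrow> 'c"
    and scaleH :: "'c qpoly \<Rightarrow> 'h::ring_1 \<Rightarrow> 'h" +
  fixes T :: "'x weyl \<Rightarrow> 'h"
  assumes T_basis: "is_basis scaleH UNIV (carrier (weyl_group D)) T"
    and T_quadratic: "s \<in> simple_reflections D
                        \<Longrightarrow> (T s + 1) * (T s - scaleH (q_gen lab s) 1) = 0"
    and T_mult: "\<lbrakk>w \<in> carrier (weyl_group D); w' \<in> carrier (weyl_group D);
                   len D (w \<otimes>\<^bsub>weyl_group D\<^esub> w') = len D w + len D w'\<rbrakk>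
                  \<Longrightarrow> T (w \<otimes>\<^bsub>weyl_group D\<^esub> w') = T w * T w'"

text \<open>The extension of scalars of \<open>H\<close> from \<open>'c qpoly\<close> to \<open>'c vlaurent\<close>. As \<open>H\<close> is free on the \<open>T w\<close>,
  its extension of scalars is the algebra \<open>K\<close>, free on the \<open>\<iota> (T w)\<close>, receiving a ring
  homomorphism \<open>\<iota>\<close> from \<open>H\<close> that is compatible with the inclusion of scalars (given by
  \<open>h \<mapsto> h \<otimes> 1\<close>); \<open>\<iota>\<close> is then injective, and \<open>H\<close> is identified with \<open>range \<iota>\<close>.\<close>

locale extended_hecke_algebra =
  generic_hecke_algebra D lab scaleH T + K: algebra_over scaleK
  for D :: "('x::ab_group_add, 'y::ab_group_add) root_datum"
    and lab :: "'x weyl \<Rightarrow> 'c"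
    and scaleH :: "'c qpoly \<Rightarrow> 'h::ring_1 \<Rightarrow> 'h"
    and T :: "'x weyl \<Rightarrow> 'h"
    and scaleK :: "'c vlaurent \<Rightarrow> 'k::ring_1 \<Rightarrow> 'k" +
  fixes \<iota> :: "'h \<Rightarrow> 'k"
  assumes \<iota>_add: "\<iota> (a + b) = \<iota> a + \<iota> b"
    and \<iota>_mult: "\<iota> (a * b) = \<iota> a * \<iota> b"
    and \<iota>_one: "\<iota> 1 = 1"
    and \<iota>_scale: "\<iota> (scaleH p a) = scaleK (qpoly_incl p) (\<iota> a)"
    and \<iota>_T_basis: "is_basis scaleK UNIV (carrier (weyl_group D)) (\<lambda>w. \<iota> (T w))"

text \<open>In the following definitions \<open>T\<close> takes its values in the extended algebra.\<close>

definition T_norm ::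
    "('x::ab_group_add, 'y::ab_group_add) root_datum \<Rightarrow> ('x weyl \<Rightarrow> 'c)
      \<Rightarrow> ('c vlaurent \<Rightarrow> 'k::ring_1 \<Rightarrow> 'k) \<Rightarrow> ('x weyl \<Rightarrow> 'k) \<Rightarrow> 'x weyl \<Rightarrow> 'k" where
  "T_norm D lab scaleK T w = scaleK (q_inv_sqrt D lab w) (T w)"

definition theta ::
    "('x::ab_group_add, 'y::ab_group_add) root_datum \<Rightarrow> ('x weyl \<Rightarrow> 'c)
      \<Rightarrow> ('c vlaurent \<Rightarrow> 'k::ring_1 \<Rightarrow> 'k) \<Rightarrow> ('x weyl \<Rightarrow> 'k) \<Rightarrow> 'x \<Rightarrow> 'k" where
  "theta D lab scaleK T x =
     (THE t. \<exists>y z. dominant D y \<and> dominant D z \<and> x = y - z \<and>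
        t = T_norm D lab scaleK T (transl y) * ring_inverse (T_norm D lab scaleK T (transl z)))"

definition bernstein_subalgebra ::
    "('x::ab_group_add, 'y::ab_group_add) root_datum \<Rightarrow> ('x weyl \<Rightarrow> 'c)
      \<Rightarrow> ('c vlaurent \<Rightarrow> 'k::ring_1 \<Rightarrow> 'k) \<Rightarrow> ('x weyl \<Rightarrow> 'k) \<Rightarrow> 'k set" where
  "bernstein_subalgebra D lab scaleK T = module.span scaleK (range (theta D lab scaleK T))"

definition E_elt ::
    "('x::ab_group_add, 'y::ab_group_add) root_datum \<Rightarrow> ('x weyl \<Rightarrow> 'c)
      \<Rightarrow> ('c vlaurent \<Rightarrow> 'k::ring_1 \<Rightarrow> 'k) \<Rightarrow> ('x weyl \<Rightarrow> 'k) \<Rightarrow> 'x \<Rightarrow> 'k" where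
  "E_elt D lab scaleK T x = scaleK (q_sqrt D lab (transl x)) (theta D lab scaleK T x)"

end

theory Submission
  imports Defs
begin

text \<open>
  The elements \<open>E\<^sub>x\<close> are the part indexed by the translations of a larger family, here called
  \<open>bernstein\<close>, which is indexed by all of \<open>W\<close>: to \<open>w = v e\<^sup>x\<close> it attaches \<open>T\<^sub>v \<theta>\<^sub>x\<close> multiplied by the
  square root of \<open>q\<^sub>w / q\<^sub>v\<close>. The theorem rests on two properties of this family.

  It is unitriangular over the polynomial ring: \<open>bernstein w\<close> is \<open>T\<^sub>w\<close> plus a combination, with
  coefficients in \<open>\<int>[q\<^sub>*]\<close>, of elements \<open>T\<^sub>u\<close> with \<open>u\<close> shorter than \<open>w\<close> (\<open>bernstein_triangular\<close>).
  Hence it is a \<open>\<int>[q\<^sub>*]\<close>-basis of \<open>H\<close>, and a Laurent combination of its members lies in \<open>H\<close> only if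
  all coefficients are polynomials: look at a longest element whose coefficient is not
  (\<open>triangular_coefficients\<close>). For translations this is the first claim.

  It is multiplicative where lengths add: if \<open>v e\<^sup>y\<close> and \<open>e\<^sup>x\<close> have lengths adding up to that of
  \<open>v e\<^sup>y\<^sup>+\<^sup>x\<close>, then their weights add up too, and the product of \<open>bernstein (v e\<^sup>y)\<close> and \<open>E\<^sub>x\<close> is
  \<open>bernstein (v e\<^sup>y\<^sup>+\<^sup>x)\<close> (\<open>bernstein_mult\<close>). As the length is a sum of absolute values of affine
  functions of \<open>x\<close>, Dickson's lemma yields for each \<open>v\<close> a finite set of \<open>y\<close> from which every
  translation part is reached by such an additive step (\<open>finite_compatible\<close>). Since \<open>W\<^sub>o\<close> is finite,
  finitely many members of the family generate \<open>H\<close> over \<open>H \<inter> A\<close>, which is the second claim.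

  Unitriangularity is a statement about quotients: the square root of \<open>q\<^bsub>u\<^esub> q\<^bsub>w'\<^esub> / q\<^bsub>w\<^esub>\<close> times
  \<open>T\<^sub>w T\<^bsub>w'\<^esub>\<^sup>-\<^sup>1\<close> is \<open>T\<^sub>u\<close> plus lower terms, where \<open>u = w w'\<^sup>-\<^sup>1\<close> (\<open>quotient_triangular\<close>). It is proved by
  induction on the length of \<open>w'\<close>, and the only danger is that a square root survives. That this
  does not happen is seen geometrically. The group acts on the affine roots \<open>\<alpha>\<^sup>\<or> + k\<close>, the length of
  \<open>w\<close> counts the positive affine roots that \<open>w\<close> makes negative, and \<open>q\<^sub>w\<close> is the product of the labels
  of these inversions (\<open>weight_exponent_eq\<close>). Let \<open>t\<close> be the reflection in a positive affine root
  \<open>a\<close> with \<open>w a\<close> positive. The inversions of \<open>w t\<close> correspond to those of \<open>w\<close>, together with \<open>a\<close> and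
  an excess on which \<open>b \<mapsto> - t b\<close> is an involution without fixed points that preserves labels.
  So \<open>q\<^bsub>w t\<^esub>\<close> is \<open>q\<^sub>w\<close> times the label of \<open>a\<close> times a square (\<open>weight_reflection\<close>).
\<close>

section \<open>Abelian groups as modules over the integers\<close>

interpretation Z: module zscale
  by (rule module_zscale)

lemma zscale_int: "zscale n (k::int) = n * k"
  by (induction n rule: int_induct[where k = 0])
     (simp_all add: zscale_0 zscale_1 zscale_add_left zscale_diff_left distrib_right left_diff_distrib)

lemma additive_zscale:
  assumes "additive f" shows "f (zscale n x) = zscale n (f x)"
proof -
  interpret additive f by fact
  show ?thesis
    by (induction n rule: int_induct[where k = 0])
       (simp_all add: zscale_0 zscale_1 zscale_add_left zscale_diff_left zero add diff)
qed

lemma nat_spanI: "x = (\<Sum>v\<in>b. zscale (int (n v)) v) \<Longrightarrow> x \<in> nat_span b"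
  by (auto simp: nat_span_def)

lemma nat_span_zero: "0 \<in> nat_span b"
  unfolding nat_span_def by (auto intro!: exI[of _ "\<lambda>_. 0"] simp: zscale_0)

lemma nat_span_add:
  assumes "x \<in> nat_span b" "y \<in> nat_span b" shows "x + y \<in> nat_span b"
proof -
  obtain m n where "x = (\<Sum>v\<in>b. zscale (int (m v)) v)" "y = (\<Sum>v\<in>b. zscale (int (n v)) v)"
    using assms unfolding nat_span_def by blast
  then have "x + y = (\<Sum>v\<in>b. zscale (int (m v + n v)) v)"
    by (simp add: zscale_add_left sum.distrib)
  then show ?thesis by (rule nat_spanI)
qed

lemma nat_span_base:
  assumes "finite b" "v \<in> b" shows "v \<in> nat_span b"
proof -
  have "v = (\<Sum>w\<in>b. zscale (int (if w = v then 1 else 0)) w)"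
    using assms by (simp add: if_distrib[of "\<lambda>n. zscale (int n) _"] zscale_0 zscale_1 cong: if_cong)
  then show ?thesis by (rule nat_spanI)
qed

lemma nat_span_zscale:
  assumes "x \<in> nat_span b" "0 \<le> n" shows "zscale n x \<in> nat_span b"
proof -
  obtain m where "x = (\<Sum>v\<in>b. zscale (int (m v)) v)"
    using assms unfolding nat_span_def by blast
  then have "zscale n x = (\<Sum>v\<in>b. zscale (int (nat n * m v)) v)"
    using assms(2) by (simp add: Z.scale_sum_right zscale_zscale)
  then show ?thesis by (rule nat_spanI)
qed

section \<open>Root data\<close>

subsection \<open>Reflections and the invariant form\<close>

context reduced_based_root_datum
begin

abbreviation pr :: "'x \<Rightarrow> 'y \<Rightarrow> int" where "pr \<equiv> pairing D"
abbreviation cr :: "'x \<Rightarrow> 'y" where "cr \<equiv> coroot D"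
abbreviation R :: "'x set" where "R \<equiv> roots D"
abbreviation B :: "'x set" where "B \<equiv> simple_roots D"

lemma additive_pr: "additive (\<lambda>x. pr x y)" "additive (pr x)"
  using perfect by (simp_all add: perfect_pairing_def)

lemmas pr_simps =
  additive.add[OF additive_pr(1)] additive.diff[OF additive_pr(1)] additive.zero[OF additive_pr(1)]
  additive.minus[OF additive_pr(1)] additive.sum[OF additive_pr(1)]
  additive.add[OF additive_pr(2)] additive.diff[OF additive_pr(2)] additive.zero[OF additive_pr(2)]
  additive.minus[OF additive_pr(2)] additive.sum[OF additive_pr(2)]

lemma pr_zscale: "pr (zscale n x) y = n * pr x y" "pr x (zscale n y) = n * pr x y"
  using additive_zscale[OF additive_pr(1)[of y]] additive_zscale[OF additive_pr(2)[of x]]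
  by (simp_all add: zscale_int)

text \<open>Equality in the dual lattice is proved by testing against all of \<open>X\<close>; this is the uniqueness half of perfectness.\<close>

lemma pr_nondegenerate:
  assumes "\<And>x. pr x y = pr x y'" shows "y = y'"
proof -
  have "\<exists>!z. (\<lambda>x. pr x y) = (\<lambda>x. pr x z)"
    using perfect additive_pr(1)[of y] by (simp only: perfect_pairing_def)
  moreover have "(\<lambda>x. pr x y) = (\<lambda>x. pr x y')"
    using assms by (rule ext)
  ultimately show ?thesis by blast
qed

lemma coroots_eq: "coroots D = cr ` R"
  using coroot_bij by (simp add: bij_betw_def)

lemma finite_coroots: "finite (coroots D)"
  by (simp add: coroots_eq finite_roots)

lemma cr_inj: "\<alpha> \<in> R \<Longrightarrow> \<beta> \<in> R \<Longrightarrow> cr \<alpha> = cr \<beta> \<Longrightarrow> \<alpha> = \<beta>"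
  using coroot_bij by (auto simp: bij_betw_def inj_on_def)

lemma pr_reflection:
  "pr (reflection D \<alpha> x) y = pr x (coreflection D \<alpha> y)"
  by (simp add: reflection_def coreflection_def pr_simps pr_zscale)

lemma reflection_additive: "additive (reflection D \<alpha>)"
  by (rule additive.intro) (simp add: reflection_def pr_simps zscale_add_left)

lemma coreflection_involution:
  assumes "\<alpha> \<in> R" shows "coreflection D \<alpha> (coreflection D \<alpha> y) = y"
  using pairing_coroot[OF assms]
  by (simp add: coreflection_def pr_simps pr_zscale zscale_diff_left flip: zscale_add_left)

lemma reflection_involution:
  assumes "\<alpha> \<in> R" shows "reflection D \<alpha> (reflection D \<alpha> x) = x"
  using pairing_coroot[OF assms]
  by (simp add: reflection_def pr_simps pr_zscale zscale_diff_left flip: zscale_add_left)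

lemma reflection_in_roots: "\<alpha> \<in> R \<Longrightarrow> \<beta> \<in> R \<Longrightarrow> reflection D \<alpha> \<beta> \<in> R"
  using reflection_roots by blast

lemma reflection_self: "\<alpha> \<in> R \<Longrightarrow> reflection D \<alpha> \<alpha> = - \<alpha>"
  using zscale_diff_left[of 1 1 \<alpha>] zscale_add_left[of 1 1 \<alpha>]
  by (simp add: reflection_def pairing_coroot zscale_1)

lemma neg_in_roots: "\<alpha> \<in> R \<Longrightarrow> - \<alpha> \<in> R"
  using reflection_in_roots[of \<alpha> \<alpha>] reflection_self by simp

text \<open>The canonical form attached to the coroots. It is invariant because the dual reflections permute the coroots, and it takes integer values. It may be degenerate on \<open>X\<close>, but roots have positive norm.\<close>

definition form :: "'x \<Rightarrow> 'x \<Rightarrow> int" where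
  "form x y = (\<Sum>c\<in>coroots D. pr x c * pr y c)"

lemma form_sym: "form x y = form y x"
  by (simp add: form_def mult.commute)

lemma form_simps:
  "form (x + x') y = form x y + form x' y" "form (x - x') y = form x y - form x' y"
  "form (- x) y = - form x y" "form (zscale n x) y = n * form x y"
  "form y (x + x') = form y x + form y x'" "form y (x - x') = form y x - form y x'"
  "form y (- x) = - form y x" "form y (zscale n x) = n * form y x"
  by (simp_all add: form_def pr_simps pr_zscale algebra_simps sum.distrib sum_subtractf sum_negf sum_distrib_left)

lemma form_sum: "form x (sum f I) = (\<Sum>i\<in>I. form x (f i))"
  by (induction I rule: infinite_finite_induct) (simp_all add: form_simps, simp_all add: form_def pr_simps)

lemma form_reflection:
  assumes "\<alpha> \<in> R"
  shows "form (reflection D \<alpha> x) (reflection D \<alpha> y) = form x y"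
proof -
  have "form (reflection D \<alpha> x) (reflection D \<alpha> y) =
    (\<Sum>c\<in>coroots D. pr x (coreflection D \<alpha> c) * pr y (coreflection D \<alpha> c))"
    by (simp add: form_def pr_reflection)
  also have "\<dots> = form x y"
    unfolding form_def
    by (rule sum.reindex_bij_witness[where i = "coreflection D \<alpha>" and j = "coreflection D \<alpha>"])
       (use coreflection_coroots[OF assms] coreflection_involution[OF assms] in auto)
  finally show ?thesis .
qed

lemma form_root_pos: "\<alpha> \<in> R \<Longrightarrow> 0 < form \<alpha> \<alpha>"
proof -
  assume a: "\<alpha> \<in> R"
  have "pr \<alpha> (cr \<alpha>) * pr \<alpha> (cr \<alpha>) \<le> form \<alpha> \<alpha>"
    unfolding form_def
    by (rule member_le_sum) (use a coroots_eq finite_coroots in auto)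
  then show ?thesis by (simp add: pairing_coroot[OF a])
qed

text \<open>Invariance under the reflection in \<open>\<alpha>\<close> expresses the coroot through the form; everything about coroots below comes from this identity.\<close>

lemma form_root:
  assumes "\<alpha> \<in> R" shows "2 * form x \<alpha> = pr x (cr \<alpha>) * form \<alpha> \<alpha>"
proof -
  have "form x \<alpha> = form (reflection D \<alpha> x) (- \<alpha>)"
    using form_reflection[OF assms, of x \<alpha>] reflection_self[OF assms] by simp
  then show ?thesis by (simp add: reflection_def form_simps)
qed

text \<open>The data only say that \<open>\<alpha> \<mapsto> \<alpha>\<^sup>\<or>\<close> is a bijection. Its equivariance follows because both sides pair with \<open>x\<close> to the same multiple of the form.\<close>

lemma coroot_reflection:
  assumes "\<alpha> \<in> R" "\<beta> \<in> R"
  shows "cr (reflection D \<alpha> \<beta>) = coreflection D \<alpha> (cr \<beta>)"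
proof (rule pr_nondegenerate)
  fix x
  let ?b = "reflection D \<alpha> \<beta>"
  have b: "form ?b ?b = form \<beta> \<beta>" by (rule form_reflection[OF assms(1)])
  have "pr x (cr ?b) * form \<beta> \<beta> = 2 * form x ?b"
    using form_root[of ?b x] reflection_in_roots[OF assms] b by simp
  also have "form x ?b = form (reflection D \<alpha> x) \<beta>"
    using form_reflection[OF assms(1), of x ?b] reflection_involution[OF assms(1)] by simp
  also have "2 * \<dots> = pr x (coreflection D \<alpha> (cr \<beta>)) * form \<beta> \<beta>"
    by (simp add: form_root[OF assms(2)] pr_reflection)
  finally show "pr x (cr ?b) = pr x (coreflection D \<alpha> (cr \<beta>))"
    using form_root_pos[OF assms(2)] by simp
qed

lemma coroot_minus: "\<alpha> \<in> R \<Longrightarrow> cr (- \<alpha>) = - cr \<alpha>"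
  using coroot_reflection[of \<alpha> \<alpha>] zscale_add_left[of 1 1 "cr \<alpha>"]
  by (simp add: reflection_self coreflection_def pairing_coroot zscale_1)

lemma pr_sign:
  assumes "\<alpha> \<in> R" "\<beta> \<in> R" shows "0 < pr \<alpha> (cr \<beta>) \<longleftrightarrow> 0 < pr \<beta> (cr \<alpha>)"
proof -
  have "pr \<alpha> (cr \<beta>) * form \<beta> \<beta> = pr \<beta> (cr \<alpha>) * form \<alpha> \<alpha>"
    using form_root[OF assms(1), of \<beta>] form_root[OF assms(2), of \<alpha>] form_sym[of \<alpha> \<beta>] by simp
  then show ?thesis using form_root_pos[OF assms(1)] form_root_pos[OF assms(2)]
    by (metis zero_less_mult_pos2 zero_less_mult_iff)
qed

subsection \<open>Positive roots\<close>

lemma finite_B: "finite B"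
  using simple_subset finite_roots finite_subset by blast

lemma simple_coeff_unique:
  assumes "(\<Sum>\<beta>\<in>B. zscale (m \<beta>) \<beta>) = (\<Sum>\<beta>\<in>B. zscale (n \<beta>) \<beta>)" "\<beta> \<in> B"
  shows "m \<beta> = n \<beta>"
proof -
  have "(\<Sum>\<beta>\<in>B. zscale (m \<beta> - n \<beta>) \<beta>) = 0"
    using assms(1) by (simp add: zscale_diff_left sum_subtractf)
  then have "m \<beta> - n \<beta> = 0"
    by (rule Z.independentD[OF simple_independent finite_B subset_refl]) (rule assms(2))
  then show ?thesis by simp
qed

lemma pos_rootsE:
  assumes "\<alpha> \<in> pos_roots D"
  obtains n where "\<alpha> \<in> R" "\<alpha> = (\<Sum>\<beta>\<in>B. zscale (int (n \<beta>)) \<beta>)"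
  using assms by (auto simp: pos_roots_def nat_span_def)

lemma neg_roots_iff: "\<alpha> \<in> neg_roots D \<longleftrightarrow> - \<alpha> \<in> pos_roots D"
proof -
  have "\<alpha> \<in> uminus ` nat_span B \<longleftrightarrow> - \<alpha> \<in> nat_span B"
    by (metis (no_types, lifting) image_iff minus_minus)
  then show ?thesis using neg_in_roots[of \<alpha>] neg_in_roots[of "- \<alpha>"]
    by (auto simp: neg_roots_def pos_roots_def)
qed

lemma zero_not_root: "0 \<notin> R"
  using pairing_coroot[of 0] by (auto simp: pr_simps)

lemma pos_neg_disjoint:
  assumes "\<alpha> \<in> pos_roots D" shows "- \<alpha> \<notin> pos_roots D"
proof
  assume "- \<alpha> \<in> pos_roots D"
  then obtain m where m: "- \<alpha> = (\<Sum>\<beta>\<in>B. zscale (int (m \<beta>)) \<beta>)" by (rule pos_rootsE)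
  obtain n where n: "\<alpha> \<in> R" "\<alpha> = (\<Sum>\<beta>\<in>B. zscale (int (n \<beta>)) \<beta>)" using assms by (rule pos_rootsE)
  have "(\<Sum>\<beta>\<in>B. zscale (int (n \<beta>)) \<beta>) = (\<Sum>\<beta>\<in>B. zscale (- int (m \<beta>)) \<beta>)"
    using m n(2) by (simp add: sum_negf) (metis minus_minus)
  then have "int (n \<beta>) = - int (m \<beta>)" if "\<beta> \<in> B" for \<beta>
    using simple_coeff_unique[of "\<lambda>\<beta>. int (n \<beta>)" "\<lambda>\<beta>. - int (m \<beta>)"] that by blast
  then have "n \<beta> = 0" if "\<beta> \<in> B" for \<beta> using that by fastforce
  then have "\<alpha> = 0" using n(2) by (simp add: zscale_0)
  then show False using n(1) zero_not_root by simp
qed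

lemma pos_cases: "\<alpha> \<in> R \<Longrightarrow> \<alpha> \<in> pos_roots D \<or> - \<alpha> \<in> pos_roots D"
  using pos_or_neg neg_roots_iff by blast

lemma pos_subset: "\<alpha> \<in> pos_roots D \<Longrightarrow> \<alpha> \<in> R"
  by (simp add: pos_roots_def)

lemma neg_iff: "\<alpha> \<in> R \<Longrightarrow> - \<alpha> \<in> pos_roots D \<longleftrightarrow> \<alpha> \<notin> pos_roots D"
  using pos_cases pos_neg_disjoint by blast

lemma finite_pos: "finite (pos_roots D)"
  using finite_roots by (simp add: pos_roots_def)

lemma simple_pos: "\<beta> \<in> B \<Longrightarrow> \<beta> \<in> pos_roots D"
  using simple_subset nat_span_base[OF finite_B] by (auto simp: pos_roots_def)

lemma simple_reflection_coeffs:
  assumes "\<beta> \<in> B" and "\<alpha> = (\<Sum>\<gamma>\<in>B. zscale (n \<gamma>) \<gamma>)"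
  shows "reflection D \<beta> \<alpha> = (\<Sum>\<gamma>\<in>B. zscale ((n(\<beta> := n \<beta> - pr \<alpha> (cr \<beta>))) \<gamma>) \<gamma>)"
proof -
  have "(\<Sum>\<gamma>\<in>B. zscale ((n(\<beta> := n \<beta> - pr \<alpha> (cr \<beta>))) \<gamma>) \<gamma>)
     = zscale (n \<beta> - pr \<alpha> (cr \<beta>)) \<beta> + (\<Sum>\<gamma>\<in>B - {\<beta>}. zscale (n \<gamma>) \<gamma>)"
    by (simp add: sum.remove[OF finite_B assms(1)])
  also have "\<dots> = (zscale (n \<beta>) \<beta> + (\<Sum>\<gamma>\<in>B - {\<beta>}. zscale (n \<gamma>) \<gamma>)) - zscale (pr \<alpha> (cr \<beta>)) \<beta>"
    by (simp add: zscale_diff_left)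
  also have "\<dots> = reflection D \<beta> \<alpha>"
    using assms(2) by (simp add: sum.remove[OF finite_B assms(1)] reflection_def)
  finally show ?thesis by simp
qed

text \<open>Subtracting a multiple of \<open>\<beta>\<close> leaves the other coefficients alone, and one of these is positive, as otherwise \<open>\<alpha>\<close> would be a multiple of \<open>\<beta>\<close>.\<close>

lemma simple_reflection_pos:
  assumes "\<beta> \<in> B" "\<alpha> \<in> pos_roots D" "\<alpha> \<noteq> \<beta>"
  shows "reflection D \<beta> \<alpha> \<in> pos_roots D"
proof (rule ccontr)
  obtain n where n: "\<alpha> \<in> R" "\<alpha> = (\<Sum>\<beta>\<in>B. zscale (int (n \<beta>)) \<beta>)"
    using assms(2) by (rule pos_rootsE)
  let ?n = "(\<lambda>\<gamma>. int (n \<gamma>))(\<beta> := int (n \<beta>) - pr \<alpha> (cr \<beta>))"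
  have r: "reflection D \<beta> \<alpha> = (\<Sum>\<gamma>\<in>B. zscale (?n \<gamma>) \<gamma>)"
    by (rule simple_reflection_coeffs[OF assms(1) n(2)])
  have bR: "\<beta> \<in> R" using assms(1) simple_subset by blast
  assume "reflection D \<beta> \<alpha> \<notin> pos_roots D"
  then have "- reflection D \<beta> \<alpha> \<in> pos_roots D"
    using pos_cases reflection_in_roots[OF bR n(1)] by blast
  then obtain m where m: "- reflection D \<beta> \<alpha> = (\<Sum>\<beta>\<in>B. zscale (int (m \<beta>)) \<beta>)"
    by (rule pos_rootsE)
  have "(\<Sum>\<gamma>\<in>B. zscale (?n \<gamma>) \<gamma>) = (\<Sum>\<beta>\<in>B. zscale (- int (m \<beta>)) \<beta>)"
    unfolding r[symmetric] using m by (simp add: sum_negf) (metis minus_minus)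
  then have eq: "?n \<gamma> = - int (m \<gamma>)" if "\<gamma> \<in> B" for \<gamma>
    using simple_coeff_unique[of ?n "\<lambda>\<beta>. - int (m \<beta>)"] that by blast
  have z: "n \<gamma> = 0" if "\<gamma> \<in> B - {\<beta>}" for \<gamma>
    using eq[of \<gamma>] that by simp
  have "\<alpha> = zscale (int (n \<beta>)) \<beta>"
    using n(2) z by (simp add: sum.remove[OF finite_B assms(1)] zscale_0)
  then have "zscale 1 \<alpha> = zscale (int (n \<beta>)) \<beta>" by (simp add: zscale_1)
  then have "\<alpha> = - \<beta>" using reduced[OF bR n(1) one_neq_zero] assms(3) by blast
  then show False using assms(2) pos_neg_disjoint[OF simple_pos[OF assms(1)]] by simp
qed

text \<open>Otherwise the norm of \<open>\<alpha>\<close>, expanded along the simple roots, would not be positive.\<close>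

lemma exists_simple_acute:
  assumes "\<alpha> \<in> pos_roots D"
  shows "\<exists>\<beta>\<in>B. 0 < pr \<alpha> (cr \<beta>)"
proof (rule ccontr)
  assume neg: "\<not> ?thesis"
  obtain n where n: "\<alpha> \<in> R" "\<alpha> = (\<Sum>\<beta>\<in>B. zscale (int (n \<beta>)) \<beta>)"
    using assms by (rule pos_rootsE)
  have "form \<alpha> \<alpha> = (\<Sum>\<beta>\<in>B. int (n \<beta>) * form \<alpha> \<beta>)"
    using n(2) form_sum[of \<alpha> "\<lambda>\<beta>. zscale (int (n \<beta>)) \<beta>" B] by (simp add: form_simps)
  also have "\<dots> \<le> 0"
  proof (rule sum_nonpos)
    fix \<beta> assume b: "\<beta> \<in> B"
    have bR: "\<beta> \<in> R" using b simple_subset by blast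
    have "2 * form \<alpha> \<beta> \<le> 0"
      using form_root[OF bR, of \<alpha>] form_root_pos[OF bR] neg b
      by (simp add: mult_nonpos_nonneg not_less)
    then show "int (n \<beta>) * form \<alpha> \<beta> \<le> 0" by (simp add: mult_nonneg_nonpos)
  qed
  finally show False using form_root_pos[OF n(1)] by simp
qed

text \<open>The simple coroots are a base of the dual system. Induction on the height: a simple reflection at an acute angle lowers the height of \<open>\<alpha>\<close> and changes its coroot by a nonnegative multiple of a simple coroot.\<close>

lemma pos_coroot_aux:
  assumes "\<alpha> \<in> R" "\<alpha> = (\<Sum>\<beta>\<in>B. zscale (int (n \<beta>)) \<beta>)"
  shows "cr \<alpha> \<in> nat_span (cr ` B)"
  using assms
proof (induction "\<Sum>\<beta>\<in>B. n \<beta>" arbitrary: \<alpha> n rule: less_induct)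
  case less
  have pos: "\<alpha> \<in> pos_roots D" using less.prems by (auto simp: pos_roots_def nat_span_def)
  obtain \<beta> where b: "\<beta> \<in> B" "0 < pr \<alpha> (cr \<beta>)" using exists_simple_acute[OF pos] by blast
  have bR: "\<beta> \<in> R" using b simple_subset by blast
  have base: "cr \<beta> \<in> nat_span (cr ` B)" using b finite_B by (intro nat_span_base) auto
  show ?case
  proof (cases "\<alpha> = \<beta>")
    case True then show ?thesis using base by simp
  next
    case False
    let ?g = "reflection D \<beta> \<alpha>"
    let ?n = "(\<lambda>\<gamma>. int (n \<gamma>))(\<beta> := int (n \<beta>) - pr \<alpha> (cr \<beta>))"
    have gpos: "?g \<in> pos_roots D" by (rule simple_reflection_pos[OF b(1) pos False])
    then obtain m where m: "?g \<in> R" "?g = (\<Sum>\<beta>\<in>B. zscale (int (m \<beta>)) \<beta>)" by (rule pos_rootsE)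
    have "?g = (\<Sum>\<gamma>\<in>B. zscale (?n \<gamma>) \<gamma>)"
      by (rule simple_reflection_coeffs[OF b(1) less.prems(2)])
    then have eq: "int (m \<gamma>) = ?n \<gamma>" if "\<gamma> \<in> B" for \<gamma>
      using simple_coeff_unique[of "\<lambda>\<beta>. int (m \<beta>)" ?n] m(2) that by simp
    have "(\<Sum>\<beta>\<in>B. m \<beta>) < (\<Sum>\<beta>\<in>B. n \<beta>)"
    proof (rule sum_strict_mono_ex1[OF finite_B])
      show "\<forall>\<gamma>\<in>B. m \<gamma> \<le> n \<gamma>"
      proof
        fix \<gamma> assume "\<gamma> \<in> B"
        then show "m \<gamma> \<le> n \<gamma>" using eq[of \<gamma>] b(2) by (cases "\<gamma> = \<beta>") auto
      qed
      show "\<exists>\<gamma>\<in>B. m \<gamma> < n \<gamma>" using eq[of \<beta>] b by (intro bexI[of _ \<beta>]) auto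
    qed
    then have IH: "cr ?g \<in> nat_span (cr ` B)" using less.hyps m by blast
    have "\<alpha> = reflection D \<beta> ?g" by (simp add: reflection_involution[OF bR])
    then have "cr \<alpha> = coreflection D \<beta> (cr ?g)"
      using coroot_reflection[OF bR m(1)] by simp
    also have "\<dots> = cr ?g + zscale (- pr \<beta> (cr ?g)) (cr \<beta>)"
      by (simp add: coreflection_def)
    also have "pr \<beta> (cr ?g) = - pr \<beta> (cr \<alpha>)"
      by (simp add: coroot_reflection[OF bR less.prems(1)] flip: pr_reflection)
         (simp add: reflection_self[OF bR] pr_simps)
    finally have c: "cr \<alpha> = cr ?g + zscale (pr \<beta> (cr \<alpha>)) (cr \<beta>)" by simp
    have "0 \<le> pr \<beta> (cr \<alpha>)" using b(2) pr_sign[OF less.prems(1) bR] by simp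
    then show ?thesis
      by (subst c) (intro nat_span_add IH nat_span_zscale base)
  qed
qed

lemma pos_coroot: "\<alpha> \<in> pos_roots D \<Longrightarrow> cr \<alpha> \<in> nat_span (cr ` B)"
  by (erule pos_rootsE) (rule pos_coroot_aux)

definition two_rho :: 'x where "two_rho = \<Sum>(pos_roots D)"

lemma pr_two_rho_simple:
  assumes "\<beta> \<in> B" shows "pr two_rho (cr \<beta>) = 2"
proof -
  have bR: "\<beta> \<in> R" using assms simple_subset by blast
  have bp: "\<beta> \<in> pos_roots D" by (rule simple_pos[OF assms])
  interpret r: additive "reflection D \<beta>" by (rule reflection_additive)
  have "(\<Sum>\<alpha>\<in>pos_roots D - {\<beta>}. reflection D \<beta> \<alpha>) = \<Sum>(pos_roots D - {\<beta>})"
  proof (rule sum.reindex_bij_witness[where i = "reflection D \<beta>" and j = "reflection D \<beta>"])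
    fix \<alpha> assume a: "\<alpha> \<in> pos_roots D - {\<beta>}"
    then have "reflection D \<beta> \<alpha> \<in> pos_roots D" using simple_reflection_pos[OF assms] by blast
    moreover have "reflection D \<beta> \<alpha> \<noteq> \<beta>"
    proof
      assume "reflection D \<beta> \<alpha> = \<beta>"
      then have "\<alpha> = - \<beta>" using reflection_involution[OF bR, of \<alpha>] reflection_self[OF bR] by simp
      then show False using a pos_neg_disjoint[OF bp] by blast
    qed
    ultimately show "reflection D \<beta> \<alpha> \<in> pos_roots D - {\<beta>}" by blast
    then show "reflection D \<beta> \<alpha> \<in> pos_roots D - {\<beta>}" .
  qed (auto simp: reflection_involution[OF bR])
  then have "reflection D \<beta> two_rho = - \<beta> + (two_rho - \<beta>)"
    unfolding two_rho_def r.sum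
    by (simp add: sum.remove[OF finite_pos bp] reflection_self[OF bR])
  then have "pr (reflection D \<beta> two_rho) (cr \<beta>) = pr two_rho (cr \<beta>) - 4"
    by (simp add: pr_simps pairing_coroot[OF bR])
  moreover have "pr (reflection D \<beta> two_rho) (cr \<beta>) = - pr two_rho (cr \<beta>)"
    by (simp add: reflection_def pr_simps pr_zscale pairing_coroot[OF bR])
  ultimately show ?thesis by simp
qed

lemma nat_span_coroot_nonneg:
  assumes "c \<in> nat_span (cr ` B)" "\<And>\<beta>. \<beta> \<in> B \<Longrightarrow> 0 \<le> pr x (cr \<beta>)"
  shows "0 \<le> pr x c"
proof -
  obtain n where "c = (\<Sum>v\<in>cr ` B. zscale (int (n v)) v)"
    using assms unfolding nat_span_def by blast
  then show ?thesis using assms(2) by (auto simp: pr_simps pr_zscale intro!: sum_nonneg)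
qed

text \<open>Functionals that are positive on the simple coroots separate the cone of nonnegative combinations from zero.\<close>

lemma nat_span_coroot_zero:
  assumes "c \<in> nat_span (cr ` B)" "pr x c \<le> 0" "\<And>\<beta>. \<beta> \<in> B \<Longrightarrow> 0 < pr x (cr \<beta>)"
  shows "c = 0"
proof -
  obtain n where n: "c = (\<Sum>v\<in>cr ` B. zscale (int (n v)) v)"
    using assms unfolding nat_span_def by blast
  have p: "0 < pr x v" if "v \<in> cr ` B" for v using assms(3) that by auto
  have "pr x c = (\<Sum>v\<in>cr ` B. int (n v) * pr x v)"
    by (simp add: n pr_simps pr_zscale)
  moreover have "\<forall>v\<in>cr ` B. 0 \<le> int (n v) * pr x v" using p by (simp add: less_imp_le)
  ultimately have "\<forall>v\<in>cr ` B. int (n v) * pr x v = 0"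
    using assms(2) finite_B by (subst sum_nonneg_eq_0_iff[symmetric]) (auto intro!: antisym sum_nonneg)
  then have "\<forall>v\<in>cr ` B. n v = 0" using p by fastforce
  then show ?thesis unfolding n by (intro sum.neutral) (simp add: zscale_0)
qed

lemma cr_nonzero: "\<alpha> \<in> R \<Longrightarrow> cr \<alpha> \<noteq> 0"
  using pairing_coroot[of \<alpha>] by (auto simp: pr_simps)

lemma pr_two_rho_pos:
  assumes "\<alpha> \<in> pos_roots D" shows "0 < pr two_rho (cr \<alpha>)"
proof (rule ccontr)
  assume "\<not> ?thesis"
  then have "cr \<alpha> = 0"
    by (intro nat_span_coroot_zero[OF pos_coroot[OF assms], of two_rho]) (auto simp: pr_two_rho_simple)
  then show False using cr_nonzero pos_subset[OF assms] by blast
qed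

lemma pr_two_rho_iff:
  assumes "\<alpha> \<in> R" shows "0 < pr two_rho (cr \<alpha>) \<longleftrightarrow> \<alpha> \<in> pos_roots D"
proof
  assume *: "0 < pr two_rho (cr \<alpha>)"
  show "\<alpha> \<in> pos_roots D"
  proof (rule ccontr)
    assume "\<alpha> \<notin> pos_roots D"
    then have "0 < pr two_rho (cr (- \<alpha>))" using pos_cases[OF assms] pr_two_rho_pos by blast
    then show False using * by (simp add: coroot_minus[OF assms] pr_simps)
  qed
qed (rule pr_two_rho_pos)

lemma dominant_pos_root: "dominant D x \<Longrightarrow> \<alpha> \<in> pos_roots D \<Longrightarrow> 0 \<le> pr x (cr \<alpha>)"
  by (rule nat_span_coroot_nonneg[OF pos_coroot]) (auto simp: dominant_def)

lemma dominant_add: "dominant D x \<Longrightarrow> dominant D y \<Longrightarrow> dominant D (x + y)"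
  by (auto simp: dominant_def pr_simps)

lemma dominant_zero: "dominant D 0"
  by (auto simp: dominant_def pr_simps)

text \<open>The sum of the positive roots is strictly dominant, so a large multiple of it moves \<open>x\<close> into the dominant cone.\<close>

lemma dominant_difference: "\<exists>y z. dominant D y \<and> dominant D z \<and> x = y - z"
proof -
  define N where "N = (\<Sum>\<beta>\<in>B. \<bar>pr x (cr \<beta>)\<bar>)"
  have N: "\<bar>pr x (cr \<beta>)\<bar> \<le> N" if "\<beta> \<in> B" for \<beta>
    unfolding N_def using that finite_B by (intro member_le_sum) auto
  have "dominant D (x + zscale N two_rho)" "dominant D (zscale N two_rho)"
    using N by (fastforce simp: dominant_def pr_simps pr_zscale pr_two_rho_simple)+
  then show ?thesis by (intro exI[of _ "x + zscale N two_rho"] exI[of _ "zscale N two_rho"]) simp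
qed

subsection \<open>Minimal coroots\<close>

lemma min_root: "\<mu> \<in> min_coroot_roots D \<Longrightarrow> \<mu> \<in> R"
  by (simp add: min_coroot_roots_def)

lemma min_coroot_minimal:
  assumes "\<mu> \<in> min_coroot_roots D" "\<alpha> \<in> R" "cr \<mu> - cr \<alpha> \<in> nat_span (cr ` B)"
  shows "\<alpha> = \<mu>"
proof -
  have "cr \<alpha> = cr \<mu>"
    using assms unfolding min_coroot_roots_def coroot_le_def coroots_eq by blast
  then show ?thesis using assms cr_inj min_root by blast
qed

text \<open>Among the finitely many coroots below that of \<open>\<alpha>\<close>, one with the least value on \<open>two_rho\<close> is minimal.\<close>

lemma exists_min_below:
  assumes "\<alpha> \<in> R"
  shows "\<exists>\<mu>\<in>min_coroot_roots D. cr \<alpha> - cr \<mu> \<in> nat_span (cr ` B)"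
proof -
  let ?S = "{\<mu>\<in>R. cr \<alpha> - cr \<mu> \<in> nat_span (cr ` B)}"
  let ?f = "\<lambda>\<mu>. pr two_rho (cr \<mu>)"
  have fin: "finite ?S" using finite_roots by simp
  have ne: "\<alpha> \<in> ?S" using assms nat_span_zero by simp
  obtain \<mu> where mS: "\<mu> \<in> ?S" and mmin: "\<And>\<nu>. \<nu> \<in> ?S \<Longrightarrow> ?f \<mu> \<le> ?f \<nu>"
    using ex_is_arg_min_if_finite[OF fin, of ?f] ne unfolding is_arg_min_linorder by blast
  have "\<mu> \<in> min_coroot_roots D"
    unfolding min_coroot_roots_def coroots_eq coroot_le_def
  proof (intro CollectI conjI ballI impI)
    show "\<mu> \<in> R" using mS by simp
    fix b assume b: "b \<in> cr ` R" "cr \<mu> - b \<in> nat_span (cr ` B)"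
    then obtain \<nu> where nu: "\<nu> \<in> R" "b = cr \<nu>" by blast
    have "cr \<alpha> - cr \<nu> = (cr \<alpha> - cr \<mu>) + (cr \<mu> - cr \<nu>)" by simp
    also have "\<dots> \<in> nat_span (cr ` B)" using mS b nu by (intro nat_span_add) auto
    finally have "?f \<mu> \<le> ?f \<nu>" using mmin nu by blast
    then have "pr two_rho (cr \<mu> - b) \<le> 0" using nu by (simp add: pr_simps)
    then have "cr \<mu> - b = 0"
      by (rule nat_span_coroot_zero[OF b(2)]) (simp add: pr_two_rho_simple)
    then show "b = cr \<mu>" by simp
  qed
  then show ?thesis using mS by blast
qed

lemma min_root_negative:
  assumes "\<mu> \<in> min_coroot_roots D" shows "- \<mu> \<in> pos_roots D"
proof (rule ccontr)
  assume "- \<mu> \<notin> pos_roots D"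
  then have p: "\<mu> \<in> pos_roots D" using pos_cases min_root[OF assms] by blast
  have "cr \<mu> - cr (- \<mu>) = cr \<mu> + cr \<mu>" by (simp add: coroot_minus min_root[OF assms])
  also have "\<dots> \<in> nat_span (cr ` B)" by (intro nat_span_add pos_coroot p)
  finally have "- \<mu> = \<mu>" by (rule min_coroot_minimal[OF assms neg_in_roots[OF min_root[OF assms]]])
  then show False using p pos_neg_disjoint[OF p] by simp
qed

text \<open>An acute angle would make the reflected coroot of \<open>\<mu>\<close> strictly smaller than that of \<open>\<mu>\<close>.\<close>

lemma min_root_obtuse:
  assumes "\<mu> \<in> min_coroot_roots D" "\<alpha> \<in> pos_roots D"
  shows "pr \<mu> (cr \<alpha>) \<le> 0"
proof (rule ccontr)
  assume n: "\<not> ?thesis"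
  have m: "\<mu> \<in> R" and a: "\<alpha> \<in> R" using assms min_root pos_subset by blast+
  have p: "0 < pr \<alpha> (cr \<mu>)" using n pr_sign[OF m a] by simp
  have "cr \<mu> - cr (reflection D \<alpha> \<mu>) = zscale (pr \<alpha> (cr \<mu>)) (cr \<alpha>)"
    by (simp add: coroot_reflection[OF a m] coreflection_def)
  also have "\<dots> \<in> nat_span (cr ` B)" using p by (intro nat_span_zscale pos_coroot assms(2)) simp
  finally have "reflection D \<alpha> \<mu> = \<mu>"
    by (rule min_coroot_minimal[OF assms(1) reflection_in_roots[OF a m]])
  then have "pr (reflection D \<alpha> \<mu>) (cr \<alpha>) = pr \<mu> (cr \<alpha>)" by simp
  then show False using n by (simp add: reflection_def pr_simps pr_zscale pairing_coroot[OF a])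
qed

text \<open>The equality case of the Cauchy--Schwarz inequality: if both pairings are at least 2, then \<open>\<mu> - \<alpha>\<close> has norm zero and is orthogonal to all coroots, so the product of the two reflections translates \<open>\<mu>\<close> by multiples of it. Finiteness of the roots then makes \<open>\<alpha>\<close> and \<open>\<mu>\<close> proportional.\<close>

lemma bounded_angle:
  assumes a: "\<alpha> \<in> R" and m: "\<mu> \<in> R"
    and "2 \<le> pr \<mu> (cr \<alpha>)" "2 \<le> pr \<alpha> (cr \<mu>)"
  shows "\<alpha> = \<mu> \<or> \<alpha> = - \<mu>"
proof -
  let ?d = "\<mu> - \<alpha>"
  have "2 * form \<mu> \<alpha> \<ge> 2 * form \<alpha> \<alpha>"
    using form_root[OF a, of \<mu>] assms(3) form_root_pos[OF a] by simp
  moreover have "2 * form \<mu> \<alpha> \<ge> 2 * form \<mu> \<mu>"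
    using form_root[OF m, of \<alpha>] form_sym[of \<mu> \<alpha>] assms(4) form_root_pos[OF m] by simp
  ultimately have le: "form ?d ?d \<le> 0"
    using form_sym[of \<mu> \<alpha>] by (simp add: form_simps)
  have "(\<Sum>c\<in>coroots D. pr ?d c * pr ?d c) = 0"
    using le sum_nonneg[of "coroots D" "\<lambda>c. pr ?d c * pr ?d c"] unfolding form_def by fastforce
  then have z: "pr ?d c = 0" if "c \<in> coroots D" for c
    using that by (simp add: sum_nonneg_eq_0_iff finite_coroots)
  have za: "pr \<mu> (cr \<alpha>) = 2" "pr \<alpha> (cr \<mu>) = 2"
    using z[of "cr \<alpha>"] z[of "cr \<mu>"] a m pairing_coroot by (auto simp: coroots_eq pr_simps)
  define f where "f = reflection D \<mu> \<circ> reflection D \<alpha>"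
  have step: "f (\<mu> + zscale (2 * int k) ?d) = \<mu> + zscale (2 * int (Suc k)) ?d" for k
  proof -
    interpret ra: additive "reflection D \<alpha>" by (rule reflection_additive)
    interpret rm: additive "reflection D \<mu>" by (rule reflection_additive)
    have fd: "reflection D \<alpha> ?d = ?d" "reflection D \<mu> ?d = ?d"
      using z[of "cr \<alpha>"] z[of "cr \<mu>"] a m by (auto simp: reflection_def coroots_eq zscale_0)
    have z2: "zscale 2 x = x + x" for x :: 'x
      using zscale_add_left[of 1 1 x] by (simp add: zscale_1)
    have fm: "reflection D \<mu> (reflection D \<alpha> \<mu>) = \<mu> + zscale 2 ?d"
      by (simp add: reflection_def[of _ \<alpha>] za z2 rm.diff rm.add reflection_self[OF m])
         (simp add: reflection_def za z2)
    show ?thesis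
      by (simp add: f_def ra.add rm.add additive_zscale[OF reflection_additive] fd fm
          zscale_add_left distrib_left)
  qed
  have inR: "\<mu> + zscale (2 * int k) ?d \<in> R" for k
  proof (induction k)
    case 0 then show ?case using m by (simp add: zscale_0)
  next
    case (Suc k)
    then have "f (\<mu> + zscale (2 * int k) ?d) \<in> R"
      by (simp add: f_def reflection_in_roots[OF m] reflection_in_roots[OF a])
    then show ?case by (simp only: step)
  qed
  have "\<not> inj (\<lambda>k. \<mu> + zscale (2 * int k) ?d)"
  proof
    assume i: "inj (\<lambda>k. \<mu> + zscale (2 * int k) ?d)"
    have "range (\<lambda>k. \<mu> + zscale (2 * int k) ?d) \<subseteq> R" using inR by blast
    then have "finite (range (\<lambda>k. \<mu> + zscale (2 * int k) ?d))" using finite_roots finite_subset by blast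
    then have "finite (UNIV :: nat set)" by (rule finite_imageD) (rule i)
    then show False by simp
  qed
  then obtain j k :: nat where jk: "j \<noteq> k" "zscale (2 * int j) ?d = zscale (2 * int k) ?d"
    unfolding inj_def by auto
  then have "zscale (2 * int j - 2 * int k) ?d = 0" by (simp add: zscale_diff_left)
  then have "zscale (2 * int j - 2 * int k) \<alpha> = zscale (2 * int j - 2 * int k) \<mu>"
    by (simp add: Z.scale_right_diff_distrib)
  then show ?thesis by (intro reduced[OF m a]) (use jk in auto)
qed

text \<open>Minimal coroots are long: another root at an acute angle to \<open>\<mu>\<close> has pairing exactly 1 with it. If the pairing were larger, the coroot of \<open>\<alpha>\<close> or that of \<open>- reflection D \<mu> \<alpha>\<close> would lie strictly below the coroot of \<open>\<mu>\<close>.\<close>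

lemma min_root_acute:
  assumes "\<mu> \<in> min_coroot_roots D" "\<alpha> \<in> R" "\<alpha> \<noteq> \<mu>" "0 < pr \<mu> (cr \<alpha>)"
  shows "pr \<mu> (cr \<alpha>) = 1 \<and> reflection D \<mu> \<alpha> \<in> pos_roots D"
proof -
  note m = min_root[OF assms(1)] and a = assms(2)
  have am: "\<alpha> \<noteq> - \<mu>"
    using assms(4) pairing_coroot[OF m] by (auto simp: coroot_minus[OF m] pr_simps)
  have ac: "0 < pr \<alpha> (cr \<mu>)" using assms(4) pr_sign[OF m a] by simp
  have mneg: "- cr \<mu> \<in> nat_span (cr ` B)"
    using pos_coroot[OF min_root_negative[OF assms(1)]] by (simp add: coroot_minus[OF m])
  have notbelow: False if "\<gamma> \<in> R" "\<gamma> \<noteq> \<mu>" "cr \<mu> - cr \<gamma> \<in> nat_span (cr ` B)" for \<gamma>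
    using min_coroot_minimal[OF assms(1)] that by blast
  have one: "pr \<mu> (cr \<alpha>) = 1"
  proof (rule ccontr)
    assume "pr \<mu> (cr \<alpha>) \<noteq> 1"
    then have c: "2 \<le> pr \<mu> (cr \<alpha>)" using assms(4) by simp
    have n: "pr \<alpha> (cr \<mu>) = 1"
      using bounded_angle[OF a m c] assms(3) am ac by fastforce
    let ?g = "reflection D \<alpha> \<mu>"
    have g: "?g \<in> R" "cr ?g = cr \<mu> - cr \<alpha>"
      using reflection_in_roots[OF a m] by (simp_all add: coroot_reflection[OF a m] coreflection_def n zscale_1)
    show False
    proof (cases "?g \<in> pos_roots D")
      case True
      then show False using pos_coroot[OF True] notbelow[OF a assms(3)] by (simp add: g)
    next
      case False
      then have gn: "cr (- ?g) \<in> nat_span (cr ` B)" using pos_cases[OF g(1)] pos_coroot by blast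
      let ?d = "- reflection D \<mu> \<alpha>"
      have d: "?d \<in> R" "cr ?d = zscale (pr \<mu> (cr \<alpha>)) (cr \<mu>) - cr \<alpha>"
        using reflection_in_roots[OF m a] neg_in_roots
        by (auto simp: coroot_minus coroot_reflection[OF m a] coreflection_def)
      have "cr \<mu> - cr ?d = cr (- ?g) + zscale (pr \<mu> (cr \<alpha>) - 2) (- cr \<mu>)"
        unfolding d coroot_minus[OF g(1)] g(2)
        by (simp add: zscale_diff_left zscale_add_left[of 1 1, simplified] zscale_1)
      also have "\<dots> \<in> nat_span (cr ` B)"
        using c by (intro nat_span_add gn nat_span_zscale mneg) simp
      finally have "?d = \<mu>" using notbelow[OF d(1)] by blast
      then have "reflection D \<mu> \<alpha> = - \<mu>" by (metis minus_minus)
      then have "\<alpha> = \<mu>"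
        using reflection_involution[OF m, of \<alpha>] reflection_involution[OF m, of \<mu>] reflection_self[OF m] by simp
      then show False using assms(3) by blast
    qed
  qed
  have "reflection D \<mu> \<alpha> \<in> pos_roots D"
  proof (rule ccontr)
    assume "\<not> ?thesis"
    then have "cr (- reflection D \<mu> \<alpha>) \<in> nat_span (cr ` B)"
      using pos_cases[OF reflection_in_roots[OF m a]] pos_coroot by blast
    then have "cr \<mu> - cr \<alpha> \<in> nat_span (cr ` B)"
      by (simp add: coroot_minus[OF reflection_in_roots[OF m a]] coroot_reflection[OF m a] coreflection_def one zscale_1)
    then show False using notbelow[OF a assms(3)] by blast
  qed
  then show ?thesis using one by blast
qed

subsection \<open>The finite Weyl group\<close>

lemma group_GL: "group (GL :: ('x \<Rightarrow> 'x) monoid)"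
proof (rule groupI)
  fix f :: "'x \<Rightarrow> 'x" assume "f \<in> carrier GL"
  then have f: "bij f" "additive f" by (auto simp: GL_def)
  interpret f: additive f by (rule f(2))
  have "additive (inv_into UNIV f)"
  proof (rule additive.intro)
    fix x y
    have "f (inv_into UNIV f x + inv_into UNIV f y) = x + y"
      by (simp add: f.add bij_is_surj[OF f(1)] surj_f_inv_f)
    then show "inv_into UNIV f (x + y) = inv_into UNIV f x + inv_into UNIV f y"
      using f(1) by (metis bij_inv_eq_iff)
  qed
  moreover have "inv_into UNIV f \<circ> f = id" using f(1) by (simp add: bij_is_inj)
  ultimately show "\<exists>g\<in>carrier GL. g \<otimes>\<^bsub>GL\<^esub> f = \<one>\<^bsub>GL\<^esub>"
    using f(1) by (intro bexI[of _ "inv_into UNIV f"]) (auto simp: GL_def bij_imp_bij_inv)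
qed (auto simp: GL_def bij_comp additive_def)

lemma GL_inv:
  assumes "f \<in> carrier (GL :: ('x \<Rightarrow> 'x) monoid)" shows "inv\<^bsub>GL\<^esub> f = inv_into UNIV f"
proof -
  interpret group "GL :: ('x \<Rightarrow> 'x) monoid" by (rule group_GL)
  have "f \<circ> inv\<^bsub>GL\<^esub> f = id" using r_inv[OF assms] by (simp add: GL_def)
  moreover have "bij f" using assms by (simp add: GL_def)
  ultimately show ?thesis by (metis bij_is_inj comp_assoc id_comp comp_id inv_o_cancel)
qed

lemma reflection_GL: "\<alpha> \<in> R \<Longrightarrow> reflection D \<alpha> \<in> carrier GL"
  using reflection_involution[of \<alpha>] reflection_additive[of \<alpha>]
  by (auto simp: GL_def intro!: o_bij[of "reflection D \<alpha>"])

abbreviation W0 :: "('x \<Rightarrow> 'x) set" where "W0 \<equiv> finite_weyl D"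

lemma W0_GL: "v \<in> W0 \<Longrightarrow> v \<in> carrier GL"
  unfolding finite_weyl_def using reflection_GL
  by (intro group.generate_in_carrier[OF group_GL, of "reflection D ` R"]) auto

lemma W0_additive: "v \<in> W0 \<Longrightarrow> additive v" and W0_bij: "v \<in> W0 \<Longrightarrow> bij v"
  using W0_GL by (auto simp: GL_def)

lemma W0_id: "id \<in> W0"
  using generate.one[of GL "reflection D ` R"] by (simp add: finite_weyl_def GL_def)

lemma W0_comp: "v \<in> W0 \<Longrightarrow> v' \<in> W0 \<Longrightarrow> v \<circ> v' \<in> W0"
  using generate.eng[of v GL "reflection D ` R" v'] by (simp add: finite_weyl_def GL_def)

lemma W0_inv:
  assumes "v \<in> W0" shows "inv_into UNIV v \<in> W0"
proof -
  have "inv\<^bsub>GL\<^esub> v \<in> W0"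
    using assms unfolding finite_weyl_def
    by (intro group.generate_m_inv_closed[OF group_GL]) (use reflection_GL in auto)
  then show ?thesis using GL_inv[OF W0_GL[OF assms]] by simp
qed

lemma W0_reflection: "\<alpha> \<in> R \<Longrightarrow> reflection D \<alpha> \<in> W0"
  unfolding finite_weyl_def by (rule generate.incl) blast

text \<open>Reflections are their own inverses, so the generated group is reached by left multiplications.\<close>

lemma W0_induct [consumes 1, case_names id reflection]:
  assumes "v \<in> W0" "P id"
    "\<And>\<alpha> v. \<alpha> \<in> R \<Longrightarrow> v \<in> W0 \<Longrightarrow> P v \<Longrightarrow> P (reflection D \<alpha> \<circ> v)"
  shows "P v"
proof -
  have refl: "P (reflection D \<alpha> \<circ> v)" if "\<alpha> \<in> R" "v \<in> W0" "P v" for \<alpha> v by (rule assms(3)[OF that])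
  have "\<forall>u\<in>W0. P u \<longrightarrow> P (v \<circ> u)"
    using assms(1) unfolding finite_weyl_def
  proof (induction rule: generate.induct)
    case one then show ?case by (simp add: GL_def)
  next
    case (incl h) then show ?case using refl unfolding finite_weyl_def by blast
  next
    case (inv h)
    then obtain \<alpha> where a: "\<alpha> \<in> R" "h = reflection D \<alpha>" by blast
    have "inv\<^bsub>GL\<^esub> h = h"
      using a reflection_GL[OF a(1)] reflection_involution[OF a(1)]
      by (simp add: GL_inv inv_equality)
    then show ?case using refl a unfolding finite_weyl_def by metis
  next
    case (eng h1 h2)
    show ?case
    proof (intro ballI impI)
      fix u assume u: "u \<in> generate GL (reflection D ` R)" "P u"
      have "h2 \<circ> u \<in> W0" using W0_comp eng(2) u(1) by (simp add: finite_weyl_def)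
      then have "P (h1 \<circ> (h2 \<circ> u))" using eng u unfolding finite_weyl_def by blast
      then show "P (h1 \<otimes>\<^bsub>GL\<^esub> h2 \<circ> u)" by (simp add: GL_def comp_assoc)
    qed
  qed
  then show ?thesis using W0_id assms(2) by fastforce
qed

lemma W0_root: "v \<in> W0 \<Longrightarrow> \<alpha> \<in> R \<Longrightarrow> v \<alpha> \<in> R"
  by (induction v rule: W0_induct) (auto simp: reflection_in_roots)

lemma W0_pr: "v \<in> W0 \<Longrightarrow> \<alpha> \<in> R \<Longrightarrow> pr (v x) (cr (v \<alpha>)) = pr x (cr \<alpha>)"
  by (induction v rule: W0_induct)
     (simp_all add: W0_root coroot_reflection pr_reflection coreflection_involution)

end

section \<open>The extended affine Weyl group and its affine roots\<close>

text \<open>The source of all squares of monomials: the orbits of a fixed-point-free involution have two elements.\<close>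

lemma sum_involution_double:
  fixes f :: "'a \<Rightarrow> 'b::comm_monoid_add"
  assumes "finite A"
    and "\<And>x. x \<in> A \<Longrightarrow> \<tau> x \<in> A \<and> \<tau> x \<noteq> x \<and> \<tau> (\<tau> x) = x \<and> f (\<tau> x) = f x"
  shows "\<exists>m. sum f A = m + m"
  using assms
proof (induction "card A" arbitrary: A rule: less_induct)
  case less
  show ?case
  proof (cases "A = {}")
    case True then show ?thesis by (intro exI[of _ 0]) simp
  next
    case False
    then obtain x where x: "x \<in> A" by blast
    let ?A = "A - {x, \<tau> x}"
    have tx: "\<tau> x \<in> A" "\<tau> x \<noteq> x" "\<tau> (\<tau> x) = x" "f (\<tau> x) = f x" using less.prems(2)[OF x] by blast+
    have "card ?A < card A" using less.prems(1) x by (intro psubset_card_mono) auto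
    moreover have "\<tau> y \<in> ?A \<and> \<tau> y \<noteq> y \<and> \<tau> (\<tau> y) = y \<and> f (\<tau> y) = f y" if "y \<in> ?A" for y
    proof -
      have y: "y \<in> A" "y \<noteq> x" "y \<noteq> \<tau> x" using that by auto
      have ty: "\<tau> y \<in> A" "\<tau> y \<noteq> y" "\<tau> (\<tau> y) = y" "f (\<tau> y) = f y" using less.prems(2)[OF y(1)] by blast+
      have "\<tau> y \<noteq> x" "\<tau> y \<noteq> \<tau> x" using ty(3) tx(3) y by metis+
      then show ?thesis using ty by blast
    qed
    ultimately obtain m where m: "sum f ?A = m + m"
      using less.hyps[of ?A] less.prems(1) by blast
    have "sum f A = f x + (f (\<tau> x) + sum f ?A)"
      using less.prems(1) x tx
      by (simp add: sum.remove[of A x] sum.remove[of "A - {x}" "\<tau> x"] Diff_insert2[of A x "{\<tau> x}"] insert_commute)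
    then show ?thesis using m tx(4) by (intro exI[of _ "f x + m"]) (simp add: ac_simps)
  qed
qed

context reduced_based_root_datum
begin

abbreviation WG :: "'x weyl monoid" where "WG \<equiv> weyl_group D"
abbreviation W :: "'x weyl set" where "W \<equiv> carrier WG"

lemma W_carrier: "W = W0 \<times> UNIV"
  by (simp add: weyl_group_def)

lemma W_mult: "(v, x) \<otimes>\<^bsub>WG\<^esub> (v', x') = (v \<circ> v', inv_into UNIV v' x + x')"
  by (simp add: weyl_group_def)

lemma W_one: "\<one>\<^bsub>WG\<^esub> = (id, 0)"
  by (simp add: weyl_group_def)

lemma W0_inv_apply: "v \<in> W0 \<Longrightarrow> inv_into UNIV v (v x) = x" "v \<in> W0 \<Longrightarrow> v (inv_into UNIV v x) = x"
  using W0_bij by (simp_all add: bij_is_inj bij_is_surj surj_f_inv_f)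

lemma W0_inv_comp:
  "v \<in> W0 \<Longrightarrow> v' \<in> W0 \<Longrightarrow> inv_into UNIV (v \<circ> v') x = inv_into UNIV v' (inv_into UNIV v x)"
  using o_inv_distrib[of v v'] W0_bij by (simp add: bij_is_inj bij_is_surj)

lemma group_WG: "group WG"
proof (rule groupI)
  fix a b c assume "a \<in> W" "b \<in> W" "c \<in> W"
  then show "a \<otimes>\<^bsub>WG\<^esub> b \<otimes>\<^bsub>WG\<^esub> c = a \<otimes>\<^bsub>WG\<^esub> (b \<otimes>\<^bsub>WG\<^esub> c)"
    by (cases a; cases b; cases c)
       (simp add: W_carrier W_mult W0_inv_comp additive.add[OF W0_additive[OF W0_inv]] comp_assoc add.assoc)
next
  fix a assume "a \<in> W"
  then obtain v x where a: "a = (v, x)" "v \<in> W0" by (auto simp: W_carrier)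
  have "inv_into UNIV v \<circ> v = id" using a W0_bij by (simp add: bij_is_inj)
  then have "(inv_into UNIV v, - v x) \<otimes>\<^bsub>WG\<^esub> a = \<one>\<^bsub>WG\<^esub>"
    using a by (simp add: W_mult W_one additive.minus[OF W0_additive[OF W0_inv]] W0_inv_apply)
  then show "\<exists>b\<in>W. b \<otimes>\<^bsub>WG\<^esub> a = \<one>\<^bsub>WG\<^esub>"
    using W0_inv[OF a(2)] by (intro bexI[of _ "(inv_into UNIV v, - v x)"]) (auto simp: W_carrier)
next
  fix a b assume "a \<in> W" "b \<in> W"
  then show "a \<otimes>\<^bsub>WG\<^esub> b \<in> W"
    by (cases a; cases b) (simp add: W_carrier W_mult W0_comp)
next
  fix a assume "a \<in> W"
  then show "\<one>\<^bsub>WG\<^esub> \<otimes>\<^bsub>WG\<^esub> a = a"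
    by (cases a) (simp add: W_carrier W_mult W_one additive.zero[OF W0_additive[OF W0_inv]])
qed (simp add: W_carrier W_one W0_id)

sublocale WG: group WG
  by (rule group_WG)

text \<open>The pair \<open>(\<alpha>, k)\<close> stands for the affine function \<open>y \<mapsto> (y, \<alpha>\<^sup>\<or>) + k\<close>. The element \<open>v e\<^sup>x\<close> acts on points by \<open>y \<mapsto> v (y + x)\<close> and on affine functions by composition with the inverse. An affine root is positive if it is positive on the alcove whose closure contains 0 and that lies in the dominant chamber, which decides the sign at \<open>k = 0\<close>; \<open>arefl a\<close> is the reflection in the hyperplane where \<open>a\<close> vanishes.\<close>

definition affine_roots :: "('x \<times> int) set" where "affine_roots = R \<times> UNIV"

definition act :: "'x weyl \<Rightarrow> 'x \<times> int \<Rightarrow> 'x \<times> int" where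
  "act w a = (fst w (fst a), snd a - pr (snd w) (cr (fst a)))"

definition apos :: "'x \<times> int \<Rightarrow> bool" where
  "apos a \<longleftrightarrow> 0 < snd a \<or> snd a = 0 \<and> fst a \<in> pos_roots D"

definition opp :: "'x \<times> int \<Rightarrow> 'x \<times> int" where "opp a = (- fst a, - snd a)"

definition arefl :: "'x \<times> int \<Rightarrow> 'x weyl" where
  "arefl a = (reflection D (fst a), zscale (snd a) (fst a))"

lemma act_closed: "w \<in> W \<Longrightarrow> a \<in> affine_roots \<Longrightarrow> act w a \<in> affine_roots"
  by (auto simp: W_carrier affine_roots_def act_def W0_root)

lemma act_mult:
  assumes "w \<in> W" "w' \<in> W" "a \<in> affine_roots"
  shows "act (w \<otimes>\<^bsub>WG\<^esub> w') a = act w (act w' a)"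
proof -
  obtain v x v' x' \<alpha> k where e: "w = (v, x)" "w' = (v', x')" "a = (\<alpha>, k)" "v \<in> W0" "v' \<in> W0" "\<alpha> \<in> R"
    using assms by (auto simp: W_carrier affine_roots_def)
  have "pr (inv_into UNIV v' x) (cr \<alpha>) = pr x (cr (v' \<alpha>))"
    using W0_pr[OF e(5,6), of "inv_into UNIV v' x"] by (simp add: W0_inv_apply e(5))
  then show ?thesis by (simp add: e(1-3) act_def W_mult pr_simps)
qed

lemma act_one: "act \<one>\<^bsub>WG\<^esub> a = a"
  by (simp add: act_def W_one pr_simps)

lemma act_inv: "w \<in> W \<Longrightarrow> a \<in> affine_roots \<Longrightarrow> act (inv\<^bsub>WG\<^esub> w) (act w a) = a"
  "w \<in> W \<Longrightarrow> a \<in> affine_roots \<Longrightarrow> act w (act (inv\<^bsub>WG\<^esub> w) a) = a"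
  by (simp_all add: act_one flip: act_mult)

lemma opp_closed: "a \<in> affine_roots \<Longrightarrow> opp a \<in> affine_roots"
  by (auto simp: affine_roots_def opp_def neg_in_roots)

lemma opp_opp: "opp (opp a) = a"
  by (simp add: opp_def)

lemma act_opp: "w \<in> W \<Longrightarrow> a \<in> affine_roots \<Longrightarrow> act w (opp a) = opp (act w a)"
  by (auto simp: W_carrier affine_roots_def act_def opp_def coroot_minus pr_simps additive.minus[OF W0_additive])

lemma apos_opp: "a \<in> affine_roots \<Longrightarrow> apos (opp a) \<longleftrightarrow> \<not> apos a"
  by (auto simp: affine_roots_def apos_def opp_def neg_iff)

lemma arefl_closed: "a \<in> affine_roots \<Longrightarrow> arefl a \<in> W"
  by (auto simp: affine_roots_def arefl_def W_carrier W0_reflection)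

lemma act_arefl: "act (arefl a) b = (reflection D (fst a) (fst b), snd b - snd a * pr (fst a) (cr (fst b)))"
  by (simp add: act_def arefl_def pr_zscale)

lemma act_arefl_self: "a \<in> affine_roots \<Longrightarrow> act (arefl a) a = opp a"
  by (auto simp: affine_roots_def act_arefl opp_def reflection_self pairing_coroot)

lemma inv_reflection: "\<alpha> \<in> R \<Longrightarrow> inv_into UNIV (reflection D \<alpha>) = reflection D \<alpha>"
  by (intro inv_equality) (auto simp: reflection_involution)

lemma arefl_square: "a \<in> affine_roots \<Longrightarrow> arefl a \<otimes>\<^bsub>WG\<^esub> arefl a = \<one>\<^bsub>WG\<^esub>"
  by (auto simp: affine_roots_def arefl_def W_mult W_one inv_reflection reflection_involution fun_eq_iff
      additive_zscale[OF reflection_additive] reflection_self)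

lemma arefl_mult_cancel:
  "w \<in> W \<Longrightarrow> a \<in> affine_roots \<Longrightarrow> w \<otimes>\<^bsub>WG\<^esub> arefl a \<otimes>\<^bsub>WG\<^esub> arefl a = w"
  by (simp add: WG.m_assoc arefl_closed arefl_square)

lemma act_arefl_twice: "a \<in> affine_roots \<Longrightarrow> b \<in> affine_roots \<Longrightarrow> act (arefl a) (act (arefl a) b) = b"
  by (simp add: arefl_closed arefl_square act_one flip: act_mult)

lemma arefl_opp: "a \<in> affine_roots \<Longrightarrow> arefl (opp a) = arefl a"
  by (auto simp: affine_roots_def arefl_def opp_def reflection_def coroot_minus pr_simps fun_eq_iff)

lemma arefl_act:
  assumes "w \<in> W" "a \<in> affine_roots"
  shows "arefl (act w a) = w \<otimes>\<^bsub>WG\<^esub> arefl a \<otimes>\<^bsub>WG\<^esub> inv\<^bsub>WG\<^esub> w"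
proof -
  obtain v x \<alpha> k where e: "w = (v, x)" "a = (\<alpha>, k)" "v \<in> W0" "\<alpha> \<in> R"
    using assms by (auto simp: W_carrier affine_roots_def)
  note add = additive.diff[OF W0_additive[OF e(3)]] additive_zscale[OF W0_additive[OF e(3)]]
    additive_zscale[OF W0_additive[OF W0_inv[OF e(3)]]]
  have "reflection D (v \<alpha>) (v y) = v (reflection D \<alpha> y)" for y
    by (simp add: reflection_def W0_pr[OF e(3,4)] add)
  then have "reflection D (v \<alpha>) \<circ> v = v \<circ> reflection D \<alpha>" by (simp add: fun_eq_iff)
  then have "arefl (act w a) \<otimes>\<^bsub>WG\<^esub> w = w \<otimes>\<^bsub>WG\<^esub> arefl a"
    by (simp add: e(1,2) arefl_def act_def W_mult add W0_inv_apply[OF e(3)] inv_reflection[OF e(4)])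
       (simp add: reflection_def zscale_diff_left)
  then show ?thesis
    using assms by (metis WG.inv_solve_right' WG.m_closed act_closed arefl_closed)
qed

subsection \<open>Positivity as the sign of a linear functional\<close>

text \<open>The value of an affine function at the point \<open>p / scale_bound\<close>, multiplied by \<open>scale_bound\<close> to stay in the integers. The bound is so large that \<open>two_rho / scale_bound\<close> is a point of the base alcove. Positivity thus becomes the sign of a function that is additive in the coroot and the constant.\<close>

definition scale_bound :: int where "scale_bound = 1 + (\<Sum>\<gamma>\<in>R. \<bar>pr two_rho (cr \<gamma>)\<bar>)"

definition eval_at :: "'x \<Rightarrow> 'x \<times> int \<Rightarrow> int" where
  "eval_at p a = scale_bound * snd a + pr p (cr (fst a))"

lemma scale_bound_pos: "0 < scale_bound"
  unfolding scale_bound_def by (simp add: sum_nonneg add_pos_nonneg)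

lemma scale_bound: "\<alpha> \<in> R \<Longrightarrow> \<bar>pr two_rho (cr \<alpha>)\<bar> < scale_bound"
  unfolding scale_bound_def
  using member_le_sum[of \<alpha> R "\<lambda>\<gamma>. \<bar>pr two_rho (cr \<gamma>)\<bar>"] finite_roots by simp

lemma apos_iff:
  assumes "a \<in> affine_roots" shows "apos a \<longleftrightarrow> 0 < eval_at two_rho a"
proof -
  obtain \<alpha> k where a: "a = (\<alpha>, k)" "\<alpha> \<in> R" using assms by (auto simp: affine_roots_def)
  note b = scale_bound[OF a(2)]
  consider "k > 0" | "k = 0" | "k < 0" by linarith
  then show ?thesis
  proof cases
    case 1
    then have "scale_bound * 1 \<le> scale_bound * k" using scale_bound_pos by (intro mult_left_mono) auto
    then show ?thesis using 1 b by (simp add: a apos_def eval_at_def)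
  next
    case 2 then show ?thesis using pr_two_rho_iff[OF a(2)] by (simp add: a apos_def eval_at_def)
  next
    case 3
    then have "scale_bound * k \<le> scale_bound * (-1)" using scale_bound_pos by (intro mult_left_mono) auto
    then show ?thesis using 3 b by (simp add: a apos_def eval_at_def)
  qed
qed

text \<open>\<open>p\<close> encodes the preimage under \<open>w\<close> of the point of the base alcove.\<close>

lemma eval_act:
  assumes "w \<in> W"
  shows "\<exists>p. \<forall>a\<in>affine_roots. eval_at two_rho (act w a) = eval_at p a"
proof -
  obtain v x where w: "w = (v, x)" "v \<in> W0" using assms by (auto simp: W_carrier)
  have "pr two_rho (cr (v \<alpha>)) = pr (inv_into UNIV v two_rho) (cr \<alpha>)" if "\<alpha> \<in> R" for \<alpha>
    using W0_pr[OF w(2) that, of "inv_into UNIV v two_rho"] by (simp add: W0_inv_apply w(2))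
  then have "eval_at two_rho (act w a) = eval_at (inv_into UNIV v two_rho - zscale scale_bound x) a"
    if "a \<in> affine_roots" for a
    using that by (auto simp: affine_roots_def eval_at_def act_def w(1) pr_simps pr_zscale algebra_simps)
  then show ?thesis by blast
qed

lemma eval_arefl:
  assumes "a \<in> affine_roots" "b \<in> affine_roots"
  shows "eval_at p (act (arefl a) b) = eval_at p b - pr (fst a) (cr (fst b)) * eval_at p a"
  using assms
  by (auto simp: affine_roots_def eval_at_def act_arefl coroot_reflection coreflection_def pr_simps pr_zscale algebra_simps)

subsection \<open>Inversions and length\<close>

definition inversions :: "'x weyl \<Rightarrow> ('x \<times> int) set" where
  "inversions w = {a \<in> affine_roots. apos a \<and> \<not> apos (act w a)}"

lemma roots_split: "R = pos_roots D \<union> uminus ` pos_roots D"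
proof
  show "R \<subseteq> pos_roots D \<union> uminus ` pos_roots D"
    using pos_cases by (metis UnCI image_eqI minus_minus subsetI)
qed (use pos_subset neg_in_roots in blast)

text \<open>For a positive root \<open>\<alpha>\<close>, the hyperplanes of direction \<open>\<alpha>\<close> that are crossed come from constants attached to \<open>\<alpha>\<close> or to \<open>- \<alpha>\<close>, depending on the sign of \<open>(x, \<alpha>\<^sup>\<or>)\<close>; the shift by 1 in the length formula arises because the constant 0 counts for \<open>\<alpha>\<close> but not for \<open>- \<alpha>\<close>.\<close>

lemma inversions_card:
  assumes "w \<in> W"
  shows "finite (inversions w) \<and> card (inversions w) = len D w"
proof -
  obtain v x where w: "w = (v, x)" "v \<in> W0" using assms by (auto simp: W_carrier)
  define K where "K \<alpha> = {k. apos (\<alpha>, k) \<and> \<not> apos (v \<alpha>, k - pr x (cr \<alpha>))}" for \<alpha>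
  have Inv: "inversions w = Sigma R K"
    by (auto simp: inversions_def affine_roots_def K_def act_def w)
  have K: "finite (K \<alpha>) \<and> finite (K (- \<alpha>)) \<and> card (K \<alpha>) + card (K (- \<alpha>)) =
      (if v \<alpha> \<in> pos_roots D then nat \<bar>pr x (cr \<alpha>)\<bar> else nat \<bar>1 + pr x (cr \<alpha>)\<bar>)"
    if a: "\<alpha> \<in> pos_roots D" for \<alpha>
  proof -
    have aR: "\<alpha> \<in> R" and vR: "v \<alpha> \<in> R" using a pos_subset W0_root[OF w(2)] by blast+
    have na: "- \<alpha> \<notin> pos_roots D" using pos_neg_disjoint[OF a] .
    have nv: "v (- \<alpha>) = - v \<alpha>" by (rule additive.minus[OF W0_additive[OF w(2)]])
    let ?n = "pr x (cr \<alpha>)"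
    show ?thesis
    proof (cases "v \<alpha> \<in> pos_roots D")
      case True
      then have "- v \<alpha> \<notin> pos_roots D" using pos_neg_disjoint by blast
      then have "K \<alpha> = {0..<?n}" "K (- \<alpha>) = {1..- ?n}"
        using a na True by (auto simp: K_def apos_def nv coroot_minus[OF aR] pr_simps)
      then show ?thesis using True by simp
    next
      case False
      then have "- v \<alpha> \<in> pos_roots D" using vR pos_cases by blast
      then have "K \<alpha> = {0..?n}" "K (- \<alpha>) = {1..- ?n - 1}"
        using a na False by (auto simp: K_def apos_def nv coroot_minus[OF aR] pr_simps)
      then show ?thesis using False by simp
    qed
  qed
  have fin: "finite (K \<alpha>)" if "\<alpha> \<in> R" for \<alpha>
  proof (cases "\<alpha> \<in> pos_roots D")
    case False
    then have "- \<alpha> \<in> pos_roots D" using pos_cases that by blast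
    then show ?thesis using K[of "- \<alpha>"] by simp
  qed (use K in blast)
  have "card (inversions w) = (\<Sum>\<alpha>\<in>R. card (K \<alpha>))"
    unfolding Inv using finite_roots fin by (intro card_SigmaI) auto
  also have "\<dots> = (\<Sum>\<alpha>\<in>pos_roots D. card (K \<alpha>)) + (\<Sum>\<alpha>\<in>uminus ` pos_roots D. card (K \<alpha>))"
    by (subst roots_split, rule sum.union_disjoint) (use finite_pos pos_neg_disjoint in auto)
  also have "(\<Sum>\<alpha>\<in>uminus ` pos_roots D. card (K \<alpha>)) = (\<Sum>\<alpha>\<in>pos_roots D. card (K (- \<alpha>)))"
    by (subst sum.reindex) (auto simp: inj_on_def)
  also have "(\<Sum>\<alpha>\<in>pos_roots D. card (K \<alpha>)) + \<dots> =
      (\<Sum>\<alpha>\<in>pos_roots D. if v \<alpha> \<in> pos_roots D then nat \<bar>pr x (cr \<alpha>)\<bar> else nat \<bar>1 + pr x (cr \<alpha>)\<bar>)"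
    using K by (simp flip: sum.distrib)
  also have "\<dots> = len D w"
  proof -
    have "{\<alpha> \<in> pos_roots D. v \<alpha> \<in> neg_roots D} = {\<alpha> \<in> pos_roots D. v \<alpha> \<notin> pos_roots D}"
      using neg_roots_iff neg_iff W0_root[OF w(2)] pos_subset by blast
    then show ?thesis
      by (simp add: w(1) sum.If_cases[OF finite_pos] Int_def Collect_neg_eq)
  qed
  finally show ?thesis using finite_roots fin unfolding Inv by auto
qed

lemmas finite_inversions = inversions_card[THEN conjunct1]
lemmas card_inversions = inversions_card[THEN conjunct2]

lemma inversionsD:
  assumes "b \<in> inversions w" shows "b \<in> affine_roots" "apos b" "\<not> apos (act w b)"
  using assms by (auto simp: inversions_def)

subsection \<open>Multiplication by a reflection\<close>

definition excess :: "'x weyl \<Rightarrow> 'x \<times> int \<Rightarrow> ('x \<times> int) set" where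
  "excess w a = {b \<in> inversions (arefl a). b \<noteq> a \<and> apos (act w b) \<and> \<not> apos (act w (act (arefl a) b))}"

text \<open>Away from \<open>a\<close> and the excess, an inversion \<open>b\<close> of \<open>w t\<close> corresponds to the inversion \<open>t b\<close> of \<open>w\<close> if \<open>t b\<close> is positive and to \<open>b\<close> itself otherwise. The recipe is its own inverse. In the second case, \<open>b\<close> and \<open>- t b\<close> are positive with sum a positive multiple of \<open>a\<close>, and \<open>w a\<close> is positive, so \<open>w\<close> cannot make both of them negative.\<close>

lemma sum_inversions_reflection:
  fixes f :: "'x \<times> int \<Rightarrow> 'b::comm_monoid_add"
  assumes w: "w \<in> W" and a: "a \<in> affine_roots" and pa: "apos a" and wa: "apos (act w a)"
    and f: "\<And>b. b \<in> affine_roots \<Longrightarrow> f (act (arefl a) b) = f b"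
  shows "sum f (inversions (w \<otimes>\<^bsub>WG\<^esub> arefl a)) = sum f (inversions w) + f a + sum f (excess w a)"
proof -
  let ?t = "arefl a" let ?I = "inversions (w \<otimes>\<^bsub>WG\<^esub> ?t)" let ?E = "excess w a"
  note t = arefl_closed[OF a]
  have act_wt: "act (w \<otimes>\<^bsub>WG\<^esub> ?t) b = act w (act ?t b)" if "b \<in> affine_roots" for b
    by (rule act_mult[OF w t that])
  have tt: "act ?t (act ?t b) = b" "act ?t b \<in> affine_roots" if "b \<in> affine_roots" for b
    using act_arefl_twice[OF a that] act_closed[OF t that] by auto
  have fin: "finite ?I" by (rule finite_inversions) (simp add: w t)
  have aI: "a \<in> ?I"
    using a pa wa by (simp add: inversions_def act_wt act_arefl_self act_opp w act_closed apos_opp)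
  have EI: "?E \<subseteq> ?I" by (auto simp: excess_def inversions_def act_wt)
  have aE: "a \<notin> ?E" by (simp add: excess_def)
  let ?r = "\<lambda>b. if apos (act ?t b) then act ?t b else b"
  have "sum f (?I - ?E - {a}) = sum f (inversions w)"
  proof (rule sum.reindex_bij_witness[where i = ?r and j = ?r])
    fix b assume b: "b \<in> ?I - ?E - {a}"
    then have bI: "b \<in> affine_roots" "apos b" "\<not> apos (act w (act ?t b))"
      by (auto simp: inversions_def act_wt)
    show "?r (?r b) = b" using tt[OF bI(1)] bI(2) by auto
    show "?r b \<in> inversions w"
      using b bI tt[OF bI(1)] by (auto simp: inversions_def excess_def)
    show "f (?r b) = f b" using f[OF bI(1)] by simp
  next
    fix c assume "c \<in> inversions w"
    then have c: "c \<in> affine_roots" "apos c" "\<not> apos (act w c)" by (auto simp: inversions_def)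
    show "?r (?r c) = c" using tt[OF c(1)] c(2) by auto
    have wtc: "\<not> apos (act w (act ?t c))" if n: "\<not> apos (act ?t c)"
    proof -
      \<comment> \<open>The affine roots \<open>c\<close> and \<open>- t c\<close> add up to \<open>?m\<close> times \<open>a\<close>.\<close>
      let ?m = "pr (fst a) (cr (fst c))"
      obtain p where p: "\<forall>a\<in>affine_roots. eval_at two_rho (act w a) = eval_at p a"
        using eval_act[OF w] by blast
      have "eval_at two_rho c - ?m * eval_at two_rho a \<le> 0"
        using n apos_iff[OF tt(2)[OF c(1)]] eval_arefl[OF a c(1)] by simp
      then have "0 < ?m * eval_at two_rho a" using c(2) apos_iff[OF c(1)] by simp
      then have m: "0 < ?m" using pa apos_iff[OF a] by (simp add: zero_less_mult_iff)
      have "eval_at p c \<le> 0" "0 < ?m * eval_at p a"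
        using c(3) wa m by (simp_all add: apos_iff act_closed[OF w] a c(1) p)
      then have "eval_at p c - ?m * eval_at p a \<le> 0" by linarith
      then show ?thesis
        by (simp add: apos_iff act_closed[OF w] tt(2)[OF c(1)] p eval_arefl[OF a c(1)])
    qed
    have ca: "c \<noteq> a" using c(3) wa by blast
    have tca: "act ?t c \<noteq> a"
    proof
      assume "act ?t c = a"
      then have "c = opp a" using tt(1)[OF c(1)] act_arefl_self[OF a] by simp
      then show False using c(2) pa apos_opp[OF a] by simp
    qed
    show "?r c \<in> ?I - ?E - {a}"
      using c tt[OF c(1)] wtc ca tca by (auto simp: inversions_def excess_def act_wt)
  qed
  moreover have "sum f ?I = f a + sum f (?I - {a})" by (rule sum.remove[OF fin aI])
  moreover have "sum f (?I - {a}) = sum f (?I - {a} - ?E) + sum f ?E"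
    by (rule sum.subset_diff) (use EI aE fin in auto)
  moreover have "?I - {a} - ?E = ?I - ?E - {a}" by blast
  ultimately show ?thesis by (simp add: ac_simps)
qed

lemma finite_excess: "a \<in> affine_roots \<Longrightarrow> finite (excess w a)"
  using finite_inversions[OF arefl_closed[of a]] by (auto simp: excess_def intro: finite_subset[rotated])

text \<open>The involution \<open>b \<mapsto> - t b\<close> could fix \<open>b\<close> only if \<open>b\<close> were proportional to \<open>a\<close>, which reducedness limits to \<open>b = a\<close>; labels are preserved because \<open>- c\<close> is the image of \<open>c\<close> under its own reflection.\<close>

lemma sum_excess_double:
  fixes f :: "'x \<times> int \<Rightarrow> 'b::comm_monoid_add"
  assumes w: "w \<in> W" and a: "a \<in> affine_roots" and pa: "apos a"
    and f: "\<And>w b. w \<in> W \<Longrightarrow> b \<in> affine_roots \<Longrightarrow> f (act w b) = f b"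
  shows "\<exists>m. sum f (excess w a) = m + m"
proof (rule sum_involution_double[where \<tau> = "\<lambda>b. opp (act (arefl a) b)"])
  show "finite (excess w a)" by (rule finite_excess[OF a])
  let ?t = "arefl a"
  note t = arefl_closed[OF a]
  have fopp: "f (opp b) = f b" if "b \<in> affine_roots" for b
    using f[OF arefl_closed[OF that] that] act_arefl_self[OF that] by simp
  fix b assume "b \<in> excess w a"
  then have b: "b \<in> affine_roots" "apos b" "\<not> apos (act ?t b)" "b \<noteq> a" "apos (act w b)"
      "\<not> apos (act w (act ?t b))"
    by (auto simp: excess_def inversions_def)
  note tb = act_closed[OF t b(1)]
  have t_opp: "act ?t (opp (act ?t b)) = opp b"
    by (simp add: act_opp[OF t tb] act_arefl_twice[OF a b(1)])
  have ne_a: "opp (act ?t b) \<noteq> a"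
  proof
    assume "opp (act ?t b) = a"
    then have "opp b = opp a" using t_opp act_arefl_self[OF a] by simp
    then show False using b(4) by (metis opp_opp)
  qed
  have ne_b: "opp (act ?t b) \<noteq> b"
  proof
    assume "opp (act ?t b) = b"
    then have "act ?t b = opp b" by (metis opp_opp)
    moreover obtain \<alpha> k \<beta> j where e: "a = (\<alpha>, k)" "b = (\<beta>, j)" "\<alpha> \<in> R" "\<beta> \<in> R"
      using a b(1) by (auto simp: affine_roots_def)
    ultimately have eq: "reflection D \<alpha> \<beta> = - \<beta>" "j - k * pr \<alpha> (cr \<beta>) = - j"
      by (auto simp: act_arefl opp_def)
    have "\<beta> + \<beta> = zscale (pr \<beta> (cr \<alpha>)) \<alpha>"
      using eq(1) by (simp add: reflection_def algebra_simps)
    then have "zscale 2 \<beta> = zscale (pr \<beta> (cr \<alpha>)) \<alpha>"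
      using zscale_add_left[of 1 1 \<beta>] by (simp add: zscale_1)
    then consider "\<beta> = \<alpha>" | "\<beta> = - \<alpha>" using reduced[OF e(3,4), of 2] by auto
    then show False
    proof cases
      case 1 then show False using eq(2) b(4) by (simp add: e pairing_coroot)
    next
      case 2
      then have "b = opp a" using eq(2) e(3) by (simp add: e opp_def coroot_minus pairing_coroot pr_simps)
      then show False using b(2) pa apos_opp[OF a] by simp
    qed
  qed
  show "opp (act ?t b) \<in> excess w a \<and> opp (act ?t b) \<noteq> b \<and> opp (act ?t (opp (act ?t b))) = b \<and>
      f (opp (act ?t b)) = f b"
    using b tb ne_a ne_b w
    by (simp add: excess_def inversions_def opp_closed apos_opp t_opp opp_opp act_opp act_closed fopp f t)
qed

subsection \<open>Simple affine roots\<close>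

definition simple_affine :: "('x \<times> int) set" where
  "simple_affine = {(\<beta>, 0) | \<beta>. \<beta> \<in> B} \<union> {(\<mu>, 1) | \<mu>. \<mu> \<in> min_coroot_roots D}"

abbreviation S :: "'x weyl set" where "S \<equiv> simple_reflections D"

lemma S_eq: "S = arefl ` simple_affine"
  unfolding simple_affine_def simple_reflections_def image_Un setcompr_eq_image image_image
  by (simp add: arefl_def zscale_0 zscale_1)

lemma simple_affine_root: "a \<in> simple_affine \<Longrightarrow> a \<in> affine_roots"
  using simple_subset min_root by (auto simp: simple_affine_def affine_roots_def)

lemma simple_affine_apos: "a \<in> simple_affine \<Longrightarrow> apos a"
  using simple_pos by (auto simp: simple_affine_def apos_def)

text \<open>For the reflections in \<open>(\<mu>, 1)\<close> the pairings of \<open>\<mu>\<close> with the coroots of the roots other than \<open>\<mu>\<close> are at most 1, so a constant drops by at most 1; when it drops to 0, the root part becomes positive.\<close>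

lemma inversions_simple:
  assumes "a \<in> simple_affine" shows "inversions (arefl a) = {a}"
proof -
  have a: "a \<in> affine_roots" "apos a" using assms simple_affine_root simple_affine_apos by auto
  have "apos (act (arefl a) b)" if bR: "b \<in> affine_roots" and "apos b" "b \<noteq> a" for b
  proof -
    obtain \<gamma> j where b: "b = (\<gamma>, j)" "\<gamma> \<in> R"
      using bR by (cases b) (auto simp: affine_roots_def)
    consider \<beta> where "a = (\<beta>, 0)" "\<beta> \<in> B" | \<mu> where "a = (\<mu>, 1)" "\<mu> \<in> min_coroot_roots D"
      using assms by (auto simp: simple_affine_def)
    then show ?thesis
    proof cases
      case 1
      then show ?thesis using that simple_reflection_pos[OF 1(2), of \<gamma>]
        by (auto simp: b apos_def act_arefl)
    next
      case 2
      note m = min_root[OF 2(2)]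
      have mn: "- \<mu> \<in> pos_roots D" "\<mu> \<notin> pos_roots D"
        using min_root_negative[OF 2(2)] neg_iff[OF m] by auto
      let ?c = "pr \<mu> (cr \<gamma>)"
      show ?thesis
      proof (cases "\<gamma> = \<mu>")
        case True
        then show ?thesis using that mn
          by (auto simp: b 2(1) apos_def act_arefl reflection_self[OF m] pairing_coroot[OF m])
      next
        case False
        show ?thesis
        proof (cases "0 < ?c")
          case True
          then have "?c = 1" "reflection D \<mu> \<gamma> \<in> pos_roots D" "\<gamma> \<notin> pos_roots D"
            using min_root_acute[OF 2(2) b(2) False] min_root_obtuse[OF 2(2), of \<gamma>] by auto
          then show ?thesis using that by (auto simp: b 2(1) apos_def act_arefl)
        next
          case nc: False
          show ?thesis
          proof (cases "?c = 0")
            case True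
            then have "pr \<gamma> (cr \<mu>) * form \<mu> \<mu> = 0"
              using form_root[OF m, of \<gamma>] form_root[OF b(2), of \<mu>] form_sym[of \<mu> \<gamma>] by simp
            then have "reflection D \<mu> \<gamma> = \<gamma>"
              using form_root_pos[OF m] by (simp add: reflection_def zscale_0)
            then show ?thesis using that True by (auto simp: b 2(1) apos_def act_arefl)
          next
            case False
            then show ?thesis using nc that by (auto simp: b 2(1) apos_def act_arefl)
          qed
        qed
      qed
    qed
  qed
  then show ?thesis
    using a by (auto simp: inversions_def act_arefl_self apos_opp)
qed

lemma excess_simple: "a \<in> simple_affine \<Longrightarrow> excess w a = {}"
  by (auto simp: excess_def inversions_simple)

text \<open>Every positive affine root is a nonnegative combination of simple ones and of the constant 1: every coroot lies above a minimal one. As positivity after \<open>w\<close> is the sign of an additive functional, it suffices to test the simple affine roots.\<close>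

lemma apos_of_simple:
  assumes w: "w \<in> W" and pos: "\<And>a. a \<in> simple_affine \<Longrightarrow> apos (act w a)"
    and b: "b \<in> affine_roots" "apos b"
  shows "apos (act w b)"
proof -
  obtain p where p: "\<forall>a\<in>affine_roots. eval_at two_rho (act w a) = eval_at p a"
    using eval_act[OF w] by blast
  have ap: "apos (act w a) \<longleftrightarrow> 0 < eval_at p a" if "a \<in> affine_roots" for a
    using that by (simp add: apos_iff act_closed[OF w] p)
  have s: "0 < pr p (cr \<beta>)" if "\<beta> \<in> B" for \<beta>
    using pos[of "(\<beta>, 0)"] ap[of "(\<beta>, 0)"] that simple_affine_root[of "(\<beta>, 0)"]
    by (auto simp: simple_affine_def eval_at_def)
  have m: "0 < scale_bound + pr p (cr \<mu>)" if "\<mu> \<in> min_coroot_roots D" for \<mu>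
    using pos[of "(\<mu>, 1)"] ap[of "(\<mu>, 1)"] that simple_affine_root[of "(\<mu>, 1)"]
    by (auto simp: simple_affine_def eval_at_def)
  obtain \<gamma> j where bb: "b = (\<gamma>, j)" "\<gamma> \<in> R" using b(1) by (auto simp: affine_roots_def)
  have "0 < eval_at p b"
  proof (cases "j = 0")
    case True
    then have g: "\<gamma> \<in> pos_roots D" using b(2) by (simp add: bb apos_def)
    have "\<not> pr p (cr \<gamma>) \<le> 0"
      using nat_span_coroot_zero[OF pos_coroot[OF g] _ s] cr_nonzero[OF bb(2)] by blast
    then show ?thesis by (simp add: bb True eval_at_def)
  next
    case False
    then have j: "1 \<le> j" using b(2) by (auto simp: bb apos_def)
    obtain \<mu> where mu: "\<mu> \<in> min_coroot_roots D" "cr \<gamma> - cr \<mu> \<in> nat_span (cr ` B)"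
      using exists_min_below[OF bb(2)] by blast
    have "0 \<le> pr p (cr \<gamma> - cr \<mu>)" by (rule nat_span_coroot_nonneg[OF mu(2)]) (use s in force)
    moreover have "scale_bound * 1 \<le> scale_bound * j"
      using j scale_bound_pos by (intro mult_left_mono) auto
    ultimately show ?thesis using m[OF mu(1)] by (simp add: bb eval_at_def pr_simps)
  qed
  then show ?thesis using ap[OF b(1)] by simp
qed

lemma exists_descent:
  assumes "w \<in> W" "len D w \<noteq> 0" shows "\<exists>a\<in>simple_affine. \<not> apos (act w a)"
proof (rule ccontr)
  assume "\<not> ?thesis"
  then have "inversions w = {}" using apos_of_simple[OF assms(1)] by (auto simp: inversions_def)
  then show False using assms card_inversions[OF assms(1)] by simp
qed

lemma sum_inversions_up:
  fixes f :: "'x \<times> int \<Rightarrow> 'b::comm_monoid_add"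
  assumes "w \<in> W" "a \<in> simple_affine" "apos (act w a)"
    and "\<And>w b. w \<in> W \<Longrightarrow> b \<in> affine_roots \<Longrightarrow> f (act w b) = f b"
  shows "sum f (inversions (w \<otimes>\<^bsub>WG\<^esub> arefl a)) = sum f (inversions w) + f a"
  using sum_inversions_reflection[OF assms(1) simple_affine_root simple_affine_apos assms(3), of f]
    assms(1,2,4)
  by (simp add: excess_simple arefl_closed simple_affine_root)

lemma len_up:
  assumes "w \<in> W" "a \<in> simple_affine" "apos (act w a)"
  shows "len D (w \<otimes>\<^bsub>WG\<^esub> arefl a) = Suc (len D w)"
  using sum_inversions_up[OF assms, of "\<lambda>_. 1 :: nat"] assms
  by (simp add: arefl_closed simple_affine_root flip: card_inversions)

lemma descent_swap:
  assumes "w \<in> W" "a \<in> simple_affine" "\<not> apos (act w a)"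
  shows "apos (act (w \<otimes>\<^bsub>WG\<^esub> arefl a) a)"
  using assms simple_affine_root[OF assms(2)]
  by (simp add: act_mult arefl_closed act_arefl_self act_opp act_closed apos_opp)

lemma sum_inversions_down:
  fixes f :: "'x \<times> int \<Rightarrow> 'b::comm_monoid_add"
  assumes "w \<in> W" "a \<in> simple_affine" "\<not> apos (act w a)"
    and "\<And>w b. w \<in> W \<Longrightarrow> b \<in> affine_roots \<Longrightarrow> f (act w b) = f b"
  shows "sum f (inversions w) = sum f (inversions (w \<otimes>\<^bsub>WG\<^esub> arefl a)) + f a"
  using sum_inversions_up[OF _ assms(2) descent_swap[OF assms(1-3)] assms(4)] assms(1,2)
  by (simp add: arefl_closed simple_affine_root arefl_mult_cancel)

lemma len_down:
  assumes "w \<in> W" "a \<in> simple_affine" "\<not> apos (act w a)"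
  shows "len D w = Suc (len D (w \<otimes>\<^bsub>WG\<^esub> arefl a))"
  using len_up[OF _ assms(2) descent_swap[OF assms]] assms(1,2)
  by (simp add: arefl_closed simple_affine_root arefl_mult_cancel)

subsection \<open>Words\<close>

lemma S_closed: "s \<in> S \<Longrightarrow> s \<in> W"
  using arefl_closed simple_affine_root by (auto simp: S_eq)

lemma list_prod_Nil: "list_prod WG [] = \<one>\<^bsub>WG\<^esub>"
  and list_prod_Cons: "list_prod WG (s # ss) = s \<otimes>\<^bsub>WG\<^esub> list_prod WG ss"
  by (simp_all add: list_prod_def)

lemma list_prod_closed: "set ss \<subseteq> S \<Longrightarrow> list_prod WG ss \<in> W"
  by (induction ss) (auto simp: list_prod_Nil list_prod_Cons S_closed)

lemma list_prod_append:
  "set ss \<subseteq> S \<Longrightarrow> set ts \<subseteq> S \<Longrightarrow> list_prod WG (ss @ ts) = list_prod WG ss \<otimes>\<^bsub>WG\<^esub> list_prod WG ts"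
  by (induction ss) (auto simp: list_prod_Nil list_prod_Cons S_closed list_prod_closed WG.m_assoc)

lemma list_prod_snoc:
  "set ss \<subseteq> S \<Longrightarrow> s \<in> S \<Longrightarrow> list_prod WG (ss @ [s]) = list_prod WG ss \<otimes>\<^bsub>WG\<^esub> s"
  by (simp add: list_prod_append list_prod_Nil list_prod_Cons S_closed)

text \<open>The exchange condition. As \<open>a\<close> is moved leftwards along the word, the letter at which it turns negative is the reflection in the moved root, because the only inversion of a simple reflection is its own root. Deleting this letter has the same effect as multiplying by the reflection in \<open>a\<close>.\<close>

lemma exchange:
  assumes "set ss \<subseteq> S" "a \<in> simple_affine" "\<not> apos (act (list_prod WG ss) a)"
  shows "\<exists>ts. set ts \<subseteq> S \<and> length ts < length ss \<and> list_prod WG ss \<otimes>\<^bsub>WG\<^esub> arefl a = list_prod WG ts"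
  using assms
proof (induction ss)
  case Nil then show ?case by (simp add: list_prod_Nil act_one simple_affine_apos)
next
  case (Cons r ss)
  note a = simple_affine_root[OF Cons.prems(2)]
  have ss: "set ss \<subseteq> S" and r: "r \<in> S" using Cons.prems by auto
  let ?P = "list_prod WG ss"
  note P = list_prod_closed[OF ss]
  show ?case
  proof (cases "apos (act ?P a)")
    case False
    then obtain ts where "set ts \<subseteq> S" "length ts < length ss" "?P \<otimes>\<^bsub>WG\<^esub> arefl a = list_prod WG ts"
      using Cons.IH ss Cons.prems(2) by blast
    then show ?thesis using r P a
      by (intro exI[of _ "r # ts"]) (auto simp: list_prod_Cons WG.m_assoc S_closed arefl_closed)
  next
    case True
    obtain c where c: "c \<in> simple_affine" "r = arefl c" using r by (auto simp: S_eq)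
    have "act ?P a \<in> inversions (arefl c)"
      using True Cons.prems c a P S_closed[OF r]
      by (simp add: inversions_def act_closed list_prod_Cons act_mult)
    then have ca: "c = act ?P a" using inversions_simple[OF c(1)] by simp
    have "r = ?P \<otimes>\<^bsub>WG\<^esub> arefl a \<otimes>\<^bsub>WG\<^esub> inv\<^bsub>WG\<^esub> ?P" using c(2) ca arefl_act[OF P a] by simp
    then have "list_prod WG (r # ss) \<otimes>\<^bsub>WG\<^esub> arefl a = ?P"
      using P a by (simp add: list_prod_Cons WG.m_assoc arefl_closed arefl_square)
    then show ?thesis using ss by (intro exI[of _ ss]) auto
  qed
qed

lemma exists_reduced_subword:
  assumes "set ss \<subseteq> S"
  shows "\<exists>ts. set ts \<subseteq> S \<and> length ts \<le> length ss \<and> list_prod WG ts = list_prod WG ss \<and>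
    length ts = len D (list_prod WG ts)"
  using assms
proof (induction "length ss" arbitrary: ss rule: less_induct)
  case less
  show ?case
  proof (cases ss rule: rev_cases)
    case Nil
    have "inversions \<one>\<^bsub>WG\<^esub> = {}" by (auto simp: inversions_def act_one)
    then have "len D \<one>\<^bsub>WG\<^esub> = 0" using card_inversions[OF WG.one_closed] by simp
    then show ?thesis using Nil by (intro exI[of _ "[]"]) (simp add: list_prod_Nil)
  next
    case (snoc us s)
    then have us: "set us \<subseteq> S" and s: "s \<in> S" using less.prems by auto
    obtain ts where ts: "set ts \<subseteq> S" "length ts \<le> length us" "list_prod WG ts = list_prod WG us"
      "length ts = len D (list_prod WG ts)" using less.hyps[OF _ us] snoc by auto
    obtain a where a: "a \<in> simple_affine" "s = arefl a" using s by (auto simp: S_eq)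
    have prod: "list_prod WG ss = list_prod WG ts \<otimes>\<^bsub>WG\<^esub> arefl a"
      using snoc us s a ts by (simp add: list_prod_snoc)
    show ?thesis
    proof (cases "apos (act (list_prod WG ts) a)")
      case True
      then have "len D (list_prod WG ss) = Suc (length ts)"
        using len_up[OF list_prod_closed[OF ts(1)] a(1)] prod ts(4) by simp
      moreover have "list_prod WG (ts @ [s]) = list_prod WG ss"
        using list_prod_snoc[OF ts(1) s] prod a(2) by simp
      ultimately show ?thesis using ts(1,2) s snoc by (intro exI[of _ "ts @ [s]"]) simp
    next
      case False
      obtain rs where rs: "set rs \<subseteq> S" "length rs < length ts" "list_prod WG ss = list_prod WG rs"
        using exchange[OF ts(1) a(1) False] prod by auto
      then show ?thesis using less.hyps[OF _ rs(1)] ts snoc by auto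
    qed
  qed
qed

lemma len_list_prod_le:
  assumes "set ss \<subseteq> S" shows "len D (list_prod WG ss) \<le> length ss"
  using exists_reduced_subword[OF assms] by auto

lemma reduced_word_iff:
  assumes "set ss \<subseteq> S"
  shows "reduced_word WG S ss \<longleftrightarrow> length ss = len D (list_prod WG ss)"
proof
  assume "reduced_word WG S ss"
  then show "length ss = len D (list_prod WG ss)"
    using exists_reduced_subword[OF assms] by (auto simp: reduced_word_def)
next
  assume "length ss = len D (list_prod WG ss)"
  then show "reduced_word WG S ss"
    using len_list_prod_le assms by (metis reduced_word_def)
qed

lemma Omega_word:
  assumes "w \<in> W"
  shows "\<exists>u ss. u \<in> Omega D \<and> set ss \<subseteq> S \<and> length ss = len D w \<and> w = u \<otimes>\<^bsub>WG\<^esub> list_prod WG ss"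
  using assms
proof (induction "len D w" arbitrary: w)
  case 0
  then show ?case
    by (intro exI[of _ w] exI[of _ "[]"]) (simp add: Omega_def list_prod_Nil)
next
  case (Suc n)
  obtain a where a: "a \<in> simple_affine" "\<not> apos (act w a)"
    using exists_descent[OF Suc.prems] Suc.hyps(2) by auto
  note aR = simple_affine_root[OF a(1)]
  have s: "arefl a \<in> S" using a by (simp add: S_eq)
  let ?w = "w \<otimes>\<^bsub>WG\<^esub> arefl a"
  have "n = len D ?w" using len_down[OF Suc.prems a] Suc.hyps(2) by simp
  then obtain u ss where u: "u \<in> Omega D" "set ss \<subseteq> S" "length ss = len D ?w" "?w = u \<otimes>\<^bsub>WG\<^esub> list_prod WG ss"
    using Suc.hyps(1)[of ?w] Suc.prems arefl_closed[OF aR] by auto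
  have "w = ?w \<otimes>\<^bsub>WG\<^esub> arefl a" by (simp add: arefl_mult_cancel Suc.prems aR)
  also have "\<dots> = u \<otimes>\<^bsub>WG\<^esub> list_prod WG (ss @ [arefl a])"
    using u s by (simp add: list_prod_snoc WG.m_assoc S_closed list_prod_closed Omega_def)
  finally show ?case using u s len_down[OF Suc.prems a]
    by (intro exI[of _ u] exI[of _ "ss @ [arefl a]"]) auto
qed

lemma inversions_empty: "w \<in> W \<Longrightarrow> len D w = 0 \<Longrightarrow> inversions w = {}"
  using inversions_card[of w] card_0_eq[of "inversions w"] by simp

lemma Omega_apos:
  assumes "u \<in> Omega D" "b \<in> affine_roots" shows "apos (act u b) \<longleftrightarrow> apos b"
proof -
  have u: "u \<in> W" "len D u = 0" using assms by (auto simp: Omega_def)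
  then have "inversions u = {}" by (rule inversions_empty)
  then have *: "apos (act u c)" if "c \<in> affine_roots" "apos c" for c
    using that unfolding inversions_def by blast
  show ?thesis using *[OF assms(2)] *[OF opp_closed[OF assms(2)]]
    by (auto simp: apos_opp act_opp act_closed u(1) assms(2))
qed

lemma inversions_Omega_mult:
  assumes "u \<in> Omega D" "w \<in> W" shows "inversions (u \<otimes>\<^bsub>WG\<^esub> w) = inversions w"
proof -
  have "u \<in> W" using assms by (simp add: Omega_def)
  then show ?thesis using assms by (auto simp: inversions_def act_mult Omega_apos act_closed)
qed

lemma Omega_inv:
  assumes "u \<in> Omega D" shows "inv\<^bsub>WG\<^esub> u \<in> Omega D"
proof -
  have u: "u \<in> W" using assms by (simp add: Omega_def)
  have "apos (act (inv\<^bsub>WG\<^esub> u) b)" if "b \<in> affine_roots" "apos b" for b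
    using that Omega_apos[OF assms act_closed[OF WG.inv_closed[OF u]], of b] u by (simp add: act_inv)
  then have "inversions (inv\<^bsub>WG\<^esub> u) = {}" by (auto simp: inversions_def)
  then show ?thesis using u card_inversions[of "inv\<^bsub>WG\<^esub> u"] by (simp add: Omega_def)
qed

lemma inversions_mult_subset:
  assumes "w \<in> W" "w' \<in> W"
  shows "inversions (w \<otimes>\<^bsub>WG\<^esub> w') \<subseteq> inversions w' \<union> act (inv\<^bsub>WG\<^esub> w') ` inversions w"
proof
  fix b assume b: "b \<in> inversions (w \<otimes>\<^bsub>WG\<^esub> w')"
  note bb = inversionsD[OF b]
  show "b \<in> inversions w' \<union> act (inv\<^bsub>WG\<^esub> w') ` inversions w"
  proof (cases "apos (act w' b)")
    case True
    then have "act w' b \<in> inversions w"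
      using bb assms by (simp add: inversions_def act_mult act_closed)
    then show ?thesis using act_inv(1)[OF assms(2) bb(1)] by (metis UnI2 imageI)
  qed (use bb in \<open>auto simp: inversions_def\<close>)
qed

lemma inj_on_act: "w \<in> W \<Longrightarrow> A \<subseteq> affine_roots \<Longrightarrow> inj_on (act w) A"
  by (intro inj_on_inverseI[where g = "act (inv\<^bsub>WG\<^esub> w)"]) (auto simp: act_inv)

lemma len_mult_le:
  assumes "w \<in> W" "w' \<in> W" shows "len D (w \<otimes>\<^bsub>WG\<^esub> w') \<le> len D w + len D w'"
proof -
  have "card (inversions (w \<otimes>\<^bsub>WG\<^esub> w')) \<le> card (inversions w' \<union> act (inv\<^bsub>WG\<^esub> w') ` inversions w)"
    by (rule card_mono[OF _ inversions_mult_subset[OF assms]]) (simp add: finite_inversions assms)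
  also have "\<dots> \<le> card (inversions w') + card (act (inv\<^bsub>WG\<^esub> w') ` inversions w)"
    by (rule card_Un_le)
  also have "\<dots> \<le> card (inversions w') + card (inversions w)"
    by (simp add: card_image_le finite_inversions assms)
  finally show ?thesis using assms by (simp add: card_inversions)
qed

text \<open>Inversions of a product come from either factor. If the cardinalities add, nothing is lost, so weights add as well.\<close>

lemma sum_inversions_mult:
  fixes f :: "'x \<times> int \<Rightarrow> 'b::comm_monoid_add"
  assumes w: "w \<in> W" "w' \<in> W" and len: "len D (w \<otimes>\<^bsub>WG\<^esub> w') = len D w + len D w'"
    and f: "\<And>w b. w \<in> W \<Longrightarrow> b \<in> affine_roots \<Longrightarrow> f (act w b) = f b"
  shows "sum f (inversions (w \<otimes>\<^bsub>WG\<^esub> w')) = sum f (inversions w) + sum f (inversions w')"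
proof -
  let ?I = "inversions w'" let ?J = "act (inv\<^bsub>WG\<^esub> w') ` inversions w"
  have fin: "finite ?I" "finite ?J" using w by (auto simp: finite_inversions)
  have inj: "inj_on (act (inv\<^bsub>WG\<^esub> w')) (inversions w)"
    using w by (intro inj_on_act) (auto simp: inversions_def)
  have cJ: "card ?J = card (inversions w)" by (rule card_image[OF inj])
  have le: "card (inversions (w \<otimes>\<^bsub>WG\<^esub> w')) \<le> card (?I \<union> ?J)"
    by (rule card_mono[OF _ inversions_mult_subset[OF w]]) (use fin in simp)
  have c: "card (inversions (w \<otimes>\<^bsub>WG\<^esub> w')) = card ?I + card ?J"
    using len w cJ by (simp add: card_inversions)
  have "card (?I \<inter> ?J) = 0" using card_Un_Int[OF fin] le c by simp
  then have disj: "?I \<inter> ?J = {}" using fin by simp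
  have "inversions (w \<otimes>\<^bsub>WG\<^esub> w') = ?I \<union> ?J"
    using inversions_mult_subset[OF w] c card_Un_disjoint[OF fin disj] fin
    by (intro card_subset_eq) auto
  then have "sum f (inversions (w \<otimes>\<^bsub>WG\<^esub> w')) = sum f ?I + sum f ?J"
    using sum.union_disjoint[OF fin disj] by simp
  also have "sum f ?J = sum f (inversions w)"
    using w by (subst sum.reindex[OF inj], intro sum.cong refl) (auto simp: f inversions_def)
  finally show ?thesis by (simp add: add.commute)
qed

subsection \<open>Finiteness of the finite Weyl group\<close>

text \<open>The Coxeter group inside \<open>W\<close>. It contains all affine reflections and meets the elements of length 0 trivially; this is how the finite group is shown to act faithfully on the roots, although these need not span \<open>X\<close>.\<close>

definition word_products :: "'x weyl set" where "word_products = {list_prod WG ss | ss. set ss \<subseteq> S}"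

lemma word_products_mult: "w \<in> word_products \<Longrightarrow> w' \<in> word_products \<Longrightarrow> w \<otimes>\<^bsub>WG\<^esub> w' \<in> word_products"
  unfolding word_products_def by clarify (metis list_prod_append set_append Un_subset_iff)

lemma word_products_S: "s \<in> S \<Longrightarrow> s \<in> word_products"
  unfolding word_products_def by (rule CollectI, rule exI[of _ "[s]"]) (simp add: list_prod_Cons list_prod_Nil S_closed)

lemma word_products_one: "\<one>\<^bsub>WG\<^esub> \<in> word_products"
  unfolding word_products_def by (rule CollectI, rule exI[of _ "[]"]) (simp add: list_prod_Nil)

lemma word_products_closed: "w \<in> word_products \<Longrightarrow> w \<in> W"
  by (auto simp: word_products_def list_prod_closed)

lemma word_products_inv:
  assumes "w \<in> word_products" shows "inv\<^bsub>WG\<^esub> w \<in> word_products"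
proof -
  obtain ss where ss: "set ss \<subseteq> S" "w = list_prod WG ss" using assms by (auto simp: word_products_def)
  have "inv\<^bsub>WG\<^esub> (list_prod WG ss) \<in> word_products" using ss(1)
  proof (induction ss)
    case Nil then show ?case by (simp add: list_prod_Nil word_products_one)
  next
    case (Cons s ss)
    then have s: "s \<in> S" "set ss \<subseteq> S" by auto
    then obtain a where a: "a \<in> affine_roots" "s = arefl a" using simple_affine_root unfolding S_eq by blast
    have "inv\<^bsub>WG\<^esub> s = s" by (metis a WG.inv_equality arefl_closed arefl_square)
    then show ?case using Cons s
      by (simp add: list_prod_Cons WG.inv_mult_group S_closed list_prod_closed word_products_mult word_products_S)
  qed
  then show ?thesis using ss by simp
qed

text \<open>Induction on the length; after removing a descent \<open>a\<close>, an inversion other than \<open>a\<close> is still an inversion, up to the reflection in \<open>a\<close>.\<close>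

lemma inversion_conjugate_simple:
  assumes "w \<in> W" "b \<in> inversions w"
  shows "\<exists>g\<in>word_products. \<exists>c\<in>simple_affine. b = act g c"
  using assms
proof (induction "len D w" arbitrary: w b)
  case 0
  then show ?case using inversions_empty[of w] by simp
next
  case (Suc n)
  obtain a where a: "a \<in> simple_affine" "\<not> apos (act w a)"
    using exists_descent[OF Suc.prems(1)] Suc.hyps(2) by auto
  note aR = simple_affine_root[OF a(1)]
  note b = inversionsD[OF Suc.prems(2)]
  let ?w = "w \<otimes>\<^bsub>WG\<^esub> arefl a"
  show ?case
  proof (cases "b = a")
    case True then show ?thesis using a word_products_one by (metis act_one)
  next
    case False
    let ?b = "act (arefl a) b"
    have "apos ?b" using False b inversions_simple[OF a(1)] by (auto simp: inversions_def)
    then have "?b \<in> inversions ?w"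
      using b aR Suc.prems(1) by (simp add: inversions_def act_closed arefl_closed act_mult act_arefl_twice)
    moreover have "n = len D ?w" using len_down[OF Suc.prems(1) a] Suc.hyps(2) by simp
    ultimately obtain g c where g: "g \<in> word_products" "c \<in> simple_affine" "?b = act g c"
      using Suc.hyps(1)[of ?w ?b] Suc.prems(1) arefl_closed[OF aR] by auto
    have "b = act (arefl a) (act g c)" using act_arefl_twice[OF aR b(1)] g(3) by simp
    also have "\<dots> = act (arefl a \<otimes>\<^bsub>WG\<^esub> g) c"
      using g aR by (simp add: act_mult arefl_closed word_products_closed simple_affine_root)
    finally show ?thesis using g a word_products_mult[OF word_products_S] by (metis S_eq imageI)
  qed
qed

lemma arefl_word:
  assumes "a \<in> affine_roots" shows "arefl a \<in> word_products"
proof -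
  have *: "arefl b \<in> word_products" if b: "b \<in> affine_roots" "apos b" for b
  proof -
    have "b \<in> inversions (arefl b)"
      using b by (simp add: inversions_def act_arefl_self apos_opp)
    then obtain g c where g: "g \<in> word_products" "c \<in> simple_affine" "b = act g c"
      using inversion_conjugate_simple[OF arefl_closed[OF b(1)]] by blast
    have "arefl b = g \<otimes>\<^bsub>WG\<^esub> arefl c \<otimes>\<^bsub>WG\<^esub> inv\<^bsub>WG\<^esub> g"
      using g by (simp add: arefl_act word_products_closed simple_affine_root)
    then show ?thesis using g by (simp add: word_products_mult word_products_inv word_products_S S_eq)
  qed
  show ?thesis using *[OF assms] *[OF opp_closed[OF assms]] assms by (auto simp: apos_opp arefl_opp)
qed

lemma W0_word:
  assumes "v \<in> W0" shows "(v, 0) \<in> word_products"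
  using assms
proof (induction rule: W0_induct)
  case id then show ?case using word_products_one unfolding W_one .
next
  case (reflection \<alpha> v)
  have "arefl (\<alpha>, 0) \<in> word_products" using reflection by (intro arefl_word) (simp add: affine_roots_def)
  then have "arefl (\<alpha>, 0) \<otimes>\<^bsub>WG\<^esub> (v, 0) \<in> word_products" using reflection by (intro word_products_mult)
  moreover have "arefl (\<alpha>, 0) \<otimes>\<^bsub>WG\<^esub> (v, 0) = (reflection D \<alpha> \<circ> v, 0)"
    by (simp add: arefl_def W_mult zscale_0 additive.zero[OF W0_additive[OF W0_inv[OF reflection(2)]]])
  ultimately show ?case by metis
qed

text \<open>An element fixing all roots has no inversions, hence length 0; being a product of simple reflections it is then the empty product.\<close>

lemma W0_faithful:
  assumes "v \<in> W0" "\<And>\<alpha>. \<alpha> \<in> R \<Longrightarrow> v \<alpha> = \<alpha>" shows "v = id"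
proof -
  have w: "(v, 0) \<in> W" using assms by (simp add: W_carrier)
  have "inversions (v, 0) = {}"
    using assms(2) by (auto simp: inversions_def affine_roots_def act_def pr_simps)
  then have l: "len D (v, 0) = 0" using card_inversions[OF w] by simp
  obtain ss where "set ss \<subseteq> S" "(v, 0) = list_prod WG ss" using W0_word[OF assms(1)] by (auto simp: word_products_def)
  then obtain ts where "(v, 0) = list_prod WG ts" "length ts = len D (v, 0)"
    using exists_reduced_subword[of ss] by metis
  then have "(v, 0) = \<one>\<^bsub>WG\<^esub>" using l by (simp add: list_prod_Nil)
  then show ?thesis by (simp add: W_one)
qed

lemma finite_W0: "finite W0"
proof (rule inj_on_finite)
  show "inj_on (\<lambda>v. restrict v R) W0"
  proof (rule inj_onI)
    fix v v' assume v: "v \<in> W0" "v' \<in> W0" and eq: "restrict v R = restrict v' R"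
    have "v \<alpha> = v' \<alpha>" if "\<alpha> \<in> R" for \<alpha> using eq that by (metis restrict_apply')
    then have "inv_into UNIV v \<circ> v' = id"
      using v W0_inv_apply(1)[OF v(1)] by (intro W0_faithful W0_comp W0_inv) (simp_all, metis)
    then show "v = v'"
      using W0_inv_apply(2)[OF v(1)] by (metis comp_apply ext id_apply)
  qed
  show "(\<lambda>v. restrict v R) ` W0 \<subseteq> R \<rightarrow>\<^sub>E R" using W0_root by auto
qed (simp add: finite_PiE finite_roots)

end

section \<open>Weights as sums over inversions\<close>

context generic_weights
begin

text \<open>The label of an affine root is that of any simple affine root in its orbit. The choice does not matter, because a simple affine root is carried to another one only if the reflections are conjugate.\<close>

definition root_label :: "'x \<times> int \<Rightarrow> 'c" where
  "root_label a = lab (arefl (SOME c. c \<in> simple_affine \<and> (\<exists>w\<in>W. act w c = a)))"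

lemma root_label_act:
  assumes "w \<in> W" "a \<in> affine_roots" shows "root_label (act w a) = root_label a"
proof -
  have "(\<exists>g\<in>W. act g c = act w a) \<longleftrightarrow> (\<exists>g\<in>W. act g c = a)" if c: "c \<in> simple_affine" for c
  proof
    assume "\<exists>g\<in>W. act g c = act w a"
    then obtain g where g: "g \<in> W" "act g c = act w a" by blast
    then have "act (inv\<^bsub>WG\<^esub> w \<otimes>\<^bsub>WG\<^esub> g) c = a"
      using assms c by (simp add: act_mult simple_affine_root act_inv)
    then show "\<exists>g\<in>W. act g c = a"
      by (rule bexI) (use g(1) assms(1) in simp)
  next
    assume "\<exists>g\<in>W. act g c = a"
    then obtain g where g: "g \<in> W" "act g c = a" by blast
    then have "act (w \<otimes>\<^bsub>WG\<^esub> g) c = act w a"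
      using assms c by (simp add: act_mult simple_affine_root)
    then show "\<exists>g\<in>W. act g c = act w a"
      by (rule bexI) (use g(1) assms(1) in simp)
  qed
  then have "(\<lambda>c. c \<in> simple_affine \<and> (\<exists>g\<in>W. act g c = act w a)) =
      (\<lambda>c. c \<in> simple_affine \<and> (\<exists>g\<in>W. act g c = a))"
    by (intro ext conj_cong refl)
  then show ?thesis by (simp add: root_label_def)
qed

lemma root_label_simple:
  assumes "c \<in> simple_affine" shows "root_label c = lab (arefl c)"
proof -
  let ?P = "\<lambda>d. d \<in> simple_affine \<and> (\<exists>w\<in>W. act w d = c)"
  have "?P c" using assms by (intro conjI bexI[of _ "\<one>\<^bsub>WG\<^esub>"]) (simp_all add: act_one)
  then have "?P (SOME d. ?P d)" by (rule someI)
  then obtain w where d: "(SOME d. ?P d) \<in> simple_affine" and w: "w \<in> W" "act w (SOME d. ?P d) = c" by blast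
  have "arefl c = w \<otimes>\<^bsub>WG\<^esub> arefl (SOME d. ?P d) \<otimes>\<^bsub>WG\<^esub> inv\<^bsub>WG\<^esub> w"
    using arefl_act[OF w(1) simple_affine_root[OF d]] w(2) by simp
  then have "conjugate WG (arefl (SOME d. ?P d)) (arefl c)"
    using w(1) unfolding conjugate_def by blast
  then have "lab (arefl (SOME d. ?P d)) = lab (arefl c)"
    using lab_eq_iff d assms by (simp add: S_eq)
  then show ?thesis by (simp add: root_label_def)
qed

definition root_weight :: "'x \<times> int \<Rightarrow> 'c \<Rightarrow>\<^sub>0 nat" where
  "root_weight a = Poly_Mapping.single (root_label a) 1"

definition weight :: "'x weyl \<Rightarrow> 'c \<Rightarrow>\<^sub>0 nat" where
  "weight w = sum root_weight (inversions w)"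

lemma root_weight_act: "w \<in> W \<Longrightarrow> a \<in> affine_roots \<Longrightarrow> root_weight (act w a) = root_weight a"
  by (simp add: root_weight_def root_label_act)

lemma weight_up:
  "w \<in> W \<Longrightarrow> a \<in> simple_affine \<Longrightarrow> apos (act w a) \<Longrightarrow>
   weight (w \<otimes>\<^bsub>WG\<^esub> arefl a) = weight w + root_weight a"
  unfolding weight_def by (rule sum_inversions_up[OF _ _ _ root_weight_act])

lemma weight_down:
  "w \<in> W \<Longrightarrow> a \<in> simple_affine \<Longrightarrow> \<not> apos (act w a) \<Longrightarrow>
   weight w = weight (w \<otimes>\<^bsub>WG\<^esub> arefl a) + root_weight a"
  unfolding weight_def by (rule sum_inversions_down[OF _ _ _ root_weight_act])

lemma weight_mult:
  "w \<in> W \<Longrightarrow> w' \<in> W \<Longrightarrow> len D (w \<otimes>\<^bsub>WG\<^esub> w') = len D w + len D w' \<Longrightarrow>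
   weight (w \<otimes>\<^bsub>WG\<^esub> w') = weight w + weight w'"
  unfolding weight_def by (rule sum_inversions_mult[OF _ _ _ root_weight_act])

text \<open>The parity statement on which integrality depends.\<close>

lemma weight_reflection:
  assumes "w \<in> W" "a \<in> affine_roots" "apos a" "apos (act w a)"
  shows "\<exists>m. weight (w \<otimes>\<^bsub>WG\<^esub> arefl a) = weight w + root_weight a + (m + m)"
    and "len D w < len D (w \<otimes>\<^bsub>WG\<^esub> arefl a)"
proof -
  have "weight (w \<otimes>\<^bsub>WG\<^esub> arefl a) = weight w + root_weight a + sum root_weight (excess w a)"
    unfolding weight_def
    by (rule sum_inversions_reflection[OF assms]) (simp add: root_weight_act arefl_closed assms)
  then show "\<exists>m. weight (w \<otimes>\<^bsub>WG\<^esub> arefl a) = weight w + root_weight a + (m + m)"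
    using sum_excess_double[OF assms(1-3), of root_weight] root_weight_act by metis
  show "len D w < len D (w \<otimes>\<^bsub>WG\<^esub> arefl a)"
    using sum_inversions_reflection[OF assms, of "\<lambda>_. 1 :: nat"] assms
    by (simp add: arefl_closed flip: card_inversions)
qed

lemma weight_len_0: "w \<in> W \<Longrightarrow> len D w = 0 \<Longrightarrow> weight w = 0"
  by (simp add: weight_def inversions_empty)

lemma weight_word:
  assumes "set ss \<subseteq> S" "length ss = len D (list_prod WG ss)"
  shows "weight (list_prod WG ss) = (\<Sum>s\<leftarrow>ss. Poly_Mapping.single (lab s) 1)"
  using assms
proof (induction ss rule: rev_induct)
  case Nil
  then show ?case using weight_len_0[OF WG.one_closed] by (simp add: list_prod_Nil)
next
  case (snoc s ss)
  then have ss: "set ss \<subseteq> S" and s: "s \<in> S" by auto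
  obtain a where a: "a \<in> simple_affine" "s = arefl a" using s by (auto simp: S_eq)
  let ?P = "list_prod WG ss"
  note P = list_prod_closed[OF ss]
  have prod: "list_prod WG (ss @ [s]) = ?P \<otimes>\<^bsub>WG\<^esub> arefl a"
    using list_prod_snoc[OF ss s] a(2) by simp
  have le: "len D ?P \<le> length ss" by (rule len_list_prod_le[OF ss])
  have "apos (act ?P a)"
  proof (rule ccontr)
    assume "\<not> apos (act ?P a)"
    from len_down[OF P a(1) this] show False using le snoc.prems(2) prod by simp
  qed
  note up = len_up[OF P a(1) this] weight_up[OF P a(1) this]
  have "length ss = len D ?P" using up(1) snoc.prems(2) prod by simp
  then show ?case using snoc.IH[OF ss] up(2) prod a
    by (simp add: root_weight_def root_label_simple)
qed

text \<open>A word is reduced exactly if its length is the number of inversions of its product, and then its letters carry the labels of these inversions. So the exponent does not depend on the chosen reduced expression.\<close>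

lemma weight_exponent_eq:
  assumes "w \<in> W" shows "weight_exponent D lab w = weight w"
  unfolding weight_exponent_def
proof (rule the_equality)
  obtain u ss where u: "u \<in> Omega D" "set ss \<subseteq> S" "length ss = len D w" "w = u \<otimes>\<^bsub>WG\<^esub> list_prod WG ss"
    using Omega_word[OF assms] by blast
  note inv = inversions_Omega_mult[OF u(1) list_prod_closed[OF u(2)], folded u(4)]
  have l: "length ss = len D (list_prod WG ss)"
    using u(3) inv assms list_prod_closed[OF u(2)] by (simp flip: card_inversions)
  have "weight w = weight (list_prod WG ss)" using inv by (simp add: weight_def)
  then have "weight w = (\<Sum>s\<leftarrow>ss. Poly_Mapping.single (lab s) 1)"
    using weight_word[OF u(2) l] by simp
  then show "\<exists>u ss. u \<in> Omega D \<and> reduced_word WG S ss \<and> w = u \<otimes>\<^bsub>WG\<^esub> list_prod WG ss \<and>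
      weight w = (\<Sum>s\<leftarrow>ss. Poly_Mapping.single (lab s) 1)"
    using u reduced_word_iff[OF u(2)] l by blast
next
  fix m :: "'c \<Rightarrow>\<^sub>0 nat"
  assume "\<exists>u ss. u \<in> Omega D \<and> reduced_word WG S ss \<and> w = u \<otimes>\<^bsub>WG\<^esub> list_prod WG ss \<and>
      m = (\<Sum>s\<leftarrow>ss. Poly_Mapping.single (lab s) 1)"
  then obtain u ss where u: "u \<in> Omega D" "reduced_word WG S ss" "w = u \<otimes>\<^bsub>WG\<^esub> list_prod WG ss"
      "m = (\<Sum>s\<leftarrow>ss. Poly_Mapping.single (lab s) 1)" by blast
  have ss: "set ss \<subseteq> S" using u(2) by (simp add: reduced_word_def)
  have "weight w = weight (list_prod WG ss)"
    using inversions_Omega_mult[OF u(1) list_prod_closed[OF ss]] u(3) by (simp add: weight_def)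
  also have "\<dots> = m" using weight_word[OF ss] reduced_word_iff[OF ss] u by simp
  finally show "m = weight w" by simp
qed

end

section \<open>Monomials\<close>

abbreviation vmono :: "('c \<Rightarrow>\<^sub>0 int) \<Rightarrow> 'c vlaurent" where
  "vmono e \<equiv> Poly_Mapping.single e 1"

lemma vmono_add: "vmono (a + b) = vmono a * vmono b"
  by (simp add: mult_single)

lemma int_exponent_0: "int_exponent 0 = 0"
  using int_exponent_add[of 0 "0 :: 'a \<Rightarrow>\<^sub>0 nat"] by simp

lemma qpoly_incl_uminus: "qpoly_incl (- p) = - qpoly_incl p"
  using qpoly_incl_add[of p "- p"] by (simp add: qpoly_incl_0 eq_neg_iff_add_eq_0 add.commute)

lemma qpoly_incl_diff: "qpoly_incl (p - q) = qpoly_incl p - qpoly_incl q"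
  using qpoly_incl_add[of p "- q"] by (simp add: qpoly_incl_uminus)

text \<open>In particular the inclusion is injective, which turns independence over the Laurent ring into independence over the polynomial ring.\<close>

lemma lookup_qpoly_incl:
  "Poly_Mapping.lookup (qpoly_incl p) (int_exponent m + int_exponent m) = Poly_Mapping.lookup p m"
proof -
  have inj: "int_exponent n + int_exponent n = int_exponent m + int_exponent m \<longleftrightarrow> n = m" for n m :: "'a \<Rightarrow>\<^sub>0 nat"
  proof
    assume e: "int_exponent n + int_exponent n = int_exponent m + int_exponent m"
    show "n = m"
    proof (rule poly_mapping_eqI)
      fix k
      have "Poly_Mapping.lookup (int_exponent n + int_exponent n) k = Poly_Mapping.lookup (int_exponent m + int_exponent m) k"
        using e by simp
      then show "Poly_Mapping.lookup n k = Poly_Mapping.lookup m k"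
        by (simp add: lookup_add int_exponent_def Poly_Mapping.map.rep_eq when_def split: if_splits)
    qed
  qed simp
  show ?thesis
    by (simp add: qpoly_incl_def lookup_sum lookup_single inj when_def in_keys_iff)
qed

lemma qpoly_incl_eq_0: "qpoly_incl p = 0 \<Longrightarrow> p = 0"
  by (rule poly_mapping_eqI) (metis lookup_qpoly_incl lookup_zero)

section \<open>Dickson's lemma\<close>

text \<open>Induction on the number of coordinates: elements whose new coordinate exceeds its maximum on a finite set chosen for the old coordinates are dominated already, and for each of the finitely many smaller values of the new coordinate the old coordinates decide. A sum serves as an upper bound for the maximum, which avoids a case distinction.\<close>

lemma dickson:
  fixes \<phi> :: "'a \<Rightarrow> 'i \<Rightarrow> nat"
  assumes "finite I"
  shows "\<exists>F. finite F \<and> F \<subseteq> A \<and> (\<forall>x\<in>A. \<exists>y\<in>F. \<forall>i\<in>I. \<phi> y i \<le> \<phi> x i)"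
  using assms
proof (induction I arbitrary: A)
  case empty
  show ?case
  proof (cases "A = {}")
    case False
    then obtain a where "a \<in> A" by blast
    then show ?thesis by (intro exI[of _ "{a}"]) auto
  qed auto
next
  case (insert i I)
  obtain F where F: "finite F" "F \<subseteq> A" "\<forall>x\<in>A. \<exists>y\<in>F. \<forall>i\<in>I. \<phi> y i \<le> \<phi> x i"
    using insert.IH[of A] by blast
  define m where "m = (\<Sum>y\<in>F. \<phi> y i)"
  have m: "\<phi> y i \<le> m" if "y \<in> F" for y
    unfolding m_def using that F(1) by (intro member_le_sum) auto
  let ?A = "\<lambda>k. {x \<in> A. \<phi> x i = k}"
  have "\<forall>k. \<exists>F. finite F \<and> F \<subseteq> ?A k \<and> (\<forall>x\<in>?A k. \<exists>y\<in>F. \<forall>i\<in>I. \<phi> y i \<le> \<phi> x i)"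
    using insert.IH by blast
  from choice[OF this] obtain G where
    "\<forall>k. finite (G k) \<and> G k \<subseteq> ?A k \<and> (\<forall>x\<in>?A k. \<exists>y\<in>G k. \<forall>i\<in>I. \<phi> y i \<le> \<phi> x i)"
    by blast
  then have G: "finite (G k)" "G k \<subseteq> ?A k" "x \<in> ?A k \<Longrightarrow> \<exists>y\<in>G k. \<forall>i\<in>I. \<phi> y i \<le> \<phi> x i" for k x
    by blast+
  show ?case
  proof (intro exI[of _ "F \<union> (\<Union>k<m. G k)"] conjI ballI)
    show "finite (F \<union> (\<Union>k<m. G k))" using F G by simp
    show "F \<union> (\<Union>k<m. G k) \<subseteq> A" using F G by blast
    fix x assume x: "x \<in> A"
    show "\<exists>y\<in>F \<union> (\<Union>k<m. G k). \<forall>i\<in>insert i I. \<phi> y i \<le> \<phi> x i"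
    proof (cases "m \<le> \<phi> x i")
      case True
      obtain y where "y \<in> F" "\<forall>i\<in>I. \<phi> y i \<le> \<phi> x i" using F x by blast
      then show ?thesis using m[of y] True by (intro bexI[of _ y]) auto
    next
      case False
      obtain y where y: "y \<in> G (\<phi> x i)" "\<forall>i\<in>I. \<phi> y i \<le> \<phi> x i" using G(3)[of x] x by blast
      then have "\<phi> y i = \<phi> x i" using G(2) by blast
      then show ?thesis using y False by (intro bexI[of _ y]) auto
    qed
  qed
qed

section \<open>Inverses\<close>

lemma ring_inverse_eqI: "x * y = 1 \<Longrightarrow> y * x = 1 \<Longrightarrow> ring_inverse x = y"
  unfolding ring_inverse_def
  by (rule the_equality) (auto, metis mult.assoc mult_1_left mult_1_right)

lemma inverse_commute:
  fixes x :: "'a::ring_1"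
  assumes "x * y = 1" "y * x = 1" "x * a = a * x" shows "y * a = a * y"
proof -
  have "y * a = y * (a * (x * y))" using assms by simp
  also have "\<dots> = y * (x * a) * y" by (simp only: assms(3) mult.assoc)
  also have "\<dots> = a * y" using assms(2) by (simp flip: mult.assoc)
  finally show ?thesis .
qed

lemma mult_cancel_middle:
  fixes a :: "'a::ring_1" shows "b * c = 1 \<Longrightarrow> (a * b) * (c * d) = a * d"
  by (metis mult.assoc mult_1_left)

lemma mult_swap_middle:
  fixes a :: "'a::ring_1" shows "b * c = c * b \<Longrightarrow> (a * b) * (c * d) = (a * c) * (b * d)"
  by (metis mult.assoc)

section \<open>The extended Hecke algebra\<close>

context extended_hecke_algebra
begin

abbreviation \<tau> :: "'x weyl \<Rightarrow> 'k" where "\<tau> w \<equiv> \<iota> (T w)"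
abbreviation wt :: "'x weyl \<Rightarrow> 'c \<Rightarrow>\<^sub>0 int" where "wt w \<equiv> int_exponent (weight w)"
abbreviation rw :: "'x \<times> int \<Rightarrow> 'c \<Rightarrow>\<^sub>0 int" where "rw a \<equiv> int_exponent (root_weight a)"

text \<open>Restriction of scalars to the polynomial ring. With respect to it, \<open>H\<close> is the span of the \<open>\<tau> w\<close>.\<close>

sublocale Q: module "\<lambda>p. scaleK (qpoly_incl p)"
  by unfold_locales
    (simp_all add: K.scale_right_distrib K.scale_left_distrib qpoly_incl_add qpoly_incl_mult qpoly_incl_1)

lemma iota_zero: "\<iota> 0 = 0"
  using \<iota>_add[of 0 0] by simp

lemma iota_minus: "\<iota> (- a) = - \<iota> a"
  using \<iota>_add[of a "- a"] by (simp add: iota_zero eq_neg_iff_add_eq_0 add.commute)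

lemma iota_diff: "\<iota> (a - b) = \<iota> a - \<iota> b"
  using \<iota>_add[of a "- b"] by (simp add: iota_minus)

lemma T_span: "H.span (T ` W) = UNIV"
  using T_basis by (simp add: is_basis_def)

lemma len_one: "len D \<one>\<^bsub>WG\<^esub> = 0"
  using len_list_prod_le[of "[]"] by (simp add: list_prod_Nil)

text \<open>The unit of \<open>H\<close> is not specified to be the basis element of the identity. By the multiplication rule that element acts as the identity on the basis, hence on all of \<open>H\<close>.\<close>

lemma T_one: "T \<one>\<^bsub>WG\<^esub> = 1"
proof -
  have "T \<one>\<^bsub>WG\<^esub> * h = h" if "h \<in> H.span (T ` W)" for h
    using that
  proof (induction rule: H.span_induct_alt)
    case (step c x y)
    then obtain w where w: "w \<in> W" "x = T w" by blast
    have "T \<one>\<^bsub>WG\<^esub> * T w = T w" using T_mult[of "\<one>\<^bsub>WG\<^esub>" w] w by (simp add: len_one)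
    then show ?case using step w by (simp add: distrib_left flip: H.scale_mult_right)
  qed simp
  then show ?thesis using T_span by (metis UNIV_I mult_1_right)
qed

lemma tau_one: "\<tau> \<one>\<^bsub>WG\<^esub> = 1"
  by (simp add: T_one \<iota>_one)

lemma tau_mult:
  "w \<in> W \<Longrightarrow> w' \<in> W \<Longrightarrow> len D (w \<otimes>\<^bsub>WG\<^esub> w') = len D w + len D w' \<Longrightarrow>
   \<tau> (w \<otimes>\<^bsub>WG\<^esub> w') = \<tau> w * \<tau> w'"
  by (simp add: T_mult \<iota>_mult)

lemma len_arefl: "a \<in> simple_affine \<Longrightarrow> len D (arefl a) = 1"
  using inversions_simple[of a] card_inversions[OF arefl_closed[OF simple_affine_root], of a] by simp

lemma tau_up:
  "w \<in> W \<Longrightarrow> a \<in> simple_affine \<Longrightarrow> apos (act w a) \<Longrightarrow> \<tau> (w \<otimes>\<^bsub>WG\<^esub> arefl a) = \<tau> w * \<tau> (arefl a)"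
  by (rule tau_mult) (simp_all add: len_up len_arefl arefl_closed simple_affine_root)

lemma tau_down:
  assumes "w \<in> W" "a \<in> simple_affine" "\<not> apos (act w a)"
  shows "\<tau> w = \<tau> (w \<otimes>\<^bsub>WG\<^esub> arefl a) * \<tau> (arefl a)"
  using tau_up[OF _ assms(2) descent_swap[OF assms]] assms(1,2)
  by (simp add: arefl_mult_cancel arefl_closed simple_affine_root)

lemma qpoly_incl_gen:
  "a \<in> simple_affine \<Longrightarrow> qpoly_incl (q_gen lab (arefl a)) = vmono (rw a + rw a)"
  by (simp add: q_gen_def qpoly_incl_single root_weight_def root_label_simple)

lemma tau_quadratic:
  assumes "a \<in> simple_affine"
  shows "(\<tau> (arefl a) + 1) * (\<tau> (arefl a) - scaleK (vmono (rw a + rw a)) 1) = 0"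
proof -
  have "arefl a \<in> S" using assms by (simp add: S_eq)
  from T_quadratic[OF this]
  have "\<iota> ((T (arefl a) + 1) * (T (arefl a) - scaleH (q_gen lab (arefl a)) 1)) = 0"
    by (simp only: iota_zero)
  then show ?thesis
    by (simp add: \<iota>_mult \<iota>_add iota_diff \<iota>_one \<iota>_scale qpoly_incl_gen assms)
qed

definition sigma :: "'x weyl \<Rightarrow> 'k" where "sigma w = ring_inverse (\<tau> w)"

lemma scaleK_mult: "scaleK p x * scaleK q y = scaleK (p * q) (x * y)"
  by (metis K.scale_mult_left K.scale_mult_right K.scale_scale)

lemma simple_inverse:
  assumes "a \<in> simple_affine"
  defines "y \<equiv> scaleK (vmono (- (rw a + rw a))) (\<tau> (arefl a) + 1 - scaleK (vmono (rw a + rw a)) 1)"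
  shows "\<tau> (arefl a) * y = 1" "y * \<tau> (arefl a) = 1"
proof -
  let ?t = "\<tau> (arefl a)" let ?q = "vmono (rw a + rw a)"
  have "?t * ?t + ?t - scaleK ?q ?t - scaleK ?q 1 = 0"
    using tau_quadratic[OF assms(1)] by (simp add: algebra_simps flip: K.scale_mult_right)
  then have q: "?t * (?t + 1 - scaleK ?q 1) = scaleK ?q 1" "(?t + 1 - scaleK ?q 1) * ?t = scaleK ?q 1"
    by (simp_all add: algebra_simps flip: K.scale_mult_left K.scale_mult_right)
  show "?t * y = 1" "y * ?t = 1"
    by (simp_all add: y_def q mult_single flip: K.scale_mult_left K.scale_mult_right)
qed

lemma tau_invertible:
  assumes "w \<in> W" shows "\<exists>y. \<tau> w * y = 1 \<and> y * \<tau> w = 1"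
  using assms
proof (induction "len D w" arbitrary: w)
  case 0
  then have "w \<in> Omega D" by (simp add: Omega_def)
  then have "inv\<^bsub>WG\<^esub> w \<in> Omega D" by (rule Omega_inv)
  then have i: "inv\<^bsub>WG\<^esub> w \<in> W" "len D (inv\<^bsub>WG\<^esub> w) = 0" by (simp_all add: Omega_def)
  have "\<tau> w * \<tau> (inv\<^bsub>WG\<^esub> w) = 1" "\<tau> (inv\<^bsub>WG\<^esub> w) * \<tau> w = 1"
    using tau_mult[of w "inv\<^bsub>WG\<^esub> w"] tau_mult[of "inv\<^bsub>WG\<^esub> w" w] 0 i
    by (simp_all add: len_one tau_one)
  then show ?case by blast
next
  case (Suc n)
  obtain a where a: "a \<in> simple_affine" "\<not> apos (act w a)"
    using exists_descent[OF Suc.prems] Suc.hyps(2) by auto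
  let ?w = "w \<otimes>\<^bsub>WG\<^esub> arefl a"
  have "n = len D ?w" using len_down[OF Suc.prems a] Suc.hyps(2) by simp
  then obtain y where y: "\<tau> ?w * y = 1" "y * \<tau> ?w = 1"
    using Suc.hyps(1)[of ?w] Suc.prems a by (auto simp: arefl_closed simple_affine_root)
  obtain z where z: "\<tau> (arefl a) * z = 1" "z * \<tau> (arefl a) = 1" using simple_inverse[OF a(1)] by blast
  have "\<tau> ?w * \<tau> (arefl a) * (z * y) = 1" "z * y * (\<tau> ?w * \<tau> (arefl a)) = 1"
    using y z by (simp_all add: mult_cancel_middle)
  moreover note tau_down[OF Suc.prems a]
  ultimately show ?case by metis
qed

lemma tau_sigma:
  assumes "w \<in> W" shows "\<tau> w * sigma w = 1" "sigma w * \<tau> w = 1"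
  using tau_invertible[OF assms] ring_inverse_eqI unfolding sigma_def by metis+

lemma sigma_eqI: "w \<in> W \<Longrightarrow> \<tau> w * y = 1 \<Longrightarrow> sigma w = y"
  by (metis mult.assoc mult_1_left mult_1_right tau_sigma(2))

lemma sigma_simple:
  "a \<in> simple_affine \<Longrightarrow> sigma (arefl a) =
    scaleK (vmono (- (rw a + rw a))) (\<tau> (arefl a) + 1 - scaleK (vmono (rw a + rw a)) 1)"
  by (rule sigma_eqI[OF arefl_closed[OF simple_affine_root]], assumption, rule simple_inverse)

subsection \<open>Triangularity of quotients\<close>

text \<open>The error terms: combinations over the polynomial ring of the basis elements of length less than \<open>n\<close>.\<close>

definition lower :: "nat \<Rightarrow> 'k set" where
  "lower n = Q.span (\<tau> ` {w \<in> W. len D w < n})"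

lemma lower_mono: "m \<le> n \<Longrightarrow> lower m \<subseteq> lower n"
  unfolding lower_def by (intro Q.span_mono image_mono) auto

lemma tau_lower: "w \<in> W \<Longrightarrow> len D w < n \<Longrightarrow> \<tau> w \<in> lower n"
  unfolding lower_def by (intro Q.span_base) auto

lemma len_Omega_right:
  assumes "w \<in> W" "u \<in> Omega D" shows "len D (w \<otimes>\<^bsub>WG\<^esub> u) = len D w"
proof -
  have u: "u \<in> W" "len D u = 0" "inv\<^bsub>WG\<^esub> u \<in> W" "len D (inv\<^bsub>WG\<^esub> u) = 0"
    using assms(2) Omega_inv[OF assms(2)] by (simp_all add: Omega_def)
  have "w = w \<otimes>\<^bsub>WG\<^esub> u \<otimes>\<^bsub>WG\<^esub> inv\<^bsub>WG\<^esub> u" using assms(1) u by (simp add: WG.m_assoc)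
  then have "len D w \<le> len D (w \<otimes>\<^bsub>WG\<^esub> u)"
    using len_mult_le[of "w \<otimes>\<^bsub>WG\<^esub> u" "inv\<^bsub>WG\<^esub> u"] assms(1) u by simp
  then show ?thesis using len_mult_le[OF assms(1) u(1)] u(2) by simp
qed

lemma WG_cancel_conj:
  assumes "w \<in> W" "v \<in> W" "s \<in> W"
  shows "w \<otimes>\<^bsub>WG\<^esub> inv\<^bsub>WG\<^esub> v \<otimes>\<^bsub>WG\<^esub> (v \<otimes>\<^bsub>WG\<^esub> s \<otimes>\<^bsub>WG\<^esub> inv\<^bsub>WG\<^esub> v) = w \<otimes>\<^bsub>WG\<^esub> s \<otimes>\<^bsub>WG\<^esub> inv\<^bsub>WG\<^esub> v"
proof -
  have "inv\<^bsub>WG\<^esub> v \<otimes>\<^bsub>WG\<^esub> (v \<otimes>\<^bsub>WG\<^esub> c) = c" if "c \<in> W" for c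
    using assms that by (simp flip: WG.m_assoc)
  then show ?thesis using assms by (simp add: WG.m_assoc)
qed

text \<open>Write \<open>w' = v s\<close> with \<open>v\<close> shorter. If \<open>s\<close> also shortens \<open>w\<close>, both factors \<open>T\<^sub>s\<close> cancel together with
  their weights. Otherwise \<open>T\<^sub>w T\<^sub>s\<^sup>-\<^sup>1 = q\<^sub>s\<^sup>-\<^sup>1 (T\<^bsub>w s\<^esub> + (1 - q\<^sub>s) T\<^sub>w)\<close>. The first summand gives the leading
  term. The second one belongs to \<open>x = w v\<^sup>-\<^sup>1\<close>, whereas the normalisation is the one for
  \<open>x t = w w'\<^sup>-\<^sup>1\<close>, with \<open>t = v s v\<^sup>-\<^sup>1\<close> a reflection that lengthens \<open>x\<close>. The quotient of the two
  normalisations is the square root of \<open>q\<^bsub>x t\<^esub> / (q\<^sub>x q\<^sub>s)\<close>, which is a monomial in the \<open>q\<^sub>*\<close> because the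
  weight of \<open>x t\<close> exceeds those of \<open>x\<close> and \<open>s\<close> by a double.\<close>

lemma quotient_triangular:
  assumes "w \<in> W" "w' \<in> W"
  shows "scaleK (vmono (wt (w \<otimes>\<^bsub>WG\<^esub> inv\<^bsub>WG\<^esub> w') + wt w' - wt w)) (\<tau> w * sigma w') - \<tau> (w \<otimes>\<^bsub>WG\<^esub> inv\<^bsub>WG\<^esub> w')
      \<in> lower (len D (w \<otimes>\<^bsub>WG\<^esub> inv\<^bsub>WG\<^esub> w'))"
  using assms
proof (induction "len D w'" arbitrary: w w')
  case 0
  note w = \<open>w \<in> W\<close> \<open>w' \<in> W\<close>
  have "w' \<in> Omega D" using 0 by (simp add: Omega_def)
  then have iO: "inv\<^bsub>WG\<^esub> w' \<in> Omega D" by (rule Omega_inv)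
  then have i: "inv\<^bsub>WG\<^esub> w' \<in> W" "len D (inv\<^bsub>WG\<^esub> w') = 0" by (simp_all add: Omega_def)
  have l: "len D (w \<otimes>\<^bsub>WG\<^esub> inv\<^bsub>WG\<^esub> w') = len D w + len D (inv\<^bsub>WG\<^esub> w')"
    using len_Omega_right[OF w(1) iO] i by simp
  have "\<tau> w' * \<tau> (inv\<^bsub>WG\<^esub> w') = 1"
    using tau_mult[of w' "inv\<^bsub>WG\<^esub> w'"] 0 i by (simp add: len_one tau_one)
  then have "sigma w' = \<tau> (inv\<^bsub>WG\<^esub> w')" by (rule sigma_eqI[OF w(2)])
  moreover have "weight w' = 0" "weight (inv\<^bsub>WG\<^esub> w') = 0" using 0 i by (simp_all add: weight_len_0)
  ultimately show ?case
    using tau_mult[OF w(1) i(1) l] weight_mult[OF w(1) i(1) l]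
    by (simp add: int_exponent_0 lower_def Q.span_zero)
next
  case (Suc n)
  note w = \<open>w \<in> W\<close> \<open>w' \<in> W\<close>
  obtain a where a: "a \<in> simple_affine" "\<not> apos (act w' a)"
    using exists_descent[OF w(2)] Suc.hyps(2) by auto
  note aR = simple_affine_root[OF a(1)]
  let ?s = "arefl a"
  note s = arefl_closed[OF aR]
  let ?v = "w' \<otimes>\<^bsub>WG\<^esub> ?s"
  have v: "?v \<in> W" using w s by simp
  have n: "n = len D ?v" using len_down[OF w(2) a] Suc.hyps(2) by simp
  note IH = Suc.hyps(1)[OF n _ v]
  have w'eq: "w' = ?v \<otimes>\<^bsub>WG\<^esub> ?s" using w by (simp add: arefl_mult_cancel aR)
  have "\<tau> w' = \<tau> ?v * \<tau> ?s" by (rule tau_down[OF w(2) a])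
  then have sig: "sigma w' = sigma ?s * sigma ?v"
    by (intro sigma_eqI[OF w(2)]) (simp add: mult_cancel_middle tau_sigma s v)
  have wt': "wt w' = wt ?v + rw a"
    using weight_down[OF w(2) a] by (simp add: int_exponent_add)
  let ?ws = "w \<otimes>\<^bsub>WG\<^esub> ?s"
  have ws: "?ws \<in> W" using w s by simp
  have sinv: "inv\<^bsub>WG\<^esub> ?s = ?s" by (metis WG.inv_equality s arefl_square[OF aR])
  have prod: "?ws \<otimes>\<^bsub>WG\<^esub> inv\<^bsub>WG\<^esub> ?v = w \<otimes>\<^bsub>WG\<^esub> inv\<^bsub>WG\<^esub> w'"
    using w s by (simp add: WG.inv_mult_group sinv WG.m_assoc)
       (simp add: arefl_square[OF aR] flip: WG.m_assoc)
  show ?case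
  proof (cases "apos (act w a)")
    case False
    have "\<tau> w = \<tau> ?ws * \<tau> ?s" by (rule tau_down[OF w(1) a(1) False])
    then have "\<tau> w * sigma w' = \<tau> ?ws * sigma ?v"
      unfolding sig by (simp add: mult_cancel_middle tau_sigma s)
    moreover have "wt w = wt ?ws + rw a"
      using weight_down[OF w(1) a(1) False] by (simp add: int_exponent_add)
    ultimately show ?thesis using IH[OF ws] by (simp add: prod wt' algebra_simps)
  next
    case True
    let ?x = "w \<otimes>\<^bsub>WG\<^esub> inv\<^bsub>WG\<^esub> ?v" let ?b = "act ?v a"
    have x: "?x \<in> W" using w v by simp
    have b: "?b \<in> affine_roots" "apos ?b"
      using descent_swap[OF w(2) a] act_closed[OF v aR] by auto
    have xb: "act ?x ?b = act w a"
      using w v aR by (simp add: act_mult act_closed act_inv)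
    have xt: "?x \<otimes>\<^bsub>WG\<^esub> arefl ?b = w \<otimes>\<^bsub>WG\<^esub> inv\<^bsub>WG\<^esub> w'"
    proof -
      have "?x \<otimes>\<^bsub>WG\<^esub> arefl ?b = ?x \<otimes>\<^bsub>WG\<^esub> (?v \<otimes>\<^bsub>WG\<^esub> ?s \<otimes>\<^bsub>WG\<^esub> inv\<^bsub>WG\<^esub> ?v)"
        by (simp only: arefl_act[OF v aR])
      also have "\<dots> = ?ws \<otimes>\<^bsub>WG\<^esub> inv\<^bsub>WG\<^esub> ?v"
        by (rule WG_cancel_conj[OF w(1) v s])
      finally show ?thesis using prod by simp
    qed
    have rb: "root_weight ?b = root_weight a" by (rule root_weight_act[OF v aR])
    obtain m where m: "weight (w \<otimes>\<^bsub>WG\<^esub> inv\<^bsub>WG\<^esub> w') = weight ?x + root_weight a + (m + m)"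
      using weight_reflection(1)[OF x b] True xb xt rb by auto
    have lx: "len D ?x < len D (w \<otimes>\<^bsub>WG\<^esub> inv\<^bsub>WG\<^esub> w')"
      using weight_reflection(2)[OF x b] True xb xt by auto
    let ?e = "wt (w \<otimes>\<^bsub>WG\<^esub> inv\<^bsub>WG\<^esub> w') + wt w' - wt w"
    let ?L = "lower (len D (w \<otimes>\<^bsub>WG\<^esub> inv\<^bsub>WG\<^esub> w'))"
    let ?q = "vmono (rw a + rw a)"
    let ?f = "wt ?x + wt ?v - wt w"
    have e1: "?e - (rw a + rw a) = wt (?ws \<otimes>\<^bsub>WG\<^esub> inv\<^bsub>WG\<^esub> ?v) + wt ?v - wt ?ws"
      using weight_up[OF w(1) a(1) True] by (simp add: prod wt' int_exponent_add)
    have e2: "?e - (rw a + rw a) = (int_exponent m + int_exponent m) + ?f"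
      by (simp add: m wt' int_exponent_add)
    have "\<tau> w * sigma w' = \<tau> w * sigma ?s * sigma ?v" by (simp add: sig mult.assoc)
    also have "\<tau> w * sigma ?s = scaleK (vmono (- (rw a + rw a))) (\<tau> ?ws + scaleK (1 - ?q) (\<tau> w))"
      by (simp add: sigma_simple[OF a(1)] tau_up[OF w(1) a(1) True] algebra_simps K.scale_left_diff_distrib
          flip: K.scale_mult_right)
    finally have "scaleK (vmono ?e) (\<tau> w * sigma w') =
        scaleK (vmono ?e * vmono (- (rw a + rw a))) ((\<tau> ?ws + scaleK (1 - ?q) (\<tau> w)) * sigma ?v)"
      by (simp only: K.scale_mult_left[symmetric] K.scale_scale)
    also have "vmono ?e * vmono (- (rw a + rw a)) = vmono (?e - (rw a + rw a))"
      by (simp only: mult_single mult_1_left diff_conv_add_uminus)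
    also have "scaleK (vmono (?e - (rw a + rw a))) ((\<tau> ?ws + scaleK (1 - ?q) (\<tau> w)) * sigma ?v) =
        scaleK (vmono (?e - (rw a + rw a))) (\<tau> ?ws * sigma ?v)
        + scaleK (1 - ?q) (scaleK (vmono (?e - (rw a + rw a))) (\<tau> w * sigma ?v))"
      by (simp only: distrib_right K.scale_right_distrib K.scale_mult_left[symmetric] K.scale_left_commute)
    also have "scaleK (vmono (?e - (rw a + rw a))) (\<tau> w * sigma ?v) =
        scaleK (vmono (int_exponent m + int_exponent m)) (scaleK (vmono ?f) (\<tau> w * sigma ?v))"
      by (simp only: e2 vmono_add K.scale_scale)
    finally have eq: "scaleK (vmono ?e) (\<tau> w * sigma w') =
        scaleK (vmono (wt (?ws \<otimes>\<^bsub>WG\<^esub> inv\<^bsub>WG\<^esub> ?v) + wt ?v - wt ?ws)) (\<tau> ?ws * sigma ?v)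
        + scaleK (qpoly_incl ((1 - q_gen lab ?s) * Poly_Mapping.single m 1)) (scaleK (vmono ?f) (\<tau> w * sigma ?v))"
      unfolding e1 by (simp add: qpoly_incl_mult qpoly_incl_diff qpoly_incl_1 qpoly_incl_gen[OF a(1)] qpoly_incl_single mult.assoc)
    have "scaleK (vmono ?f) (\<tau> w * sigma ?v) - \<tau> ?x \<in> ?L"
      using IH[OF w(1)] lower_mono[of "len D ?x"] lx by (meson less_imp_le subsetD)
    then have "(scaleK (vmono ?f) (\<tau> w * sigma ?v) - \<tau> ?x) + \<tau> ?x \<in> ?L"
      using tau_lower[OF x lx] unfolding lower_def by (rule Q.span_add)
    then have "scaleK (qpoly_incl ((1 - q_gen lab ?s) * Poly_Mapping.single m 1)) (scaleK (vmono ?f) (\<tau> w * sigma ?v)) \<in> ?L"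
      unfolding lower_def by (intro Q.span_scale) simp
    moreover have "scaleK (vmono (wt (?ws \<otimes>\<^bsub>WG\<^esub> inv\<^bsub>WG\<^esub> ?v) + wt ?v - wt ?ws)) (\<tau> ?ws * sigma ?v)
        - \<tau> (w \<otimes>\<^bsub>WG\<^esub> inv\<^bsub>WG\<^esub> w') \<in> ?L"
      using IH[OF ws] by (simp only: prod)
    ultimately have "(scaleK (vmono (wt (?ws \<otimes>\<^bsub>WG\<^esub> inv\<^bsub>WG\<^esub> ?v) + wt ?v - wt ?ws)) (\<tau> ?ws * sigma ?v)
        - \<tau> (w \<otimes>\<^bsub>WG\<^esub> inv\<^bsub>WG\<^esub> w'))
        + scaleK (qpoly_incl ((1 - q_gen lab ?s) * Poly_Mapping.single m 1)) (scaleK (vmono ?f) (\<tau> w * sigma ?v)) \<in> ?L"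
      unfolding lower_def by (intro Q.span_add)
    then show ?thesis unfolding eq by (simp add: algebra_simps)
  qed
qed

subsection \<open>The elements theta\<close>

abbreviation \<theta> :: "'x \<Rightarrow> 'k" where "\<theta> \<equiv> theta D lab scaleK \<tau>"
abbreviation E :: "'x \<Rightarrow> 'k" where "E \<equiv> E_elt D lab scaleK \<tau>"

lemma transl_closed: "transl x \<in> W"
  by (simp add: transl_def W_carrier W0_id)

lemma transl_mult: "transl x \<otimes>\<^bsub>WG\<^esub> transl y = transl (x + y)"
  by (simp add: transl_def W_mult)

lemma len_pair:
  assumes "v \<in> W0"
  shows "len D (v, x) = (\<Sum>\<alpha>\<in>pos_roots D. nat \<bar>(if v \<alpha> \<in> pos_roots D then 0 else 1) + pr x (cr \<alpha>)\<bar>)"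
proof -
  have "{\<alpha> \<in> pos_roots D. v \<alpha> \<in> neg_roots D} = {\<alpha> \<in> pos_roots D. v \<alpha> \<notin> pos_roots D}"
    using neg_roots_iff neg_iff W0_root[OF assms] pos_subset by blast
  moreover have "(\<Sum>\<alpha>\<in>pos_roots D. nat \<bar>(if v \<alpha> \<in> pos_roots D then 0 else 1) + pr x (cr \<alpha>)\<bar>) =
    (\<Sum>\<alpha>\<in>pos_roots D. if v \<alpha> \<in> pos_roots D then nat \<bar>pr x (cr \<alpha>)\<bar> else nat \<bar>1 + pr x (cr \<alpha>)\<bar>)"
    by (intro sum.cong) auto
  ultimately show ?thesis
    by (simp add: sum.If_cases[OF finite_pos] Int_def Collect_neg_eq)
qed

lemma len_transl: "len D (transl x) = (\<Sum>\<alpha>\<in>pos_roots D. nat \<bar>pr x (cr \<alpha>)\<bar>)"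
  unfolding transl_def len_pair[OF W0_id] by (intro sum.cong) auto

text \<open>The length of \<open>v e\<^sup>x\<close> is a sum of absolute values, so it is additive in \<open>x\<close> as soon as the terms for each positive root have the same sign.\<close>

lemma len_pair_add:
  assumes "v \<in> W0"
    and "\<And>\<alpha>. \<alpha> \<in> pos_roots D \<Longrightarrow>
      \<bar>(if v \<alpha> \<in> pos_roots D then 0 else 1) + pr (y + x) (cr \<alpha>)\<bar> =
      \<bar>(if v \<alpha> \<in> pos_roots D then 0 else 1) + pr y (cr \<alpha>)\<bar> + \<bar>pr x (cr \<alpha>)\<bar>"
  shows "len D (v, y + x) = len D (v, y) + len D (transl x)"
proof -
  have "len D (v, y + x) = (\<Sum>\<alpha>\<in>pos_roots D.
      nat \<bar>(if v \<alpha> \<in> pos_roots D then 0 else 1) + pr y (cr \<alpha>)\<bar> + nat \<bar>pr x (cr \<alpha>)\<bar>)"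
    unfolding len_pair[OF assms(1)] using assms(2) by (intro sum.cong refl) (simp only: nat_add_distrib abs_ge_zero)
  also have "\<dots> = len D (v, y) + len D (transl x)"
    unfolding len_pair[OF assms(1)] len_transl by (rule sum.distrib)
  finally show ?thesis .
qed

lemma pair_mult_transl: "v \<in> W0 \<Longrightarrow> (v, y) \<otimes>\<^bsub>WG\<^esub> transl x = (v, y + x)"
  by (simp add: transl_def W_mult)

lemma pair_transl_additive:
  assumes "v \<in> W0" "len D (v, y + x) = len D (v, y) + len D (transl x)"
  shows "\<tau> (v, y + x) = \<tau> (v, y) * \<tau> (transl x)" "wt (v, y + x) = wt (v, y) + wt (transl x)"
proof -
  have c: "(v, y) \<in> W" using assms(1) by (simp add: W_carrier)
  have l: "len D ((v, y) \<otimes>\<^bsub>WG\<^esub> transl x) = len D (v, y) + len D (transl x)"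
    using assms by (simp add: pair_mult_transl)
  show "\<tau> (v, y + x) = \<tau> (v, y) * \<tau> (transl x)"
    using tau_mult[OF c transl_closed l] by (simp add: pair_mult_transl assms(1))
  show "wt (v, y + x) = wt (v, y) + wt (transl x)"
    using weight_mult[OF c transl_closed l] by (simp add: pair_mult_transl assms(1) int_exponent_add)
qed

lemma len_dominant:
  assumes "v \<in> W0" "dominant D y" shows "len D (v, 0 + y) = len D (v, 0) + len D (transl y)"
  by (rule len_pair_add[OF assms(1)]) (use dominant_pos_root[OF assms(2)] in \<open>auto simp: pr_simps\<close>)

lemma len_dominant_add:
  assumes "dominant D y" "dominant D z" shows "len D (id, y + z) = len D (id, y) + len D (transl z)"
  by (rule len_pair_add[OF W0_id])
     (use dominant_pos_root[OF assms(1)] dominant_pos_root[OF assms(2)] in \<open>auto simp: pr_simps\<close>)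

lemma tau_dominant_add:
  assumes "dominant D y" "dominant D z"
  shows "\<tau> (transl (y + z)) = \<tau> (transl y) * \<tau> (transl z)"
    and "wt (transl (y + z)) = wt (transl y) + wt (transl z)"
  using pair_transl_additive[OF W0_id len_dominant_add[OF assms]] by (simp_all add: transl_def)

lemma tau_dominant_commute:
  "dominant D y \<Longrightarrow> dominant D z \<Longrightarrow> \<tau> (transl y) * \<tau> (transl z) = \<tau> (transl z) * \<tau> (transl y)"
  using tau_dominant_add[of y z] tau_dominant_add[of z y] by (simp add: add.commute)

lemma sigma_tau_commute:
  "dominant D y \<Longrightarrow> dominant D z \<Longrightarrow> sigma (transl y) * \<tau> (transl z) = \<tau> (transl z) * sigma (transl y)"
  by (rule inverse_commute[OF tau_sigma[OF transl_closed]]) (rule tau_dominant_commute)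

lemma sigma_dominant_add:
  assumes "dominant D y" "dominant D z"
  shows "sigma (transl (y + z)) = sigma (transl y) * sigma (transl z)"
proof (rule sigma_eqI[OF transl_closed])
  have "\<tau> (transl (y + z)) = \<tau> (transl z) * \<tau> (transl y)"
    using tau_dominant_add[OF assms] tau_dominant_commute[OF assms] by simp
  then show "\<tau> (transl (y + z)) * (sigma (transl y) * sigma (transl z)) = 1"
    by (metis mult.assoc mult_1_right tau_sigma(1)[OF transl_closed])
qed

text \<open>The normalised quotient for a presentation \<open>y - z\<close> of \<open>x\<close>, with the two half-integral powers collected in one monomial.\<close>

definition theta_pair :: "'x \<Rightarrow> 'x \<Rightarrow> 'k" where
  "theta_pair y z = scaleK (vmono (wt (transl z) - wt (transl y))) (\<tau> (transl y) * sigma (transl z))"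

lemma theta_pair_eq:
  assumes "dominant D y" "dominant D z" "dominant D y'" "dominant D z'" "y - z = y' - z'"
  shows "theta_pair y z = theta_pair y' z'"
proof -
  have yz: "y + z' = y' + z" using assms(5) by (simp add: algebra_simps)
  have t: "\<tau> (transl y) * \<tau> (transl z') = \<tau> (transl y') * \<tau> (transl z)"
    using tau_dominant_add(1)[OF assms(1,4)] tau_dominant_add(1)[OF assms(3,2)] yz by simp
  have w: "wt (transl y) + wt (transl z') = wt (transl y') + wt (transl z)"
    using tau_dominant_add(2)[OF assms(1,4)] tau_dominant_add(2)[OF assms(3,2)] yz by simp
  have "\<tau> (transl y) * sigma (transl z) = \<tau> (transl y) * (\<tau> (transl z') * sigma (transl z')) * sigma (transl z)"
    by (simp add: tau_sigma transl_closed)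
  also have "\<dots> = \<tau> (transl y') * \<tau> (transl z) * sigma (transl z') * sigma (transl z)"
    by (simp add: t flip: mult.assoc)
  also have "\<dots> = \<tau> (transl y') * sigma (transl z') * (\<tau> (transl z) * sigma (transl z))"
    by (metis mult.assoc sigma_tau_commute[OF assms(4,2)])
  finally have "\<tau> (transl y) * sigma (transl z) = \<tau> (transl y') * sigma (transl z')"
    by (simp add: tau_sigma transl_closed)
  moreover have "wt (transl z) - wt (transl y) = wt (transl z') - wt (transl y')"
    using w by (simp add: algebra_simps)
  ultimately show ?thesis by (simp add: theta_pair_def)
qed

lemma T_norm_quotient:
  "T_norm D lab scaleK \<tau> (transl y) * ring_inverse (T_norm D lab scaleK \<tau> (transl z)) = theta_pair y z"
proof -
  have n: "T_norm D lab scaleK \<tau> (transl x) = scaleK (vmono (- wt (transl x))) (\<tau> (transl x))" for x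
    by (simp add: T_norm_def q_inv_sqrt_def weight_exponent_eq transl_closed)
  have "ring_inverse (T_norm D lab scaleK \<tau> (transl z)) = scaleK (vmono (wt (transl z))) (sigma (transl z))"
    unfolding n by (rule ring_inverse_eqI) (simp_all add: scaleK_mult mult_single tau_sigma transl_closed)
  then show ?thesis unfolding n by (simp add: theta_pair_def scaleK_mult mult_single)
qed

lemma theta_eq:
  assumes "dominant D y" "dominant D z" shows "\<theta> (y - z) = theta_pair y z"
  unfolding theta_def T_norm_quotient
proof (rule the_equality)
  show "\<exists>y' z'. dominant D y' \<and> dominant D z' \<and> y - z = y' - z' \<and> theta_pair y z = theta_pair y' z'"
    using assms by (intro exI[of _ y] exI[of _ z]) simp
qed (elim exE conjE, simp only: theta_pair_eq[OF assms])

lemma theta_mult: "\<theta> x * \<theta> x' = \<theta> (x + x')"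
proof -
  obtain y z y' z' where d: "dominant D y" "dominant D z" "dominant D y'" "dominant D z'"
    and x: "x = y - z" "x' = y' - z'"
    using dominant_difference by metis
  have "\<theta> x * \<theta> x' = theta_pair y z * theta_pair y' z'" using d x by (simp add: theta_eq)
  also have "\<dots> = theta_pair (y + y') (z + z')"
  proof -
    have "\<tau> (transl y) * sigma (transl z) * (\<tau> (transl y') * sigma (transl z')) =
        \<tau> (transl (y + y')) * sigma (transl (z + z'))"
      using d by (simp add: tau_dominant_add sigma_dominant_add mult_swap_middle sigma_tau_commute)
    then show ?thesis using d
      by (simp add: theta_pair_def scaleK_mult mult_single tau_dominant_add algebra_simps)
  qed
  also have "\<dots> = \<theta> ((y + y') - (z + z'))" using d by (simp add: theta_eq dominant_add)
  finally show ?thesis by (simp add: x algebra_simps)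
qed

lemma transl_zero: "transl 0 = \<one>\<^bsub>WG\<^esub>"
  by (simp add: transl_def W_one)

lemma wt_one: "wt \<one>\<^bsub>WG\<^esub> = 0"
  by (simp add: weight_len_0 len_one int_exponent_0)

lemma theta_zero: "\<theta> 0 = 1"
  using theta_eq[OF dominant_zero dominant_zero] tau_sigma(1)[OF WG.one_closed]
  by (simp add: theta_pair_def transl_zero)

subsection \<open>The integral Bernstein basis\<close>

text \<open>The normalisation is the square root of \<open>q\<^sub>w / q\<^sub>v\<close> for \<open>w = v e\<^sup>x\<close>; for \<open>v = id\<close> the element is \<open>E x\<close>.\<close>

definition bernstein :: "'x weyl \<Rightarrow> 'k" where
  "bernstein w = scaleK (vmono (wt w - wt (fst w, 0))) (\<tau> (fst w, 0) * \<theta> (snd w))"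

lemma E_theta: "E x = scaleK (vmono (wt (transl x))) (\<theta> x)"
  by (simp add: E_elt_def q_sqrt_def weight_exponent_eq transl_closed)

lemma E_eq_bernstein: "E x = bernstein (transl x)"
  by (simp add: E_theta bernstein_def) (simp add: transl_def tau_one wt_one flip: W_one)

text \<open>With \<open>x = y - z\<close>, the product \<open>T\<^sub>v T\<^sub>y\<close> is a single basis element, as \<open>y\<close> is dominant. So \<open>bernstein w\<close> is one of the normalised quotients.\<close>

lemma bernstein_triangular:
  assumes "w \<in> W" shows "bernstein w - \<tau> w \<in> lower (len D w)"
proof -
  obtain v x where w: "w = (v, x)" "v \<in> W0" using assms by (auto simp: W_carrier)
  obtain y z where d: "dominant D y" "dominant D z" "x = y - z" using dominant_difference by metis
  note add = pair_transl_additive[OF w(2) len_dominant[OF w(2) d(1)], simplified]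
  have vy: "(v, y) \<in> W" using w by (simp add: W_carrier)
  have "inv\<^bsub>WG\<^esub> (transl z) = transl (- z)"
    by (rule WG.inv_equality) (simp_all add: transl_mult transl_zero transl_closed)
  then have q: "(v, y) \<otimes>\<^bsub>WG\<^esub> inv\<^bsub>WG\<^esub> (transl z) = w"
    by (simp add: pair_mult_transl w d(3))
  have "bernstein w = scaleK (vmono (wt w + wt (transl z) - wt (v, y))) (\<tau> (v, y) * sigma (transl z))"
    unfolding bernstein_def using theta_eq[OF d(1,2), folded d(3)]
    by (simp add: w(1) theta_pair_def add scaleK_mult mult_single mult.assoc algebra_simps
        flip: K.scale_mult_right)
  then show ?thesis
    using quotient_triangular[OF vy transl_closed[of z]] by (simp add: q)
qed

lemma bernstein_mult:
  assumes "v \<in> W0" "len D (v, y + x) = len D (v, y) + len D (transl x)"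
  shows "bernstein (v, y) * E x = bernstein (v, y + x)"
proof -
  have "wt (v, y) - wt (v, 0) + wt (transl x) = wt (v, y + x) - wt (v, 0)"
    by (simp add: pair_transl_additive[OF assms])
  then show ?thesis
    by (simp only: E_theta bernstein_def scaleK_mult mult_single mult_1_left fst_conv snd_conv mult.assoc theta_mult)
qed

subsection \<open>Coordinates\<close>

lemma tau_inj: "inj_on \<tau> W" and tau_independent: "K.independent (\<tau> ` W)" and tau_span: "K.span (\<tau> ` W) = UNIV"
  using \<iota>_T_basis by (simp_all add: is_basis_def)

definition coord :: "'x weyl \<Rightarrow> 'k \<Rightarrow> 'c vlaurent" where
  "coord w h = K.representation (\<tau> ` W) h (\<tau> w)"

lemma coord_add: "coord w (g + h) = coord w g + coord w h"
  and coord_scale: "coord w (scaleK p h) = p * coord w h"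
  by (simp_all add: coord_def K.representation_add K.representation_scale tau_independent tau_span)

lemma coord_zero: "coord w 0 = 0"
  by (simp add: coord_def K.representation_zero)

lemma coord_sum: "coord w (sum f F) = (\<Sum>i\<in>F. coord w (f i))"
  by (induction F rule: infinite_finite_induct) (simp_all add: coord_add coord_zero)

lemma coord_tau: "v \<in> W \<Longrightarrow> w \<in> W \<Longrightarrow> coord w (\<tau> v) = (if v = w then 1 else 0)"
  using tau_inj by (auto simp: coord_def K.representation_basis tau_independent inj_on_def)

abbreviation integral :: "'c vlaurent set" where "integral \<equiv> range qpoly_incl"

lemma integral_zero: "0 \<in> integral"
  using qpoly_incl_0 by (metis rangeI)

lemma integral_add: "p \<in> integral \<Longrightarrow> q \<in> integral \<Longrightarrow> p + q \<in> integral"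
  and integral_mult: "p \<in> integral \<Longrightarrow> q \<in> integral \<Longrightarrow> p * q \<in> integral"
  and integral_minus: "p \<in> integral \<Longrightarrow> - p \<in> integral"
  by (auto simp flip: qpoly_incl_add qpoly_incl_mult qpoly_incl_uminus)

lemma coord_lower:
  assumes "h \<in> lower n" "w \<in> W"
  shows "coord w h \<in> integral \<and> (n \<le> len D w \<longrightarrow> coord w h = 0)"
  using assms(1) unfolding lower_def
proof (induction rule: Q.span_induct_alt)
  case base
  then show ?case by (simp add: coord_zero integral_zero)
next
  case (step c x y)
  then obtain v where v: "v \<in> W" "len D v < n" "x = \<tau> v" by blast
  then show ?case using step(2) assms(2)
    by (auto simp: coord_add coord_scale coord_tau intro: integral_add)
qed

text \<open>A row of the transition matrix: 1 on the diagonal, polynomial entries, and 0 at all other elements that are at least as long.\<close>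

lemma coord_bernstein:
  assumes "w \<in> W" "w' \<in> W"
  obtains r where "coord w' (bernstein w) = (if w = w' then 1 else 0) + r" "r \<in> integral"
    "len D w \<le> len D w' \<Longrightarrow> r = 0"
proof -
  have "coord w' (bernstein w) = coord w' (\<tau> w + (bernstein w - \<tau> w))" by simp
  also have "\<dots> = (if w = w' then 1 else 0) + coord w' (bernstein w - \<tau> w)"
    by (simp only: coord_add coord_tau[OF assms])
  finally show ?thesis
    using coord_lower[OF bernstein_triangular[OF assms(1)] assms(2)] that by blast
qed

text \<open>Used with \<open>P\<close> the polynomial ring, for integrality, and with \<open>P\<close> zero, for independence. At a longest element whose coefficient is not in \<open>P\<close>, the coordinate of the sum equals that coefficient up to an element of \<open>P\<close>.\<close>

lemma triangular_coefficients:
  assumes P: "0 \<in> P" "\<And>p q. p \<in> P \<Longrightarrow> q \<in> P \<Longrightarrow> p + q \<in> P" "\<And>p. p \<in> P \<Longrightarrow> - p \<in> P"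
      "\<And>p r. p \<in> P \<Longrightarrow> r \<in> integral \<Longrightarrow> p * r \<in> P"
    and F: "finite F" "F \<subseteq> W"
    and g: "\<And>w. w \<in> W \<Longrightarrow> coord w (\<Sum>w\<in>F. scaleK (a w) (bernstein w)) \<in> P"
    and w: "w \<in> F"
  shows "a w \<in> P"
proof (rule ccontr)
  assume "a w \<notin> P"
  let ?F = "{w \<in> F. a w \<notin> P}"
  have fin: "finite (len D ` ?F)" and ne: "len D ` ?F \<noteq> {}" using F(1) w \<open>a w \<notin> P\<close> by (simp, blast)
  obtain w0 where w0: "w0 \<in> ?F" "len D w0 = Max (len D ` ?F)"
    using Max_in[OF fin ne] by auto
  have mx: "len D w \<le> len D w0" if "w \<in> ?F" for w
    using that w0(2) Max_ge[OF fin] by simp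
  have w0W: "w0 \<in> W" "w0 \<in> F" using w0 F by auto
  have "\<forall>w\<in>F. \<exists>r. coord w0 (bernstein w) = (if w = w0 then 1 else 0) + r \<and> r \<in> integral \<and> (len D w \<le> len D w0 \<longrightarrow> r = 0)"
  proof
    fix w assume "w \<in> F"
    then have "w \<in> W" using F(2) by blast
    from coord_bernstein[OF this w0W(1)] show "\<exists>r. coord w0 (bernstein w) = (if w = w0 then 1 else 0) + r \<and> r \<in> integral \<and>
        (len D w \<le> len D w0 \<longrightarrow> r = 0)" by blast
  qed
  then obtain r where r: "\<And>w. w \<in> F \<Longrightarrow> coord w0 (bernstein w) = (if w = w0 then 1 else 0) + r w"
      "\<And>w. w \<in> F \<Longrightarrow> r w \<in> integral" "\<And>w. w \<in> F \<Longrightarrow> len D w \<le> len D w0 \<Longrightarrow> r w = 0"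
    by metis
  have "coord w0 (\<Sum>w\<in>F. scaleK (a w) (bernstein w)) = (\<Sum>w\<in>F. a w * (if w = w0 then 1 else 0) + a w * r w)"
    by (simp add: coord_sum coord_scale r distrib_left)
  also have "\<dots> = a w0 + (\<Sum>w\<in>F. a w * r w)"
    using F(1) w0W by (simp add: sum.distrib if_distrib[of "\<lambda>x. _ * x"] cong: if_cong)
  finally have eq: "a w0 = coord w0 (\<Sum>w\<in>F. scaleK (a w) (bernstein w)) + - (\<Sum>w\<in>F. a w * r w)"
    by simp
  have "a w * r w \<in> P" if "w \<in> F" for w
  proof (cases "a w \<in> P")
    case True then show ?thesis using P(4) r(2) that by blast
  next
    case False then show ?thesis using mx[of w] r(3) that P(1) by simp
  qed
  then have "(\<Sum>w\<in>F. a w * r w) \<in> P"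
    by (induction F rule: infinite_finite_induct) (auto simp: P)
  then have "a w0 \<in> P" by (subst eq) (intro P(2,3) g w0W)
  then show False using w0 by simp
qed

lemma bernstein_independent:
  assumes "finite F" "F \<subseteq> W" "(\<Sum>w\<in>F. scaleK (a w) (bernstein w)) = 0" "w \<in> F"
  shows "a w = 0"
  using triangular_coefficients[of "{0}" F a w] assms by (simp add: coord_zero)

lemma range_iota: "range \<iota> = Q.span (\<tau> ` W)"
proof
  show "range \<iota> \<subseteq> Q.span (\<tau> ` W)"
  proof
    fix k assume "k \<in> range \<iota>"
    then obtain h where k: "k = \<iota> h" by blast
    have "h \<in> H.span (T ` W)" using T_span by simp
    then have "\<iota> h \<in> Q.span (\<tau> ` W)"
    proof (induction rule: H.span_induct_alt)
      case base then show ?case by (simp add: iota_zero Q.span_zero)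
    next
      case (step c x y)
      have "scaleK (qpoly_incl c) (\<iota> x) + \<iota> y \<in> Q.span (\<tau> ` W)"
        by (rule Q.span_add[OF Q.span_scale[OF Q.span_base]]) (use step in auto)
      then show ?case by (simp add: \<iota>_add \<iota>_scale)
    qed
    then show "k \<in> Q.span (\<tau> ` W)" by (simp add: k)
  qed
  have "Q.subspace (range \<iota>)"
    by (rule Q.subspaceI) (auto simp flip: iota_zero \<iota>_add \<iota>_scale)
  then show "Q.span (\<tau> ` W) \<subseteq> range \<iota>" by (intro Q.span_minimal) auto
qed

lemma coord_range_iota:
  assumes "h \<in> range \<iota>" "w \<in> W" shows "coord w h \<in> integral"
  using assms(1) unfolding range_iota
proof (induction rule: Q.span_induct_alt)
  case base then show ?case by (simp add: coord_zero integral_zero)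
next
  case (step c x y)
  then obtain v where "v \<in> W" "x = \<tau> v" by blast
  then show ?case using step(2) assms(2) by (auto simp: coord_add coord_scale coord_tau intro: integral_add)
qed

lemma lower_range: "lower n \<subseteq> range \<iota>"
  unfolding lower_def range_iota by (rule Q.span_mono) blast

lemma bernstein_range: "w \<in> W \<Longrightarrow> bernstein w \<in> range \<iota>"
proof -
  assume w: "w \<in> W"
  have "bernstein w - \<tau> w \<in> Q.span (\<tau> ` W)" using bernstein_triangular[OF w] lower_range range_iota by blast
  then have "(bernstein w - \<tau> w) + \<tau> w \<in> Q.span (\<tau> ` W)"
    using w by (rule Q.span_add[OF _ Q.span_base[OF imageI]])
  then show ?thesis by (simp add: range_iota)
qed

text \<open>Unitriangularity is inverted by induction on the length.\<close>

lemma tau_bernstein_span: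
  assumes "w \<in> W" shows "\<tau> w \<in> Q.span (bernstein ` W)"
  using assms
proof (induction "len D w" arbitrary: w rule: less_induct)
  case less
  have "lower (len D w) \<subseteq> Q.span (bernstein ` W)"
    unfolding lower_def by (rule Q.span_minimal) (use less.hyps in auto)
  then have "bernstein w - \<tau> w \<in> Q.span (bernstein ` W)" using bernstein_triangular[OF less.prems] by blast
  then have "bernstein w - (bernstein w - \<tau> w) \<in> Q.span (bernstein ` W)"
    by (rule Q.span_diff[OF Q.span_base[OF imageI[OF less.prems]]])
  then show ?case by simp
qed

lemma range_iota_bernstein: "range \<iota> = Q.span (bernstein ` W)"
proof
  show "range \<iota> \<subseteq> Q.span (bernstein ` W)"
    unfolding range_iota by (rule Q.span_minimal) (use tau_bernstein_span in auto)
  show "Q.span (bernstein ` W) \<subseteq> range \<iota>"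
    unfolding range_iota by (rule Q.span_minimal) (use bernstein_range range_iota in auto)
qed

subsection \<open>The commutative subalgebra\<close>

abbreviation A :: "'k set" where "A \<equiv> bernstein_subalgebra D lab scaleK \<tau>"

lemma theta_E: "\<theta> x = scaleK (vmono (- wt (transl x))) (E x)"
  by (simp add: E_theta mult_single)

lemma A_eq: "A = K.span (range E)"
proof
  show "A \<subseteq> K.span (range E)" unfolding bernstein_subalgebra_def
    by (rule K.span_minimal) (auto simp only: theta_E image_subset_iff intro: K.span_scale[OF K.span_base] K.subspace_span)
  show "K.span (range E) \<subseteq> A" unfolding bernstein_subalgebra_def
    by (rule K.span_minimal) (auto simp only: E_theta image_subset_iff intro: K.span_scale[OF K.span_base] K.subspace_span)
qed

lemma A_mult:
  assumes "a \<in> A" "b \<in> A" shows "a * b \<in> A"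
proof -
  have th: "\<theta> x * b \<in> A" for x
    using assms(2) unfolding bernstein_subalgebra_def
  proof (induction rule: K.span_induct_alt)
    case base then show ?case by (simp add: K.span_zero)
  next
    case (step c u h)
    then obtain x' where "u = \<theta> x'" by blast
    then have "\<theta> x * (scaleK c u + h) = scaleK c (\<theta> (x + x')) + \<theta> x * h"
      by (simp add: distrib_left theta_mult flip: K.scale_mult_right)
    then show ?case using step K.span_add[OF K.span_scale[OF K.span_base[OF rangeI]], of "\<theta> x * h" \<theta>] by simp
  qed
  show ?thesis using assms(1) unfolding bernstein_subalgebra_def
  proof (induction rule: K.span_induct_alt)
    case base then show ?case by (simp add: K.span_zero)
  next
    case (step c u h)
    then obtain x where "u = \<theta> x" by blast
    then have "(scaleK c u + h) * b = scaleK c (\<theta> x * b) + h * b"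
      by (simp add: distrib_right flip: K.scale_mult_left)
    then show ?case
      using step(2) K.span_add[OF K.span_scale[OF th[unfolded bernstein_subalgebra_def]], of "h * b"] by simp
  qed
qed

lemma inj_transl: "inj_on transl X"
  by (auto simp: inj_on_def transl_def)

lemma sum_transl: "(\<Sum>w\<in>transl ` X. scaleK (f (snd w)) (bernstein w)) = (\<Sum>x\<in>X. scaleK (f x) (E x))"
  by (subst sum.reindex[OF inj_transl]) (simp add: E_eq_bernstein transl_def)

lemma E_independent:
  assumes "finite X" "(\<Sum>x\<in>X. scaleK (f x) (E x)) = 0" "x \<in> X" shows "f x = 0"
proof -
  have "f (snd (transl x)) = 0"
  proof (rule bernstein_independent[where F = "transl ` X" and a = "\<lambda>w. f (snd w)"])
    show "transl ` X \<subseteq> W" using transl_closed by blast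
  qed (use assms in \<open>simp_all add: sum_transl\<close>)
  then show ?thesis by (simp add: transl_def)
qed

lemma E_integral_coefficients:
  assumes "finite X" "(\<Sum>x\<in>X. scaleK (f x) (E x)) \<in> range \<iota>" "x \<in> X" shows "f x \<in> integral"
proof -
  have "(\<lambda>w. f (snd w)) (transl x) \<in> integral"
  proof (rule triangular_coefficients[where F = "transl ` X"])
    show "coord w (\<Sum>w\<in>transl ` X. scaleK (f (snd w)) (bernstein w)) \<in> integral" if "w \<in> W" for w
      unfolding sum_transl by (rule coord_range_iota[OF assms(2) that])
  qed (use assms integral_zero integral_add integral_minus integral_mult transl_closed in auto)
  then show ?thesis by (simp add: transl_def)
qed

lemma inj_E: "inj E"
proof (rule injI, rule ccontr)
  fix x y assume e: "E x = E y" and ne: "x \<noteq> y"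
  have "(\<lambda>z. if z = x then 1 else - 1 :: 'c vlaurent) x = 0"
    by (rule E_independent[where X = "{x, y}"]) (use e ne in auto)
  then show False by simp
qed

lemma E_basis: "is_basis (\<lambda>p. scaleK (qpoly_incl p)) (range \<iota> \<inter> A) UNIV E"
  unfolding is_basis_def
proof (intro conjI)
  show "inj E" by (rule inj_E)
  show "Q.independent (range E)"
    unfolding Q.independent_explicit_module
  proof (intro allI impI)
    fix t u v assume t: "finite t" "t \<subseteq> range E" "(\<Sum>v\<in>t. scaleK (qpoly_incl (u v)) v) = 0" "v \<in> t"
    obtain X where X: "finite X" "t = E ` X" using finite_subset_image[OF t(1,2)] by blast
    obtain x where x: "x \<in> X" "v = E x" using X t(4) by blast
    have "(\<Sum>x\<in>X. scaleK (qpoly_incl (u (E x))) (E x)) = 0"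
      using t(3) inj_E by (simp add: X(2) sum.reindex inj_on_subset)
    then have "qpoly_incl (u (E x)) = 0"
      using E_independent[OF X(1), of "\<lambda>x. qpoly_incl (u (E x))"] x(1) by blast
    then show "u v = 0" by (simp add: x(2) qpoly_incl_eq_0)
  qed
  show "Q.span (range E) = range \<iota> \<inter> A"
  proof
    have "Q.subspace (range \<iota> \<inter> A)"
      unfolding A_eq range_iota
      by (rule Q.subspaceI) (auto intro: Q.span_zero K.span_zero Q.span_add K.span_add Q.span_scale K.span_scale)
    moreover have "range E \<subseteq> range \<iota> \<inter> A"
      using bernstein_range[OF transl_closed] K.span_superset[of "range E"] unfolding A_eq
      by (auto simp only: E_eq_bernstein)
    ultimately show "Q.span (range E) \<subseteq> range \<iota> \<inter> A" by (intro Q.span_minimal)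
    show "range \<iota> \<inter> A \<subseteq> Q.span (range E)"
    proof
      fix h assume h: "h \<in> range \<iota> \<inter> A"
      then obtain t u where t: "finite t" "t \<subseteq> range E" "h = (\<Sum>v\<in>t. scaleK (u v) v)"
        unfolding A_eq K.span_explicit by blast
      obtain X where X: "finite X" "t = E ` X" using finite_subset_image[OF t(1,2)] by blast
      have hX: "h = (\<Sum>x\<in>X. scaleK (u (E x)) (E x))"
        using t(3) inj_E by (simp add: X(2) sum.reindex inj_on_subset)
      have "u (E x) \<in> integral" if "x \<in> X" for x
        by (rule E_integral_coefficients[OF X(1), of "\<lambda>x. u (E x)"]) (use h hX that in auto)
      then have "scaleK (u (E x)) (E x) \<in> Q.span (range E)" if "x \<in> X" for x
        using that Q.span_scale[OF Q.span_base[OF rangeI], of _ E] by force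
      then show "h \<in> Q.span (range E)" unfolding hX by (rule Q.span_sum)
    qed
  qed
qed

lemma HA_subring: "is_subring (range \<iota> \<inter> A)"
  unfolding is_subring_def
proof (intro conjI ballI)
  show "1 \<in> range \<iota> \<inter> A"
    using \<iota>_one theta_zero K.span_base[of "\<theta> 0" "range \<theta>"] by (auto simp: bernstein_subalgebra_def intro: range_eqI[of _ _ 1])
  fix x y assume "x \<in> range \<iota> \<inter> A" "y \<in> range \<iota> \<inter> A"
  then show "x - y \<in> range \<iota> \<inter> A" "x * y \<in> range \<iota> \<inter> A"
    using A_mult[of x y] by (auto simp: bernstein_subalgebra_def K.span_diff simp flip: iota_diff \<iota>_mult)
qed

subsection \<open>Finite generation\<close>

lemma abs_split_of_parts:
  fixes a b :: int
  assumes "nat a \<le> nat b" "nat (- a) \<le> nat (- b)" shows "\<bar>b\<bar> = \<bar>a\<bar> + \<bar>b - a\<bar>"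
  using assms by linarith

text \<open>Dickson's lemma is applied to the positive and negative parts of the integers whose absolute values add up to the length. If both parts for \<open>y\<close> are at most those for \<open>x\<close>, the integers for \<open>y\<close> and the differences to those for \<open>x\<close> have the same signs.\<close>

lemma finite_compatible:
  assumes "v \<in> W0"
  shows "\<exists>F. finite F \<and> (\<forall>x. \<exists>y\<in>F. len D (v, y + (x - y)) = len D (v, y) + len D (transl (x - y)))"
proof -
  let ?z = "\<lambda>x \<alpha>. (if v \<alpha> \<in> pos_roots D then 0 else 1) + pr x (cr \<alpha>)"
  let ?f = "\<lambda>x (\<alpha>, b). if b then nat (?z x \<alpha>) else nat (- ?z x \<alpha>)"
  have "finite (pos_roots D \<times> (UNIV :: bool set))" using finite_pos by simp
  from dickson[OF this, of UNIV ?f] obtain F where F: "finite F"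
    "\<forall>x. \<exists>y\<in>F. \<forall>i\<in>pos_roots D \<times> UNIV. ?f y i \<le> ?f x i" by auto
  have "\<exists>y\<in>F. len D (v, y + (x - y)) = len D (v, y) + len D (transl (x - y))" for x
  proof -
    obtain y where y: "y \<in> F" "\<forall>i\<in>pos_roots D \<times> UNIV. ?f y i \<le> ?f x i" using F(2) by blast
    have "\<bar>?z (y + (x - y)) \<alpha>\<bar> = \<bar>?z y \<alpha>\<bar> + \<bar>pr (x - y) (cr \<alpha>)\<bar>" if a: "\<alpha> \<in> pos_roots D" for \<alpha>
    proof -
      have "nat (?z y \<alpha>) \<le> nat (?z x \<alpha>)" "nat (- ?z y \<alpha>) \<le> nat (- ?z x \<alpha>)"
        using y(2)[rule_format, of "(\<alpha>, True)"] y(2)[rule_format, of "(\<alpha>, False)"] a by simp_all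
      then have "\<bar>?z x \<alpha>\<bar> = \<bar>?z y \<alpha>\<bar> + \<bar>?z x \<alpha> - ?z y \<alpha>\<bar>" by (rule abs_split_of_parts)
      moreover have "?z x \<alpha> - ?z y \<alpha> = pr (x - y) (cr \<alpha>)" by (simp add: pr_simps)
      ultimately show ?thesis by simp
    qed
    then show ?thesis using len_pair_add[OF assms] y(1) by blast
  qed
  then show ?thesis using F(1) by blast
qed

text \<open>Every \<open>bernstein (v, x)\<close> is \<open>bernstein (v, y)\<close> times some \<open>E\<close>, where \<open>y\<close> runs through a finite set depending on \<open>v\<close>. These products span \<open>H\<close>, and the combinations with coefficients in \<open>H \<inter> A\<close> form a submodule over the polynomial ring.\<close>

lemma H_finitely_generated: "fg_right_module (range \<iota>) (range \<iota> \<inter> A)"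
  unfolding fg_right_module_def
proof (intro conjI ballI)
  show "is_subring (range \<iota> \<inter> A)" by (rule HA_subring)
  show "0 \<in> range \<iota>" using iota_zero by (metis rangeI)
  show "x - y \<in> range \<iota>" if "x \<in> range \<iota>" "y \<in> range \<iota>" for x y
    using that by (auto simp flip: iota_diff)
  show "x * a \<in> range \<iota>" if "x \<in> range \<iota>" "a \<in> range \<iota> \<inter> A" for x a
    using that by (auto simp flip: \<iota>_mult)
  obtain F where F: "\<And>v. v \<in> W0 \<Longrightarrow> finite (F v)"
    "\<And>v x. v \<in> W0 \<Longrightarrow> \<exists>y\<in>F v. len D (v, y + (x - y)) = len D (v, y) + len D (transl (x - y))"
    using finite_compatible by metis
  let ?G = "bernstein ` Sigma W0 F"
  have GW: "Sigma W0 F \<subseteq> W" by (auto simp: W_carrier)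
  have finG: "finite ?G" using finite_W0 F(1) by auto
  let ?M = "{\<Sum>f\<in>?G. f * a f | a. \<forall>f\<in>?G. a f \<in> range \<iota> \<inter> A}"
  have span: "Q.span (range E) = range \<iota> \<inter> A" using E_basis by (simp add: is_basis_def)
  have MI: "x \<in> ?M" if "x = (\<Sum>f\<in>?G. f * a f)" "\<forall>f\<in>?G. a f \<in> range \<iota> \<inter> A" for x a
    by (rule CollectI, rule exI, rule conjI) (rule that)+
  have sub: "Q.subspace ?M"
  proof (rule Q.subspaceI)
    show "0 \<in> ?M" using Q.span_zero[of "range E"] by (auto simp: span intro!: exI[of _ "\<lambda>_. 0"])
  next
    fix x y assume "x \<in> ?M" "y \<in> ?M"
    then obtain a b where ab: "\<forall>f\<in>?G. a f \<in> range \<iota> \<inter> A" "\<forall>f\<in>?G. b f \<in> range \<iota> \<inter> A"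
      "x = (\<Sum>f\<in>?G. f * a f)" "y = (\<Sum>f\<in>?G. f * b f)" by blast
    have "x + y = (\<Sum>f\<in>?G. f * (a f + b f))" by (simp add: ab distrib_left sum.distrib)
    moreover have "\<forall>f\<in>?G. a f + b f \<in> range \<iota> \<inter> A"
      using ab Q.span_add[of _ "range E"] unfolding span by blast
    ultimately show "x + y \<in> ?M" by (rule MI)
  next
    fix c x assume "x \<in> ?M"
    then obtain a where a: "\<forall>f\<in>?G. a f \<in> range \<iota> \<inter> A" "x = (\<Sum>f\<in>?G. f * a f)" by blast
    have "scaleK (qpoly_incl c) x = (\<Sum>f\<in>?G. f * scaleK (qpoly_incl c) (a f))"
      by (simp add: a K.scale_sum_right K.scale_mult_right)
    moreover have "\<forall>f\<in>?G. scaleK (qpoly_incl c) (a f) \<in> range \<iota> \<inter> A"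
      using a(1) Q.span_scale[of _ "range E"] unfolding span by blast
    ultimately show "scaleK (qpoly_incl c) x \<in> ?M" by (rule MI)
  qed
  have "bernstein w \<in> ?M" if "w \<in> W" for w
  proof -
    obtain v x where w: "w = (v, x)" "v \<in> W0" using \<open>w \<in> W\<close> by (auto simp: W_carrier)
    obtain y where y: "y \<in> F v" "len D (v, y + (x - y)) = len D (v, y) + len D (transl (x - y))"
      using F(2)[OF w(2)] by blast
    let ?a = "\<lambda>f. if f = bernstein (v, y) then E (x - y) else 0"
    have inG: "bernstein (v, y) \<in> ?G" using w y by blast
    have "(\<Sum>f\<in>?G. f * ?a f) = (\<Sum>f\<in>?G. if f = bernstein (v, y) then f * E (x - y) else 0)"
      by (intro sum.cong) auto
    also have "\<dots> = bernstein (v, y) * E (x - y)"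
      using inG finG by (simp add: sum.delta)
    also have "\<dots> = bernstein w" using bernstein_mult[OF w(2) y(2)] by (simp add: w)
    finally have "bernstein w = (\<Sum>f\<in>?G. f * ?a f)" by simp
    moreover have "\<forall>f\<in>?G. ?a f \<in> range \<iota> \<inter> A"
      using Q.span_base[of "E (x - y)" "range E"] Q.span_zero[of "range E"] unfolding span by auto
    ultimately show ?thesis by (rule MI)
  qed
  then have "Q.span (bernstein ` W) \<subseteq> ?M" by (intro Q.span_minimal sub) auto
  then have M: "range \<iota> \<subseteq> ?M" by (simp only: range_iota_bernstein)
  show "\<exists>F. finite F \<and> F \<subseteq> range \<iota> \<and>
      (\<forall>x\<in>range \<iota>. \<exists>a. (\<forall>f\<in>F. a f \<in> range \<iota> \<inter> A) \<and> x = (\<Sum>f\<in>F. f * a f))"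
  proof (intro exI[of _ ?G] conjI ballI)
    show "finite ?G" by (rule finG)
    show "?G \<subseteq> range \<iota>" using bernstein_range GW by blast
    fix x assume "x \<in> range \<iota>"
    then show "\<exists>a. (\<forall>f\<in>?G. a f \<in> range \<iota> \<inter> A) \<and> x = (\<Sum>f\<in>?G. f * a f)" using M by blast
  qed
qed

end

theorem mainTheorem2:
  fixes D :: "('x::ab_group_add, 'y::ab_group_add) root_datum"
    and lab :: "'x weyl \<Rightarrow> 'c"
    and scaleH :: "'c qpoly \<Rightarrow> 'h::ring_1 \<Rightarrow> 'h"
    and T :: "'x weyl \<Rightarrow> 'h"
    and scaleK :: "'c vlaurent \<Rightarrow> 'k::ring_1 \<Rightarrow> 'k"
    and \<iota> :: "'h \<Rightarrow> 'k"
  assumes "extended_hecke_algebra D lab scaleH T scaleK \<iota>"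
  shows "let A = bernstein_subalgebra D lab scaleK (\<lambda>w. \<iota> (T w));
             E = E_elt D lab scaleK (\<lambda>w. \<iota> (T w))
         in is_basis (\<lambda>p. scaleK (qpoly_incl p)) (range \<iota> \<inter> A) UNIV E \<and>
            fg_right_module (range \<iota>) (range \<iota> \<inter> A)"
proof -
  interpret extended_hecke_algebra D lab scaleH T scaleK \<iota> by (rule assms)
  show ?thesis unfolding Let_def using E_basis H_finitely_generated by blast
qed

end
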